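(* Let $\mathcal{T}$ be a triangulated category endowed with a pre-weight structure $(\mathcal{U}_{\geq 0},\mathcal{U}_{\leq 0})$ with core $\mathcal{C}$. Let $(F,\omega)\colon\mathcal{T}\to\mathcal{T}$ be a triangle endofunctor such that for each object $C\in\mathcal{C}$ there is an isomorphism $\eta_C\colon F(C)\to C$ which is natural in $C\in\mathcal{C}$. Suppose that $\mathcal{T}$ is bi-complete and that $F$ is bi-continuous. Assume that the pre-weight structure $(\mathcal{U}_{\geq 0},\mathcal{U}_{\leq 0})$ is two-sided convergent and that $\mathrm{Hom}_{\mathcal{T}}(\mathcal{C},\Sigma^{-n}(\mathcal{C}))=0$ for any $n\geq 1$. Then for each object $A\in\mathcal{T}$, $F(A)$ is isomorphic to $A$.
   Context: Let $\Sigma$ be the suspension functor of $\mathcal{T}$. For full subcategories $\mathcal{X},\mathcal{Y}$, $\mathcal{X}\ast\mathcal{Y}$ is the full subcategory of objects $Z$ fitting into an exact triangle $X\to Z\to Y\to\Sigma(X)$ with $X\in\mathcal{X}$, $Y\in\mathcal{Y}$; $\mathcal{X}$ is closed under extensions if $\mathcal{X}\ast\mathcal{X}\subseteq\mathcal{X}$. A pre-weight structure on $\mathcal{T}$ is a pair $(\mathcal{U}_{\geq0},\mathcal{U}_{\leq0})$ of full additive subcategories such that (1) $\mathcal{U}_{\geq0}\ast\Sigma(\mathcal{U}_{\leq0})=\mathcal{T}$; (2) $\mathcal{U}_{\geq0}$ is closed under $\Sigma^{-1}$ and extensions; (3) $\mathcal{U}_{\leq0}$ is closed under $\Sigma$ and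 extensions. Its core is $\mathcal{C}=\mathcal{U}_{\geq0}\cap\mathcal{U}_{\leq0}$. Put $\mathcal{U}_{\geq m}=\Sigma^{-m}(\mathcal{U}_{\geq0})$, $\mathcal{U}_{\leq m}=\Sigma^{-m}(\mathcal{U}_{\leq0})$, $\mathcal{U}_{[m,n]}=\mathcal{U}_{\geq m}\cap\mathcal{U}_{\leq n}$ for $m\le n$. A left tower of $X\in\mathcal{U}_{\leq0}$ consists of morphisms $\iota_n\colon X_n\to X$ and $\phi_n\colon X_n\to X_{n+1}$ ($n\geq0$) with $X_n\in\mathcal{U}_{[-n,0]}$, the cone of $\iota_n$ in $\mathcal{U}_{\leq-n-1}$, the cone of $\phi_n$ in $\Sigma^{n+1}(\mathcal{C})$, and $\iota_n=\iota_{n+1}\circ\phi_n$. A right tower of $Y\in\mathcal{U}_{\geq0}$ consists of morphisms $\pi_n\colon Y\to Y_n$ and $\psi_n\colon Y_{n+1}\to Y_n$ ($n\geq0$) with $Y_n\in\mathcal{U}_{[0,n]}$, the cone of $\pi_n$ in $\mathcal{U}_{\geq n}$, the cone of $\psi_n$ in $\Sigma^{-n}(\mathcal{C})$, and $\pi_n=\psi_n\circ\pi_{n+1}$. $\mathcal{T}$ is bi-complete if it has arbitrary coproducts and products. The homotopy colimit of $\{\phi_n\}$ is given by an exact triangle $\coprod X_n\xrightarrow{1-\phi}\coprod X_n\xrightarrow{\gamma}\mathrm{hocolim}\,X_n\to\Sigma(\coprod X_n)$ (where $1-\phi$ restricted to $X_n$ is $({\rm Id}_{X_n},-\phi_n)^t\colon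 X_n\to X_n\oplus X_{n+1}$ followed by the inclusion), and $\gamma_n$ is the restriction of $\gamma$ to $X_n$. The homotopy limit of $\{\psi_n\}$ is given by an exact triangle $\mathrm{holim}\,Y_n\xrightarrow{\sigma}\prod Y_n\xrightarrow{1-\psi}\prod Y_n\to\Sigma(\mathrm{holim}\,Y_n)$ (dually, the $n$-th component of $1-\psi$ is the projection to $Y_n\oplus Y_{n+1}$ followed by $({\rm Id}_{Y_n},-\psi_n)$), and $\sigma_n$ is the $n$-th component of $\sigma$. A left tower is convergent if there is an isomorphism $\kappa\colon\mathrm{hocolim}\,X_n\to X$ with $\kappa\circ\gamma_n=\iota_n$ for all $n$; a right tower is convergent if there is an isomorphism $\lambda\colon Y\to\mathrm{holim}\,Y_n$ with $\sigma_n\circ\lambda=\pi_n$ for all $n$. The pre-weight structure is left (resp. right) convergent if each object of $\mathcal{U}_{\leq0}$ (resp. $\mathcal{U}_{\geq0}$) admits a convergent left (resp. right) tower, and two-sided convergent if it is both. A triangle functor $(F,\omega)$ is an additive functor $F$ with a natural isomorphism $\omega\colon F\Sigma\to\Sigma F$ sending exact triangles to exact triangles. It is bi-continuous if it preserves arbitrary coproducts and products. $\mathrm{Hom}_{\mathcal{T}}(\mathcal{X},\mathcal{Y})=0$ means $\mathrm{Hom}_{\mathcal{T}}(X,Y)=0$ for all $X\in\mathcal{X},Y\in\mathcal{Y}$. *)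

theory Defs
  imports "HOL-Algebra.Group"
begin

section \<open>Additive categories\<close>

record ('o, 'm) cat =
  Ob :: "'o set"
  Ar :: "'m set"
  src :: "'m \<Rightarrow> 'o"
  tgt :: "'m \<Rightarrow> 'o"
  ident :: "'o \<Rightarrow> 'm"
  cmp :: "'m \<Rightarrow> 'm \<Rightarrow> 'm"  (infixl "\<cdot>\<index>" 70)

definition Hom :: "('o, 'm, 'z) cat_scheme \<Rightarrow> 'o \<Rightarrow> 'o \<Rightarrow> 'm set" where
  "Hom T X Y = {f \<in> Ar T. src T f = X \<and> tgt T f = Y}"

text \<open>Composition is written in the usual order: \<open>g \<cdot> f\<close> is \<open>f\<close> followed by \<open>g\<close>.\<close>

locale category =
  fixes T :: "('o, 'm, 'z) cat_scheme" (structure)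
  assumes src_ob: "f \<in> Ar T \<Longrightarrow> src T f \<in> Ob T"
    and tgt_ob: "f \<in> Ar T \<Longrightarrow> tgt T f \<in> Ob T"
    and ident_hom: "X \<in> Ob T \<Longrightarrow> ident T X \<in> Hom T X X"
    and cmp_hom: "f \<in> Hom T X Y \<Longrightarrow> g \<in> Hom T Y Z \<Longrightarrow> g \<cdot> f \<in> Hom T X Z"
    and cmp_assoc: "f \<in> Hom T W X \<Longrightarrow> g \<in> Hom T X Y \<Longrightarrow> h \<in> Hom T Y Z
      \<Longrightarrow> (h \<cdot> g) \<cdot> f = h \<cdot> (g \<cdot> f)"
    and cmp_ident: "f \<in> Hom T X Y \<Longrightarrow> f \<cdot> ident T X = f"
    and ident_cmp: "f \<in> Hom T X Y \<Longrightarrow> ident T Y \<cdot> f = f"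

definition is_iso :: "('o, 'm, 'z) cat_scheme \<Rightarrow> 'o \<Rightarrow> 'o \<Rightarrow> 'm \<Rightarrow> bool" where
  "is_iso T X Y f \<longleftrightarrow> f \<in> Hom T X Y \<and>
     (\<exists>g \<in> Hom T Y X. cmp T g f = ident T X \<and> cmp T f g = ident T Y)"

definition isomorphic :: "('o, 'm, 'z) cat_scheme \<Rightarrow> 'o \<Rightarrow> 'o \<Rightarrow> bool" where
  "isomorphic T X Y \<longleftrightarrow> (\<exists>f. is_iso T X Y f)"

definition zero_object :: "('o, 'm, 'z) cat_scheme \<Rightarrow> 'o \<Rightarrow> bool" where
  "zero_object T Z \<longleftrightarrow> Z \<in> Ob T \<and>
     (\<forall>X \<in> Ob T. (\<exists>!f. f \<in> Hom T X Z) \<and> (\<exists>!f. f \<in> Hom T Z X))"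

definition is_coproduct ::
  "('o, 'm, 'z) cat_scheme \<Rightarrow> 'i set \<Rightarrow> ('i \<Rightarrow> 'o) \<Rightarrow> 'o \<Rightarrow> ('i \<Rightarrow> 'm) \<Rightarrow> bool" where
  "is_coproduct T I X P inn \<longleftrightarrow> P \<in> Ob T \<and> (\<forall>i \<in> I. inn i \<in> Hom T (X i) P) \<and>
     (\<forall>Q \<in> Ob T. \<forall>q. (\<forall>i \<in> I. q i \<in> Hom T (X i) Q) \<longrightarrow>
        (\<exists>!u. u \<in> Hom T P Q \<and> (\<forall>i \<in> I. cmp T u (inn i) = q i)))"

definition is_product ::
  "('o, 'm, 'z) cat_scheme \<Rightarrow> 'i set \<Rightarrow> ('i \<Rightarrow> 'o) \<Rightarrow> 'o \<Rightarrow> ('i \<Rightarrow> 'm) \<Rightarrow> bool" where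
  "is_product T I X P pr \<longleftrightarrow> P \<in> Ob T \<and> (\<forall>i \<in> I. pr i \<in> Hom T P (X i)) \<and>
     (\<forall>Q \<in> Ob T. \<forall>q. (\<forall>i \<in> I. q i \<in> Hom T Q (X i)) \<longrightarrow>
        (\<exists>!u. u \<in> Hom T Q P \<and> (\<forall>i \<in> I. cmp T (pr i) u = q i)))"

text \<open>
  ``Arbitrary'' (co)products are those of all families indexed by subsets of an index type
  \<open>'i\<close>, which bounds the size of the index sets. HOL cannot quantify over types inside a
  formula, so \<open>'i\<close> is a parameter. Statements using these notions must make \<open>'i\<close> infinite,
  since otherwise only finite families are covered.
\<close>

definition bi_complete :: "'i itself \<Rightarrow> ('o, 'm, 'z) cat_scheme \<Rightarrow> bool" where
  "bi_complete _ T \<longleftrightarrow> (\<forall>(I :: 'i set) X. (\<forall>i \<in> I. X i \<in> Ob T) \<longrightarrow>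
     (\<exists>P inn. is_coproduct T I X P inn) \<and> (\<exists>P pr. is_product T I X P pr))"

record ('o, 'm) precat = "('o, 'm) cat" +
  hadd :: "'m \<Rightarrow> 'm \<Rightarrow> 'm"  (infixl "\<boxplus>\<index>" 65)
  hzero :: "'o \<Rightarrow> 'o \<Rightarrow> 'm"

definition hom_group :: "('o, 'm, 'z) precat_scheme \<Rightarrow> 'o \<Rightarrow> 'o \<Rightarrow> 'm monoid" where
  "hom_group T X Y = \<lparr>carrier = Hom T X Y, mult = hadd T, one = hzero T X Y\<rparr>"

definition hneg :: "('o, 'm, 'z) precat_scheme \<Rightarrow> 'm \<Rightarrow> 'm"  ("\<boxminus>\<index> _" [81] 80) where
  "hneg T f = m_inv (hom_group T (src T f) (tgt T f)) f"

definition is_biproduct ::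
  "('o, 'm, 'z) precat_scheme \<Rightarrow> 'o \<Rightarrow> 'o \<Rightarrow> 'o \<Rightarrow> 'm \<Rightarrow> 'm \<Rightarrow> 'm \<Rightarrow> 'm \<Rightarrow> bool" where
  "is_biproduct T X Y P i1 i2 p1 p2 \<longleftrightarrow>
     i1 \<in> Hom T X P \<and> i2 \<in> Hom T Y P \<and> p1 \<in> Hom T P X \<and> p2 \<in> Hom T P Y \<and>
     cmp T p1 i1 = ident T X \<and> cmp T p2 i2 = ident T Y \<and>
     cmp T p1 i2 = hzero T Y X \<and> cmp T p2 i1 = hzero T X Y \<and>
     hadd T (cmp T i1 p1) (cmp T i2 p2) = ident T P"

locale additive_category = category T
  for T :: "('o, 'm, 'z) precat_scheme" (structure) +
  assumes hom_comm_group: "X \<in> Ob T \<Longrightarrow> Y \<in> Ob T \<Longrightarrow> comm_group (hom_group T X Y)"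
    and cmp_add_left: "f \<in> Hom T X Y \<Longrightarrow> g \<in> Hom T Y Z \<Longrightarrow> g' \<in> Hom T Y Z
      \<Longrightarrow> (g \<boxplus> g') \<cdot> f = (g \<cdot> f) \<boxplus> (g' \<cdot> f)"
    and cmp_add_right: "f \<in> Hom T X Y \<Longrightarrow> f' \<in> Hom T X Y \<Longrightarrow> g \<in> Hom T Y Z
      \<Longrightarrow> g \<cdot> (f \<boxplus> f') = (g \<cdot> f) \<boxplus> (g \<cdot> f')"
    and ex_zero_object: "\<exists>Z. zero_object T Z"
    and ex_biproduct: "X \<in> Ob T \<Longrightarrow> Y \<in> Ob T
      \<Longrightarrow> \<exists>P i1 i2 p1 p2. is_biproduct T X Y P i1 i2 p1 p2"

text \<open>Full subcategories are represented by their sets of objects.\<close>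

definition additive_subcategory :: "('o, 'm, 'z) precat_scheme \<Rightarrow> 'o set \<Rightarrow> bool" where
  "additive_subcategory T \<X> \<longleftrightarrow> \<X> \<subseteq> Ob T \<and> (\<exists>Z \<in> \<X>. zero_object T Z) \<and>
     (\<forall>X \<in> \<X>. \<forall>Y \<in> \<X>. \<exists>P \<in> \<X>. \<exists>i1 i2 p1 p2. is_biproduct T X Y P i1 i2 p1 p2)"

definition hom_vanishes :: "('o, 'm, 'z) precat_scheme \<Rightarrow> 'o set \<Rightarrow> 'o set \<Rightarrow> bool" where
  "hom_vanishes T \<X> \<Y> \<longleftrightarrow> (\<forall>X \<in> \<X>. \<forall>Y \<in> \<Y>. Hom T X Y = {hzero T X Y})"

section \<open>Endofunctors\<close>

text \<open>An endofunctor is given by its action \<open>Fo\<close> on objects and \<open>Fm\<close> on morphisms.\<close>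

definition endofunctor :: "('o, 'm, 'z) cat_scheme \<Rightarrow> ('o \<Rightarrow> 'o) \<Rightarrow> ('m \<Rightarrow> 'm) \<Rightarrow> bool" where
  "endofunctor T Fo Fm \<longleftrightarrow>
     (\<forall>X \<in> Ob T. Fo X \<in> Ob T \<and> Fm (ident T X) = ident T (Fo X)) \<and>
     (\<forall>X Y. \<forall>f \<in> Hom T X Y. Fm f \<in> Hom T (Fo X) (Fo Y)) \<and>
     (\<forall>X Y Z. \<forall>f \<in> Hom T X Y. \<forall>g \<in> Hom T Y Z. Fm (cmp T g f) = cmp T (Fm g) (Fm f))"

definition additive_endofunctor ::
  "('o, 'm, 'z) precat_scheme \<Rightarrow> ('o \<Rightarrow> 'o) \<Rightarrow> ('m \<Rightarrow> 'm) \<Rightarrow> bool" where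
  "additive_endofunctor T Fo Fm \<longleftrightarrow> endofunctor T Fo Fm \<and>
     (\<forall>X Y. \<forall>f \<in> Hom T X Y. \<forall>g \<in> Hom T X Y. Fm (hadd T f g) = hadd T (Fm f) (Fm g))"

text \<open>
  \<open>\<tau>\<close> is a natural isomorphism from \<open>F\<close> to \<open>G\<close>, both restricted to the full subcategory \<open>\<X>\<close>.
\<close>

definition natural_iso_on ::
  "('o, 'm, 'z) cat_scheme \<Rightarrow> 'o set \<Rightarrow> ('o \<Rightarrow> 'o) \<Rightarrow> ('m \<Rightarrow> 'm) \<Rightarrow> ('o \<Rightarrow> 'o) \<Rightarrow> ('m \<Rightarrow> 'm)
    \<Rightarrow> ('o \<Rightarrow> 'm) \<Rightarrow> bool" where
  "natural_iso_on T \<X> Fo Fm Go Gm \<tau> \<longleftrightarrow>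
     (\<forall>X \<in> \<X>. is_iso T (Fo X) (Go X) (\<tau> X)) \<and>
     (\<forall>X \<in> \<X>. \<forall>Y \<in> \<X>. \<forall>f \<in> Hom T X Y. cmp T (\<tau> Y) (Fm f) = cmp T (Gm f) (\<tau> X))"

definition quasi_inverse ::
  "('o, 'm, 'z) cat_scheme \<Rightarrow> ('o \<Rightarrow> 'o) \<Rightarrow> ('m \<Rightarrow> 'm) \<Rightarrow> ('o \<Rightarrow> 'o) \<Rightarrow> ('m \<Rightarrow> 'm) \<Rightarrow> bool" where
  "quasi_inverse T Fo Fm Go Gm \<longleftrightarrow>
     (\<exists>\<eta>. natural_iso_on T (Ob T) id id (Go \<circ> Fo) (Gm \<circ> Fm) \<eta>) \<and>
     (\<exists>\<epsilon>. natural_iso_on T (Ob T) (Fo \<circ> Go) (Fm \<circ> Gm) id id \<epsilon>)"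

definition bi_continuous ::
  "'i itself \<Rightarrow> ('o, 'm, 'z) cat_scheme \<Rightarrow> ('o \<Rightarrow> 'o) \<Rightarrow> ('m \<Rightarrow> 'm) \<Rightarrow> bool" where
  "bi_continuous _ T Fo Fm \<longleftrightarrow>
     (\<forall>(I :: 'i set) X P inn. is_coproduct T I X P inn
        \<longrightarrow> is_coproduct T I (Fo \<circ> X) (Fo P) (Fm \<circ> inn)) \<and>
     (\<forall>(I :: 'i set) X P pr. is_product T I X P pr
        \<longrightarrow> is_product T I (Fo \<circ> X) (Fo P) (Fm \<circ> pr))"

section \<open>Triangulated categories\<close>

text \<open>
  The suspension \<open>\<Sigma>\<close> is \<open>sus_ob\<close>, \<open>sus_ar\<close>. It is only required to be an autoequivalence, with a
  chosen quasi-inverse \<open>\<Sigma>\<^sup>-\<^sup>1\<close> given by \<open>des_ob\<close>, \<open>des_ar\<close>; an automorphism is the special case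
  of a strict inverse. An element \<open>(f, g, h)\<close> of \<open>tri\<close> is an exact triangle, whose objects are
  recovered from the sources and targets of \<open>f\<close>, \<open>g\<close> and \<open>h\<close>.
\<close>

record ('o, 'm) tricat = "('o, 'm) precat" +
  sus_ob :: "'o \<Rightarrow> 'o"
  sus_ar :: "'m \<Rightarrow> 'm"
  des_ob :: "'o \<Rightarrow> 'o"
  des_ar :: "'m \<Rightarrow> 'm"
  tri :: "('m \<times> 'm \<times> 'm) set"

definition is_triangle ::
  "('o, 'm, 'z) tricat_scheme \<Rightarrow> 'o \<Rightarrow> 'o \<Rightarrow> 'o \<Rightarrow> 'm \<Rightarrow> 'm \<Rightarrow> 'm \<Rightarrow> bool" where
  "is_triangle T X Y Z f g h \<longleftrightarrow>
     f \<in> Hom T X Y \<and> g \<in> Hom T Y Z \<and> h \<in> Hom T Z (sus_ob T X)"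

definition exact_triangle ::
  "('o, 'm, 'z) tricat_scheme \<Rightarrow> 'o \<Rightarrow> 'o \<Rightarrow> 'o \<Rightarrow> 'm \<Rightarrow> 'm \<Rightarrow> 'm \<Rightarrow> bool" where
  "exact_triangle T X Y Z f g h \<longleftrightarrow> is_triangle T X Y Z f g h \<and> (f, g, h) \<in> tri T"

locale triangulated_category = additive_category T
  for T :: "('o, 'm, 'z) tricat_scheme" (structure) +
  assumes sus_functor: "additive_endofunctor T (sus_ob T) (sus_ar T)"
    and des_functor: "additive_endofunctor T (des_ob T) (des_ar T)"
    and sus_des: "quasi_inverse T (sus_ob T) (sus_ar T) (des_ob T) (des_ar T)"
    and tri_is_triangle: "(f, g, h) \<in> tri T \<Longrightarrow> \<exists>X Y Z. is_triangle T X Y Z f g h"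
    and TR1_iso: "exact_triangle T X Y Z f g h \<Longrightarrow> is_triangle T X' Y' Z' f' g' h'
      \<Longrightarrow> is_iso T X X' a \<Longrightarrow> is_iso T Y Y' b \<Longrightarrow> is_iso T Z Z' c
      \<Longrightarrow> b \<cdot> f = f' \<cdot> a \<Longrightarrow> c \<cdot> g = g' \<cdot> b \<Longrightarrow> sus_ar T a \<cdot> h = h' \<cdot> c
      \<Longrightarrow> exact_triangle T X' Y' Z' f' g' h'"
    and TR1_ident: "X \<in> Ob T \<Longrightarrow> zero_object T Z
      \<Longrightarrow> exact_triangle T X X Z (ident T X) (hzero T X Z) (hzero T Z (sus_ob T X))"
    and TR1_cone: "f \<in> Hom T X Y \<Longrightarrow> \<exists>Z g h. exact_triangle T X Y Z f g h"
    and TR2: "is_triangle T X Y Z f g h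
      \<Longrightarrow> exact_triangle T X Y Z f g h \<longleftrightarrow>
          exact_triangle T Y Z (sus_ob T X) g h (\<boxminus> (sus_ar T f))"
    and TR3: "exact_triangle T X Y Z f g h \<Longrightarrow> exact_triangle T X' Y' Z' f' g' h'
      \<Longrightarrow> a \<in> Hom T X X' \<Longrightarrow> b \<in> Hom T Y Y' \<Longrightarrow> b \<cdot> f = f' \<cdot> a
      \<Longrightarrow> \<exists>c \<in> Hom T Z Z'. c \<cdot> g = g' \<cdot> b \<and> sus_ar T a \<cdot> h = h' \<cdot> c"
    and TR4: "exact_triangle T X Y Z' f f' f'' \<Longrightarrow> exact_triangle T Y Z X' g g' g''
      \<Longrightarrow> exact_triangle T X Z Y' (g \<cdot> f) h' h''
      \<Longrightarrow> \<exists>u v. exact_triangle T Z' Y' X' u v (sus_ar T f' \<cdot> g'') \<and>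
             u \<cdot> f' = h' \<cdot> g \<and> h'' \<cdot> u = f'' \<and> v \<cdot> h' = g' \<and> g'' \<cdot> v = sus_ar T f \<cdot> h''"

text \<open>\<open>\<omega>\<close> is the family of isomorphisms \<open>\<omega> X : F (\<Sigma> X) \<rightarrow> \<Sigma> (F X)\<close>.\<close>

definition triangle_endofunctor ::
  "('o, 'm, 'z) tricat_scheme \<Rightarrow> ('o \<Rightarrow> 'o) \<Rightarrow> ('m \<Rightarrow> 'm) \<Rightarrow> ('o \<Rightarrow> 'm) \<Rightarrow> bool" where
  "triangle_endofunctor T Fo Fm \<omega> \<longleftrightarrow> additive_endofunctor T Fo Fm \<and>
     natural_iso_on T (Ob T) (Fo \<circ> sus_ob T) (Fm \<circ> sus_ar T) (sus_ob T \<circ> Fo) (sus_ar T \<circ> Fm) \<omega> \<and>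
     (\<forall>X Y Z f g h. exact_triangle T X Y Z f g h \<longrightarrow>
        exact_triangle T (Fo X) (Fo Y) (Fo Z) (Fm f) (Fm g) (cmp T (\<omega> X) (Fm h)))"

text \<open>
  \<open>shift T n \<X>\<close> is the full subcategory \<open>\<Sigma>\<^sup>n(\<X>)\<close>, read as an essential image: since \<open>\<Sigma>\<close> is only
  an autoequivalence, it is closed under isomorphism.
\<close>

definition shift_ob :: "('o, 'm, 'z) tricat_scheme \<Rightarrow> int \<Rightarrow> 'o \<Rightarrow> 'o" where
  "shift_ob T n X = (if 0 \<le> n then (sus_ob T ^^ nat n) X else (des_ob T ^^ nat (- n)) X)"

definition shift :: "('o, 'm, 'z) tricat_scheme \<Rightarrow> int \<Rightarrow> 'o set \<Rightarrow> 'o set" where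
  "shift T n \<X> = {Z \<in> Ob T. \<exists>X \<in> \<X>. isomorphic T Z (shift_ob T n X)}"

definition ext_product :: "('o, 'm, 'z) tricat_scheme \<Rightarrow> 'o set \<Rightarrow> 'o set \<Rightarrow> 'o set" where
  "ext_product T \<X> \<Y> = {Z. \<exists>X \<in> \<X>. \<exists>Y \<in> \<Y>. \<exists>f g h. exact_triangle T X Z Y f g h}"

definition cone_in :: "('o, 'm, 'z) tricat_scheme \<Rightarrow> 'm \<Rightarrow> 'o set \<Rightarrow> bool" where
  "cone_in T f \<X> \<longleftrightarrow> (\<exists>Z \<in> \<X>. \<exists>g h. exact_triangle T (src T f) (tgt T f) Z f g h)"

section \<open>Pre-weight structures\<close>

definition pre_weight_structure :: "('o, 'm, 'z) tricat_scheme \<Rightarrow> 'o set \<Rightarrow> 'o set \<Rightarrow> bool" where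
  "pre_weight_structure T Uge Ule \<longleftrightarrow>
     additive_subcategory T Uge \<and> additive_subcategory T Ule \<and>
     ext_product T Uge (shift T 1 Ule) = Ob T \<and>
     shift T (- 1) Uge \<subseteq> Uge \<and> ext_product T Uge Uge \<subseteq> Uge \<and>
     shift T 1 Ule \<subseteq> Ule \<and> ext_product T Ule Ule \<subseteq> Ule"

definition core :: "'o set \<Rightarrow> 'o set \<Rightarrow> 'o set" where
  "core Uge Ule = Uge \<inter> Ule"

definition U_ge :: "('o, 'm, 'z) tricat_scheme \<Rightarrow> 'o set \<Rightarrow> int \<Rightarrow> 'o set" where
  "U_ge T Uge m = shift T (- m) Uge"

definition U_le :: "('o, 'm, 'z) tricat_scheme \<Rightarrow> 'o set \<Rightarrow> int \<Rightarrow> 'o set" where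
  "U_le T Ule m = shift T (- m) Ule"

definition U_between ::
  "('o, 'm, 'z) tricat_scheme \<Rightarrow> 'o set \<Rightarrow> 'o set \<Rightarrow> int \<Rightarrow> int \<Rightarrow> 'o set" where
  "U_between T Uge Ule m n = U_ge T Uge m \<inter> U_le T Ule n"

definition left_tower ::
  "('o, 'm, 'z) tricat_scheme \<Rightarrow> 'o set \<Rightarrow> 'o set \<Rightarrow> 'o \<Rightarrow> (nat \<Rightarrow> 'o) \<Rightarrow> (nat \<Rightarrow> 'm) \<Rightarrow> (nat \<Rightarrow> 'm)
    \<Rightarrow> bool" where
  "left_tower T Uge Ule X Xs \<iota> \<phi> \<longleftrightarrow> X \<in> Ule \<and>
     (\<forall>n. \<iota> n \<in> Hom T (Xs n) X \<and> \<phi> n \<in> Hom T (Xs n) (Xs (Suc n)) \<and>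
          Xs n \<in> U_between T Uge Ule (- int n) 0 \<and>
          cone_in T (\<iota> n) (U_le T Ule (- int n - 1)) \<and>
          cone_in T (\<phi> n) (shift T (int n + 1) (core Uge Ule)) \<and>
          \<iota> n = cmp T (\<iota> (Suc n)) (\<phi> n))"

definition right_tower ::
  "('o, 'm, 'z) tricat_scheme \<Rightarrow> 'o set \<Rightarrow> 'o set \<Rightarrow> 'o \<Rightarrow> (nat \<Rightarrow> 'o) \<Rightarrow> (nat \<Rightarrow> 'm) \<Rightarrow> (nat \<Rightarrow> 'm)
    \<Rightarrow> bool" where
  "right_tower T Uge Ule Y Ys \<pi> \<psi> \<longleftrightarrow> Y \<in> Uge \<and>
     (\<forall>n. \<pi> n \<in> Hom T Y (Ys n) \<and> \<psi> n \<in> Hom T (Ys (Suc n)) (Ys n) \<and>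
          Ys n \<in> U_between T Uge Ule 0 (int n) \<and>
          cone_in T (\<pi> n) (U_ge T Uge (int n)) \<and>
          cone_in T (\<psi> n) (shift T (- int n) (core Uge Ule)) \<and>
          \<pi> n = cmp T (\<psi> n) (\<pi> (Suc n)))"

text \<open>
  \<open>H\<close> with the morphisms \<open>\<gamma> n : X n \<rightarrow> H\<close> is a homotopy colimit of \<open>\<phi> n : X n \<rightarrow> X (n + 1)\<close>;
  \<open>d\<close> is the morphism \<open>1 - \<phi>\<close>, determined by its restrictions to the summands. Dually for
  homotopy limits. Both are unique only up to (non-unique) isomorphism, so they are relations.
\<close>

definition is_hocolim ::
  "('o, 'm, 'z) tricat_scheme \<Rightarrow> (nat \<Rightarrow> 'o) \<Rightarrow> (nat \<Rightarrow> 'm) \<Rightarrow> 'o \<Rightarrow> (nat \<Rightarrow> 'm) \<Rightarrow> bool" where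
  "is_hocolim T Xs \<phi> H \<gamma> \<longleftrightarrow> (\<exists>P inn d c h.
     is_coproduct T UNIV Xs P inn \<and>
     (\<forall>n. cmp T d (inn n) = hadd T (inn n) (hneg T (cmp T (inn (Suc n)) (\<phi> n)))) \<and>
     exact_triangle T P P H d c h \<and>
     (\<forall>n. \<gamma> n = cmp T c (inn n)))"

definition is_holim ::
  "('o, 'm, 'z) tricat_scheme \<Rightarrow> (nat \<Rightarrow> 'o) \<Rightarrow> (nat \<Rightarrow> 'm) \<Rightarrow> 'o \<Rightarrow> (nat \<Rightarrow> 'm) \<Rightarrow> bool" where
  "is_holim T Ys \<psi> H \<sigma> \<longleftrightarrow> (\<exists>P pr s d h.
     is_product T UNIV Ys P pr \<and>
     (\<forall>n. cmp T (pr n) d = hadd T (pr n) (hneg T (cmp T (\<psi> n) (pr (Suc n))))) \<and>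
     exact_triangle T H P P s d h \<and>
     (\<forall>n. \<sigma> n = cmp T (pr n) s))"

definition left_tower_convergent ::
  "('o, 'm, 'z) tricat_scheme \<Rightarrow> 'o \<Rightarrow> (nat \<Rightarrow> 'o) \<Rightarrow> (nat \<Rightarrow> 'm) \<Rightarrow> (nat \<Rightarrow> 'm) \<Rightarrow> bool" where
  "left_tower_convergent T X Xs \<iota> \<phi> \<longleftrightarrow>
     (\<exists>H \<gamma> \<kappa>. is_hocolim T Xs \<phi> H \<gamma> \<and> is_iso T H X \<kappa> \<and> (\<forall>n. cmp T \<kappa> (\<gamma> n) = \<iota> n))"

definition right_tower_convergent ::
  "('o, 'm, 'z) tricat_scheme \<Rightarrow> 'o \<Rightarrow> (nat \<Rightarrow> 'o) \<Rightarrow> (nat \<Rightarrow> 'm) \<Rightarrow> (nat \<Rightarrow> 'm) \<Rightarrow> bool" where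
  "right_tower_convergent T Y Ys \<pi> \<psi> \<longleftrightarrow>
     (\<exists>H \<sigma> l. is_holim T Ys \<psi> H \<sigma> \<and> is_iso T Y H l \<and> (\<forall>n. cmp T (\<sigma> n) l = \<pi> n))"

definition left_convergent :: "('o, 'm, 'z) tricat_scheme \<Rightarrow> 'o set \<Rightarrow> 'o set \<Rightarrow> bool" where
  "left_convergent T Uge Ule \<longleftrightarrow> (\<forall>X \<in> Ule. \<exists>Xs \<iota> \<phi>.
     left_tower T Uge Ule X Xs \<iota> \<phi> \<and> left_tower_convergent T X Xs \<iota> \<phi>)"

definition right_convergent :: "('o, 'm, 'z) tricat_scheme \<Rightarrow> 'o set \<Rightarrow> 'o set \<Rightarrow> bool" where
  "right_convergent T Uge Ule \<longleftrightarrow> (\<forall>Y \<in> Uge. \<exists>Ys \<pi> \<psi>.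
     right_tower T Uge Ule Y Ys \<pi> \<psi> \<and> right_tower_convergent T Y Ys \<pi> \<psi>)"

definition two_sided_convergent :: "('o, 'm, 'z) tricat_scheme \<Rightarrow> 'o set \<Rightarrow> 'o set \<Rightarrow> bool" where
  "two_sided_convergent T Uge Ule \<longleftrightarrow> left_convergent T Uge Ule \<and> right_convergent T Uge Ule"

end

theory Submission
  imports Defs
begin

text \<open>
  Write \<open>D k = \<Sigma>\<^sup>k(\<C>)\<close>. The natural isomorphism \<open>\<eta>\<close> on the core extends to a \<open>\<Sigma>\<close>-compatible family
  of natural isomorphisms \<open>E k\<close> on all \<open>D k\<close>, and \<open>Hom(D i, D j) = 0\<close> for \<open>i > j\<close>. By this vanishing,
  isomorphisms \<open>F(X\<^sub>n) \<rightarrow> X\<^sub>n\<close> can be chosen inductively along a left or right tower, compatibly with the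
  tower. As \<open>F\<close> preserves homotopy colimits and limits, convergence yields isomorphisms
  \<open>F(X) \<rightarrow> X\<close> and \<open>F(Y) \<rightarrow> Y\<close> for \<open>X \<in> \<U>\<^sub>\<le>\<^sub>0\<close>, \<open>Y \<in> \<U>\<^sub>\<ge>\<^sub>0\<close>, compatible with \<open>\<iota>\<^sub>0\<close> and \<open>\<pi>\<^sub>0\<close>. An arbitrary
  \<open>A\<close> is the cone of some \<open>w : X \<rightarrow> Y\<close>, and these isomorphisms commute with \<open>w\<close>: the same vanishing
  makes \<open>f \<mapsto> \<pi>\<^sub>0 f \<iota>\<^sub>0\<close> injective on \<open>Hom(X, Y)\<close>, and \<open>\<pi>\<^sub>0 w \<iota>\<^sub>0\<close> is a morphism in the core, where
  \<open>\<eta>\<close> is natural. The axiom TR3 then gives \<open>F(A) \<cong> A\<close>.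
\<close>

section \<open>Additive categories\<close>

text \<open>The obstacle is that cones are not functorial: TR3 supplies fill-ins without uniqueness,
  so an isomorphism chosen at one stage of a tower need not be natural, and nothing would then
  guarantee the square needed at the next stage. The induction therefore carries naturality in a
  single degree: against morphisms from \<open>\<Sigma>\<^sup>n(\<C>)\<close> to the n-th stage of a
  left tower, and against morphisms from the n-th stage of a right tower to
  \<open>\<Sigma>\<^sup>-\<^sup>n(\<C>)\<close>. Up to suspension, the attaching morphisms are of
  exactly this kind. Injectivity of \<open>f \<mapsto> \<pi>\<^sub>0 f \<iota>\<^sub>0\<close> has
  two obstructions, one for each cone: morphisms from an object of
  \<open>\<Sigma>(\<U>\<^sub>\<le>\<^sub>0)\<close>, the cone of \<open>\<iota>\<^sub>0\<close>, to
  \<open>Y\<close>, and morphisms from \<open>\<Sigma>(X\<^sub>0)\<close> to an object of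
  \<open>\<U>\<^sub>\<ge>\<^sub>0\<close>, the cone of \<open>\<pi>\<^sub>0\<close>. Convergence
  reduces the vanishing of both to the core. As \<open>\<Sigma>\<close> is only an autoequivalence,
  objects of \<open>D k\<close> are suspensions only up to isomorphism. Arguments in lower degrees
  are therefore run after applying \<open>\<Sigma>\<close> and brought back by its full
  faithfulness.\<close>

context category
begin

lemma HomD:
  assumes "f \<in> Hom T X Y"
  shows "f \<in> Ar T" "src T f = X" "tgt T f = Y" "X \<in> Ob T" "Y \<in> Ob T"
  using assms src_ob tgt_ob by (auto simp: Hom_def)

lemma HomI: "f \<in> Ar T \<Longrightarrow> src T f = X \<Longrightarrow> tgt T f = Y \<Longrightarrow> f \<in> Hom T X Y"
  by (simp add: Hom_def)

lemma cmp_Ar: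
  assumes "f \<in> Ar T" "g \<in> Ar T" "tgt T f = src T g"
  shows "g \<cdot> f \<in> Ar T" "src T (g \<cdot> f) = src T f" "tgt T (g \<cdot> f) = tgt T g"
  using cmp_hom[OF HomI[OF assms(1) refl refl] HomI[OF assms(2) assms(3)[symmetric] refl]]
  by (auto simp: Hom_def)

lemma assoc:
  assumes "f \<in> Ar T" "g \<in> Ar T" "h \<in> Ar T" "tgt T f = src T g" "tgt T g = src T h"
  shows "(h \<cdot> g) \<cdot> f = h \<cdot> (g \<cdot> f)"
  using assms by (intro cmp_assoc[of f "src T f" "tgt T f" g "tgt T g" h "tgt T h"]) (auto simp: Hom_def)

lemma ident_Ar:
  assumes "X \<in> Ob T"
  shows "ident T X \<in> Ar T" "src T (ident T X) = X" "tgt T (ident T X) = X"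
  using ident_hom[OF assms] by (auto simp: Hom_def)

lemma ident_cmp': "f \<in> Ar T \<Longrightarrow> tgt T f = Y \<Longrightarrow> ident T Y \<cdot> f = f"
  by (rule ident_cmp[of f "src T f" Y]) (auto simp: Hom_def)

lemma cmp_ident': "f \<in> Ar T \<Longrightarrow> src T f = X \<Longrightarrow> f \<cdot> ident T X = f"
  by (rule cmp_ident[of f X "tgt T f"]) (auto simp: Hom_def)

lemmas cat_simps = cmp_Ar assoc ident_Ar ident_cmp' cmp_ident' src_ob tgt_ob

text \<open>Makes an equation between composites applicable inside right-associated composites.\<close>

lemma eq_assoc:
  assumes "g \<cdot> f = k" "f \<in> Ar T" "g \<in> Ar T" "tgt T f = src T g" "x \<in> Ar T" "tgt T x = src T f"
  shows "g \<cdot> (f \<cdot> x) = k \<cdot> x"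
  using assms assoc by metis

lemma is_isoE:
  assumes "is_iso T X Y f"
  obtains g where "f \<in> Hom T X Y" "g \<in> Hom T Y X" "g \<cdot> f = ident T X" "f \<cdot> g = ident T Y"
  using assms by (auto simp: is_iso_def)

lemma is_iso_hom: "is_iso T X Y f \<Longrightarrow> f \<in> Hom T X Y"
  by (simp add: is_iso_def)

lemma is_isoI:
  "f \<in> Hom T X Y \<Longrightarrow> g \<in> Hom T Y X \<Longrightarrow> g \<cdot> f = ident T X \<Longrightarrow> f \<cdot> g = ident T Y \<Longrightarrow> is_iso T X Y f"
  by (auto simp: is_iso_def)

lemma ident_is_iso: "X \<in> Ob T \<Longrightarrow> is_iso T X X (ident T X)"
  by (rule is_isoI[of _ _ _ "ident T X"]) (auto simp: ident_hom cat_simps)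

lemma is_iso_cmp:
  assumes "is_iso T X Y f" "is_iso T Y Z g"
  shows "is_iso T X Z (g \<cdot> f)"
proof -
  obtain f' where f: "f \<in> Hom T X Y" "f' \<in> Hom T Y X" "f' \<cdot> f = ident T X" "f \<cdot> f' = ident T Y"
    using assms(1) by (rule is_isoE)
  obtain g' where g: "g \<in> Hom T Y Z" "g' \<in> Hom T Z Y" "g' \<cdot> g = ident T Y" "g \<cdot> g' = ident T Z"
    using assms(2) by (rule is_isoE)
  note h = HomD[OF f(1)] HomD[OF f(2)] HomD[OF g(1)] HomD[OF g(2)]
  have "(f' \<cdot> g') \<cdot> (g \<cdot> f) = ident T X"
    by (simp add: cat_simps h f(3) eq_assoc[OF g(3)])
  moreover have "(g \<cdot> f) \<cdot> (f' \<cdot> g') = ident T Z"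
    by (simp add: cat_simps h g(4) eq_assoc[OF f(4)])
  ultimately show ?thesis
    by (intro is_isoI[of _ _ _ "f' \<cdot> g'"]) (auto intro: cmp_hom f g)
qed

lemma isomorphic_refl: "X \<in> Ob T \<Longrightarrow> isomorphic T X X"
  using ident_is_iso isomorphic_def by metis

lemma isomorphic_sym: "isomorphic T X Y \<Longrightarrow> isomorphic T Y X"
  unfolding isomorphic_def is_iso_def by blast

lemma isomorphic_trans: "isomorphic T X Y \<Longrightarrow> isomorphic T Y Z \<Longrightarrow> isomorphic T X Z"
  unfolding isomorphic_def using is_iso_cmp by blast

text \<open>The left inverse \<open>a \<cdot> g\<close> and the right inverse
  \<open>g' \<cdot> b\<close> agree by associativity. Asking only that the two composites be
  isomorphisms matches what fill-ins of triangles provide: morphisms both ways that need not be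
  mutually inverse.\<close>

lemma is_iso_of_inverses:
  assumes f: "f \<in> Hom T X Y" and g: "g \<in> Hom T Y X" "is_iso T X X (g \<cdot> f)"
    and g': "g' \<in> Hom T Y X" "is_iso T Y Y (f \<cdot> g')"
  shows "is_iso T X Y f"
proof -
  obtain a where a: "a \<in> Hom T X X" "a \<cdot> (g \<cdot> f) = ident T X"
    using g(2) by (auto elim: is_isoE)
  obtain b where b: "b \<in> Hom T Y Y" "(f \<cdot> g') \<cdot> b = ident T Y"
    using g'(2) by (auto elim: is_isoE)
  note h = HomD[OF f(1)] HomD[OF g(1)] HomD[OF g'(1)] HomD[OF a(1)] HomD[OF b(1)]
  have "a \<cdot> g = (a \<cdot> g) \<cdot> ((f \<cdot> g') \<cdot> b)"
    using b by (simp add: cat_simps h)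
  also have "\<dots> = (a \<cdot> (g \<cdot> f)) \<cdot> (g' \<cdot> b)"
    by (simp add: cat_simps h)
  also have "\<dots> = g' \<cdot> b"
    using a by (simp add: cat_simps h)
  finally have eq: "a \<cdot> g = g' \<cdot> b" .
  show ?thesis
  proof (rule is_isoI[OF f cmp_hom[OF g(1) a(1)]])
    show "(a \<cdot> g) \<cdot> f = ident T X"
      using a by (simp add: cat_simps h)
    show "f \<cdot> (a \<cdot> g) = ident T Y"
      using b by (simp add: eq cat_simps h)
  qed
qed

lemma is_iso_cancel_left:
  assumes "is_iso T Y Z b" "f \<in> Hom T X Y" "g \<in> Hom T X Y" "b \<cdot> f = b \<cdot> g"
  shows "f = g"
proof -
  obtain t where t: "b \<in> Hom T Y Z" "t \<in> Hom T Z Y" "t \<cdot> b = ident T Y"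
    using assms(1) by (rule is_isoE)
  have "t \<cdot> (b \<cdot> f) = t \<cdot> (b \<cdot> g)"
    using assms(4) by simp
  then show ?thesis
    unfolding cmp_assoc[OF assms(2) t(1,2), symmetric] cmp_assoc[OF assms(3) t(1,2), symmetric] t(3)
      ident_cmp[OF assms(2)] ident_cmp[OF assms(3)] .
qed

lemma is_iso_cancel_right:
  assumes "is_iso T X Y b" "f \<in> Hom T Y Z" "g \<in> Hom T Y Z" "f \<cdot> b = g \<cdot> b"
  shows "f = g"
proof -
  obtain t where t: "b \<in> Hom T X Y" "t \<in> Hom T Y X" "b \<cdot> t = ident T Y"
    using assms(1) by (rule is_isoE)
  have "(f \<cdot> b) \<cdot> t = (g \<cdot> b) \<cdot> t"
    using assms(4) by simp
  then show ?thesis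
    unfolding cmp_assoc[OF t(2,1) assms(2)] cmp_assoc[OF t(2,1) assms(3)] t(3)
      cmp_ident[OF assms(2)] cmp_ident[OF assms(3)] .
qed

lemma is_iso_inverse: "is_iso T X Y f \<Longrightarrow> \<exists>g. is_iso T Y X g \<and> g \<cdot> f = ident T X \<and> f \<cdot> g = ident T Y"
  unfolding is_iso_def by blast

end

section \<open>Arithmetic in the Hom groups and vanishing of Hom sets\<close>

context additive_category
begin

lemma hadd_group:
  assumes "X \<in> Ob T" "Y \<in> Ob T"
  shows "comm_group \<lparr>carrier = Hom T X Y, mult = (\<boxplus>), one = hzero T X Y\<rparr>"
  using hom_comm_group[OF assms] by (simp add: hom_group_def)

lemma hzero_hom: "X \<in> Ob T \<Longrightarrow> Y \<in> Ob T \<Longrightarrow> hzero T X Y \<in> Hom T X Y"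
  using hadd_group[THEN comm_group.axioms(2), THEN group.is_monoid, THEN monoid.one_closed, of X Y]
  by simp

lemma hadd_hom: "f \<in> Hom T X Y \<Longrightarrow> g \<in> Hom T X Y \<Longrightarrow> f \<boxplus> g \<in> Hom T X Y"
  using hadd_group[THEN comm_group.axioms(2), THEN group.is_monoid, THEN monoid.m_closed, of X Y f g]
  by (simp add: HomD)

lemma hadd_assoc:
  "f \<in> Hom T X Y \<Longrightarrow> g \<in> Hom T X Y \<Longrightarrow> h \<in> Hom T X Y \<Longrightarrow> f \<boxplus> g \<boxplus> h = f \<boxplus> (g \<boxplus> h)"
  using hadd_group[THEN comm_group.axioms(2), THEN group.is_monoid, THEN monoid.m_assoc, of X Y f g h]
  by (simp add: HomD)

lemma hadd_commute: "f \<in> Hom T X Y \<Longrightarrow> g \<in> Hom T X Y \<Longrightarrow> f \<boxplus> g = g \<boxplus> f"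
  using hadd_group[THEN comm_group.axioms(1), THEN comm_monoid.m_comm, of X Y f g]
  by (simp add: HomD)

lemma hzero_add: "f \<in> Hom T X Y \<Longrightarrow> hzero T X Y \<boxplus> f = f"
  using hadd_group[THEN comm_group.axioms(2), THEN group.is_monoid, THEN monoid.l_one, of X Y f]
  by (simp add: HomD)

lemma hadd_zero: "f \<in> Hom T X Y \<Longrightarrow> f \<boxplus> hzero T X Y = f"
  using hzero_add hadd_commute hzero_hom HomD by metis

lemma hneg_hom: "f \<in> Hom T X Y \<Longrightarrow> \<boxminus> f \<in> Hom T X Y"
  using hadd_group[THEN comm_group.axioms(2), THEN group.inv_closed, of X Y f]
  by (simp add: HomD hneg_def hom_group_def)

lemma hneg_add: "f \<in> Hom T X Y \<Longrightarrow> \<boxminus> f \<boxplus> f = hzero T X Y"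
  using hadd_group[THEN comm_group.axioms(2), THEN group.l_inv, of X Y f]
  by (simp add: HomD hneg_def hom_group_def)

lemma hadd_neg: "f \<in> Hom T X Y \<Longrightarrow> f \<boxplus> \<boxminus> f = hzero T X Y"
  using hneg_add hadd_commute hneg_hom by metis

lemma hadd_right_cancel:
  assumes "f \<in> Hom T X Y" "g \<in> Hom T X Y" "h \<in> Hom T X Y" "f \<boxplus> h = g \<boxplus> h"
  shows "f = g"
proof -
  have "f = f \<boxplus> h \<boxplus> \<boxminus> h" "g = g \<boxplus> h \<boxplus> \<boxminus> h"
    using assms(1-3) by (simp_all add: hadd_assoc[OF _ assms(3) hneg_hom] hadd_neg hadd_zero)
  then show ?thesis using assms(4) by simp
qed

lemma hneg_unique:
  assumes "f \<in> Hom T X Y" "g \<in> Hom T X Y" "g \<boxplus> f = hzero T X Y"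
  shows "g = \<boxminus> f"
  using assms by (intro hadd_right_cancel[OF _ hneg_hom assms(1)]) (auto simp: hneg_add)

lemma hneg_hneg: "f \<in> Hom T X Y \<Longrightarrow> \<boxminus> (\<boxminus> f) = f"
  using hneg_unique[OF hneg_hom _ hadd_neg] by metis

lemma hneg_inject: "f \<in> Hom T X Y \<Longrightarrow> g \<in> Hom T X Y \<Longrightarrow> \<boxminus> f = \<boxminus> g \<Longrightarrow> f = g"
  by (metis hneg_hneg)

lemma hdiff_eq_zero:
  assumes "f \<in> Hom T X Y" "g \<in> Hom T X Y" "f \<boxplus> \<boxminus> g = hzero T X Y"
  shows "f = g"
  using hneg_unique[OF hneg_hom[OF assms(2)] assms(1,3)] hneg_hneg[OF assms(2)] by simp

lemma hzero_cmp:
  assumes "f \<in> Hom T X Y" "Z \<in> Ob T"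
  shows "hzero T Y Z \<cdot> f = hzero T X Z"
proof -
  have z: "hzero T Y Z \<in> Hom T Y Z" using assms HomD hzero_hom by blast
  then have c: "hzero T Y Z \<cdot> f \<in> Hom T X Z" using assms cmp_hom by blast
  have "hzero T Y Z \<cdot> f \<boxplus> hzero T Y Z \<cdot> f = hzero T X Z \<boxplus> hzero T Y Z \<cdot> f"
    using cmp_add_left[OF assms(1) z z] hzero_add[OF z] hzero_add[OF c] by simp
  with c show ?thesis by (meson HomD(4,5) hadd_right_cancel hzero_hom)
qed

lemma cmp_hzero:
  assumes "f \<in> Hom T Y Z" "X \<in> Ob T"
  shows "f \<cdot> hzero T X Y = hzero T X Z"
proof -
  have z: "hzero T X Y \<in> Hom T X Y" using assms HomD hzero_hom by blast
  then have c: "f \<cdot> hzero T X Y \<in> Hom T X Z" using assms cmp_hom by blast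
  have "f \<cdot> hzero T X Y \<boxplus> f \<cdot> hzero T X Y = hzero T X Z \<boxplus> f \<cdot> hzero T X Y"
    using cmp_add_right[OF z z assms(1)] hzero_add[OF z] hzero_add[OF c] by simp
  with c show ?thesis by (meson HomD(4,5) hadd_right_cancel hzero_hom)
qed

lemma cmp_hneg:
  assumes "f \<in> Hom T X Y" "g \<in> Hom T Y Z"
  shows "g \<cdot> \<boxminus> f = \<boxminus> (g \<cdot> f)"
  using cmp_add_right[OF hneg_hom[OF assms(1)] assms] hneg_hom assms
  by (intro hneg_unique[of _ X Z]) (auto simp: hneg_add cmp_hzero HomD intro: cmp_hom)

lemma hneg_cmp:
  assumes "f \<in> Hom T X Y" "g \<in> Hom T Y Z"
  shows "\<boxminus> g \<cdot> f = \<boxminus> (g \<cdot> f)"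
  using cmp_add_left[OF assms(1) hneg_hom[OF assms(2)] assms(2)] hneg_hom assms
  by (intro hneg_unique[of _ X Z]) (auto simp: hneg_add hzero_cmp HomD intro: cmp_hom)

text \<open>Removes the sign that rotating a triangle puts on the suspended morphism.\<close>

lemma hneg_cmp_cancel:
  assumes "f \<in> Hom T Y Z" "a \<in> Hom T X Y" "b \<in> Hom T X Y"
  shows "\<boxminus> f \<cdot> a = \<boxminus> f \<cdot> b \<longleftrightarrow> f \<cdot> a = f \<cdot> b"
proof -
  have "\<boxminus> f \<cdot> a = \<boxminus> (f \<cdot> a)" "\<boxminus> f \<cdot> b = \<boxminus> (f \<cdot> b)"
    by (rule hneg_cmp[OF assms(2,1)], rule hneg_cmp[OF assms(3,1)])
  moreover have "\<boxminus> (f \<cdot> a) = \<boxminus> (f \<cdot> b) \<Longrightarrow> f \<cdot> a = f \<cdot> b"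
    by (rule hneg_inject[OF cmp_hom[OF assms(2,1)] cmp_hom[OF assms(3,1)]])
  ultimately show ?thesis by auto
qed

lemma additive_endofunctor_hzero:
  assumes "additive_endofunctor T Fo Fm" "X \<in> Ob T" "Y \<in> Ob T"
  shows "Fm (hzero T X Y) = hzero T (Fo X) (Fo Y)"
proof -
  have z: "hzero T X Y \<in> Hom T X Y" using assms hzero_hom by blast
  then have c: "Fm (hzero T X Y) \<in> Hom T (Fo X) (Fo Y)"
    using assms(1) unfolding additive_endofunctor_def endofunctor_def by blast
  have "Fm (hzero T X Y) \<boxplus> Fm (hzero T X Y) = Fm (hzero T X Y \<boxplus> hzero T X Y)"
    using assms(1) z unfolding additive_endofunctor_def by metis
  also have "\<dots> = hzero T (Fo X) (Fo Y) \<boxplus> Fm (hzero T X Y)"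
    using hzero_add[OF z] hzero_add[OF c] by simp
  finally show ?thesis
    using c by (meson HomD(4,5) hadd_right_cancel hzero_hom)
qed

lemma additive_endofunctor_hneg:
  assumes "additive_endofunctor T Fo Fm" "f \<in> Hom T X Y"
  shows "Fm (\<boxminus> f) = \<boxminus> (Fm f)"
proof (rule hneg_unique)
  show "Fm f \<in> Hom T (Fo X) (Fo Y)" "Fm (\<boxminus> f) \<in> Hom T (Fo X) (Fo Y)"
    using assms hneg_hom unfolding additive_endofunctor_def endofunctor_def by blast+
  have "Fm (\<boxminus> f) \<boxplus> Fm f = Fm (\<boxminus> f \<boxplus> f)"
    using assms hneg_hom[OF assms(2)] unfolding additive_endofunctor_def by metis
  then show "Fm (\<boxminus> f) \<boxplus> Fm f = hzero T (Fo X) (Fo Y)"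
    using hneg_add[OF assms(2)] additive_endofunctor_hzero[OF assms(1)] HomD[OF assms(2)] by simp
qed

text \<open>The objectwise form of \<open>hom_vanishes\<close>. With an inclusion in place of an
  equality it holds trivially when the Hom set is empty, so no membership in \<open>Ob T\<close> has
  to be recorded.\<close>

definition orth :: "'o \<Rightarrow> 'o \<Rightarrow> bool" where
  "orth X Y \<longleftrightarrow> Hom T X Y \<subseteq> {hzero T X Y}"

lemma orthD: "orth X Y \<Longrightarrow> f \<in> Hom T X Y \<Longrightarrow> f = hzero T X Y"
  by (auto simp: orth_def)

lemma orth_iff_ex1:
  assumes "X \<in> Ob T" "Y \<in> Ob T"
  shows "orth X Y \<longleftrightarrow> (\<exists>!f. f \<in> Hom T X Y)"
proof
  assume "orth X Y"
  then show "\<exists>!f. f \<in> Hom T X Y"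
    using hzero_hom[OF assms] by (intro ex1I[of _ "hzero T X Y"]) (auto simp: orth_def)
next
  assume "\<exists>!f. f \<in> Hom T X Y"
  then obtain x where "\<And>f. f \<in> Hom T X Y \<Longrightarrow> f = x"
    by auto
  then show "orth X Y"
    using hzero_hom[OF assms] unfolding orth_def by blast
qed

text \<open>Turns zero objects into a vanishing condition, so that they can be moved along the
  suspension like any other vanishing.\<close>

lemma zero_object_iff_orth:
  "zero_object T Z \<longleftrightarrow> Z \<in> Ob T \<and> (\<forall>X \<in> Ob T. orth X Z \<and> orth Z X)"
  unfolding zero_object_def by (intro conj_cong refl ball_cong orth_iff_ex1[symmetric])

lemma orth_iso:
  assumes "isomorphic T X X'" "isomorphic T Y Y'" "orth X Y"
  shows "orth X' Y'"
  unfolding orth_def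
proof safe
  fix f assume f: "f \<in> Hom T X' Y'"
  obtain a a' where a: "a \<in> Hom T X X'" "a' \<in> Hom T X' X" "a \<cdot> a' = ident T X'"
    using assms(1) unfolding isomorphic_def by (auto elim: is_isoE)
  obtain b b' where b: "b \<in> Hom T Y Y'" "b' \<in> Hom T Y' Y" "b \<cdot> b' = ident T Y'"
    using assms(2) unfolding isomorphic_def by (auto elim: is_isoE)
  note h = HomD[OF f] HomD[OF a(1)] HomD[OF a(2)] HomD[OF b(1)] HomD[OF b(2)]
  have "f = b \<cdot> (b' \<cdot> f \<cdot> a) \<cdot> a'"
    using a b f by (simp add: cat_simps h eq_assoc[OF b(3)])
  also have "b' \<cdot> f \<cdot> a = hzero T X Y"
    using orthD[OF assms(3)] a b f cmp_hom by blast
  finally show "f = hzero T X' Y'"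
    using a b by (simp add: cmp_hzero[of b] hzero_cmp[of a'] h)
qed

lemma hom_product_eqI:
  assumes "is_product T I X P pr" "f \<in> Hom T Q P" "g \<in> Hom T Q P" "\<And>i. i \<in> I \<Longrightarrow> pr i \<cdot> f = pr i \<cdot> g"
  shows "f = g"
proof -
  have pr: "i \<in> I \<Longrightarrow> pr i \<in> Hom T P (X i)" for i
    using assms(1) by (simp add: is_product_def)
  have "\<forall>q. (\<forall>i\<in>I. q i \<in> Hom T Q (X i)) \<longrightarrow> (\<exists>!u. u \<in> Hom T Q P \<and> (\<forall>i\<in>I. pr i \<cdot> u = q i))"
    using assms(1) HomD(4)[OF assms(2)] unfolding is_product_def by blast
  from this[rule_format, of "\<lambda>i. pr i \<cdot> g"]
  have "\<exists>!u. u \<in> Hom T Q P \<and> (\<forall>i\<in>I. pr i \<cdot> u = pr i \<cdot> g)"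
    using pr cmp_hom[OF assms(3)] by simp
  then obtain x where "\<And>u. u \<in> Hom T Q P \<and> (\<forall>i\<in>I. pr i \<cdot> u = pr i \<cdot> g) \<Longrightarrow> u = x"
    by auto
  from this[of f] this[of g] show ?thesis
    using assms(2-4) by simp
qed

lemma hom_coproduct_eqI:
  assumes "is_coproduct T I X P inn" "f \<in> Hom T P Q" "g \<in> Hom T P Q" "\<And>i. i \<in> I \<Longrightarrow> f \<cdot> inn i = g \<cdot> inn i"
  shows "f = g"
proof -
  have inn: "i \<in> I \<Longrightarrow> inn i \<in> Hom T (X i) P" for i
    using assms(1) by (simp add: is_coproduct_def)
  have "\<forall>q. (\<forall>i\<in>I. q i \<in> Hom T (X i) Q) \<longrightarrow> (\<exists>!u. u \<in> Hom T P Q \<and> (\<forall>i\<in>I. u \<cdot> inn i = q i))"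
    using assms(1) HomD(5)[OF assms(2)] unfolding is_coproduct_def by blast
  from this[rule_format, of "\<lambda>i. g \<cdot> inn i"]
  have "\<exists>!u. u \<in> Hom T P Q \<and> (\<forall>i\<in>I. u \<cdot> inn i = g \<cdot> inn i)"
    using inn cmp_hom[OF _ assms(3)] by simp
  then obtain x where "\<And>u. u \<in> Hom T P Q \<and> (\<forall>i\<in>I. u \<cdot> inn i = g \<cdot> inn i) \<Longrightarrow> u = x"
    by auto
  from this[of f] this[of g] show ?thesis
    using assms(2-4) by simp
qed

lemma orth_coproduct:
  assumes P: "is_coproduct T I X P inn" and "\<And>i. i \<in> I \<Longrightarrow> orth (X i) Q" "Q \<in> Ob T"
  shows "orth P Q"
  unfolding orth_def
proof safe
  fix f assume f: "f \<in> Hom T P Q"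
  have inn: "i \<in> I \<Longrightarrow> inn i \<in> Hom T (X i) P" for i
    using P by (simp add: is_coproduct_def)
  show "f = hzero T P Q"
  proof (rule hom_coproduct_eqI[OF P f hzero_hom])
    show "f \<cdot> inn i = hzero T P Q \<cdot> inn i" if "i \<in> I" for i
      using orthD[OF assms(2)[OF that] cmp_hom[OF inn[OF that] f]] hzero_cmp[OF inn[OF that] assms(3)]
      by simp
  qed (use HomD[OF f] in auto)
qed

end

section \<open>Functors\<close>

context category
begin

lemma endofunctor_hom: "endofunctor T Fo Fm \<Longrightarrow> f \<in> Hom T X Y \<Longrightarrow> Fm f \<in> Hom T (Fo X) (Fo Y)"
  unfolding endofunctor_def by blast

lemma endofunctor_cmp:
  "endofunctor T Fo Fm \<Longrightarrow> f \<in> Hom T X Y \<Longrightarrow> g \<in> Hom T Y Z \<Longrightarrow> Fm (g \<cdot> f) = Fm g \<cdot> Fm f"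
  unfolding endofunctor_def by blast

lemma endofunctor_simps:
  assumes "endofunctor T Fo Fm"
  shows "X \<in> Ob T \<Longrightarrow> Fo X \<in> Ob T"
    and "X \<in> Ob T \<Longrightarrow> Fm (ident T X) = ident T (Fo X)"
    and "f \<in> Ar T \<Longrightarrow> Fm f \<in> Ar T"
    and "f \<in> Ar T \<Longrightarrow> src T (Fm f) = Fo (src T f)"
    and "f \<in> Ar T \<Longrightarrow> tgt T (Fm f) = Fo (tgt T f)"
    and "f \<in> Ar T \<Longrightarrow> g \<in> Ar T \<Longrightarrow> tgt T f = src T g \<Longrightarrow> Fm (g \<cdot> f) = Fm g \<cdot> Fm f"
proof -
  show "X \<in> Ob T \<Longrightarrow> Fo X \<in> Ob T" "X \<in> Ob T \<Longrightarrow> Fm (ident T X) = ident T (Fo X)"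
    using assms unfolding endofunctor_def by blast+
  show "Fm f \<in> Ar T" "src T (Fm f) = Fo (src T f)" "tgt T (Fm f) = Fo (tgt T f)" if "f \<in> Ar T"
    using endofunctor_hom[OF assms HomI[OF that refl refl]] by (simp_all add: HomD)
  show "f \<in> Ar T \<Longrightarrow> g \<in> Ar T \<Longrightarrow> tgt T f = src T g \<Longrightarrow> Fm (g \<cdot> f) = Fm g \<cdot> Fm f"
    by (rule endofunctor_cmp[OF assms HomI[OF _ refl refl] HomI[OF _ _ refl]]) auto
qed

lemma endofunctor_is_iso:
  assumes "endofunctor T Fo Fm" "is_iso T X Y f"
  shows "is_iso T (Fo X) (Fo Y) (Fm f)"
proof -
  obtain g where g: "f \<in> Hom T X Y" "g \<in> Hom T Y X" "g \<cdot> f = ident T X" "f \<cdot> g = ident T Y"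
    using assms(2) by (rule is_isoE)
  show ?thesis
  proof (rule is_isoI)
    show "Fm g \<cdot> Fm f = ident T (Fo X)" "Fm f \<cdot> Fm g = ident T (Fo Y)"
      using g endofunctor_cmp[OF assms(1)] endofunctor_simps(2)[OF assms(1)] HomD by metis+
  qed (use g endofunctor_hom[OF assms(1)] in auto)
qed

lemma endofunctor_isomorphic:
  "endofunctor T Fo Fm \<Longrightarrow> isomorphic T X Y \<Longrightarrow> isomorphic T (Fo X) (Fo Y)"
  unfolding isomorphic_def using endofunctor_is_iso by blast

text \<open>Naturality lets \<open>Fm f\<close> determine \<open>\<tau> Y \<cdot> f\<close>, and the
  isomorphism \<open>\<tau> Y\<close> cancels.\<close>

lemma faithful_of_retraction:
  assumes nat: "\<And>X. X \<in> Ob T \<Longrightarrow> is_iso T X (Go (Fo X)) (\<tau> X)"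
      "\<And>X Y f. f \<in> Hom T X Y \<Longrightarrow> \<tau> Y \<cdot> f = Gm (Fm f) \<cdot> \<tau> X"
    and f: "f \<in> Hom T X Y" "g \<in> Hom T X Y" "Fm f = Fm g"
  shows "f = g"
proof -
  have eq: "\<tau> Y \<cdot> f = \<tau> Y \<cdot> g"
    using nat(2)[OF f(1)] nat(2)[OF f(2)] f(3) by simp
  show ?thesis
    by (rule is_iso_cancel_left[OF nat(1)[OF HomD(5)[OF f(1)]] f(1,2) eq])
qed

text \<open>The variant for a transformation into the identity: in \<open>quasi_inverse\<close> the
  unit and the counit point in opposite directions, and here \<open>\<tau> X\<close> is cancelled on
  the right.\<close>

lemma faithful_of_section:
  assumes nat: "\<And>X. X \<in> Ob T \<Longrightarrow> is_iso T (Go (Fo X)) X (\<tau> X)"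
      "\<And>X Y f. f \<in> Hom T X Y \<Longrightarrow> \<tau> Y \<cdot> Gm (Fm f) = f \<cdot> \<tau> X"
    and f: "f \<in> Hom T X Y" "g \<in> Hom T X Y" "Fm f = Fm g"
  shows "f = g"
proof -
  have eq: "f \<cdot> \<tau> X = g \<cdot> \<tau> X"
    using nat(2)[OF f(1)] nat(2)[OF f(2)] f(3) by simp
  show ?thesis
    by (rule is_iso_cancel_right[OF nat(1)[OF HomD(4)[OF f(1)]] f(1,2) eq])
qed

end

section \<open>Triangulated categories\<close>

context triangulated_category
begin

section \<open>The suspension as a fully faithful, essentially surjective functor\<close>

abbreviation Sus :: "'o \<Rightarrow> 'o" where "Sus \<equiv> sus_ob T"
abbreviation sus :: "'m \<Rightarrow> 'm" where "sus \<equiv> sus_ar T"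
abbreviation Des :: "'o \<Rightarrow> 'o" where "Des \<equiv> des_ob T"

lemma sus_endo: "endofunctor T Sus sus" and des_endo: "endofunctor T Des (des_ar T)"
  using sus_functor des_functor by (auto simp: additive_endofunctor_def)

lemmas sus_hom = endofunctor_hom[OF sus_endo]
  and sus_simps = endofunctor_simps[OF sus_endo] endofunctor_simps(1)[OF des_endo]
  and sus_is_iso = endofunctor_is_iso[OF sus_endo]
  and sus_hzero = additive_endofunctor_hzero[OF sus_functor]
  and sus_hneg = additive_endofunctor_hneg[OF sus_functor]

lemma Sus_Des: "X \<in> Ob T \<Longrightarrow> isomorphic T (Sus (Des X)) X"
  using sus_des unfolding quasi_inverse_def natural_iso_on_def isomorphic_def by fastforce

lemma sus_faithful: "f \<in> Hom T X Y \<Longrightarrow> g \<in> Hom T X Y \<Longrightarrow> sus f = sus g \<Longrightarrow> f = g"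
proof -
  obtain \<tau> where "natural_iso_on T (Ob T) id id (Des \<circ> Sus) (des_ar T \<circ> sus) \<tau>"
    using sus_des unfolding quasi_inverse_def by blast
  then have "\<And>X. X \<in> Ob T \<Longrightarrow> is_iso T X (Des (Sus X)) (\<tau> X)"
    "\<And>X Y f. f \<in> Hom T X Y \<Longrightarrow> \<tau> Y \<cdot> f = des_ar T (sus f) \<cdot> \<tau> X"
    unfolding natural_iso_on_def using HomD(4,5) by fastforce+
  then show "f \<in> Hom T X Y \<Longrightarrow> g \<in> Hom T X Y \<Longrightarrow> sus f = sus g \<Longrightarrow> f = g"
    by (rule faithful_of_retraction)
qed

text \<open>Serves the fullness of the suspension, where a candidate preimage is checked after
  desuspending.\<close>

lemma des_faithful: "f \<in> Hom T X Y \<Longrightarrow> g \<in> Hom T X Y \<Longrightarrow> des_ar T f = des_ar T g \<Longrightarrow> f = g"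
proof -
  obtain \<tau> where "natural_iso_on T (Ob T) (Sus \<circ> Des) (sus \<circ> des_ar T) id id \<tau>"
    using sus_des unfolding quasi_inverse_def by blast
  then have "\<And>X. X \<in> Ob T \<Longrightarrow> is_iso T (Sus (Des X)) X (\<tau> X)"
    "\<And>X Y f. f \<in> Hom T X Y \<Longrightarrow> \<tau> Y \<cdot> sus (des_ar T f) = f \<cdot> \<tau> X"
    unfolding natural_iso_on_def using HomD(4,5) by fastforce+
  then show "f \<in> Hom T X Y \<Longrightarrow> g \<in> Hom T X Y \<Longrightarrow> des_ar T f = des_ar T g \<Longrightarrow> f = g"
    by (rule faithful_of_section)
qed

text \<open>The preimage is \<open>des_ar T g\<close> conjugated by the unit of the equivalence.
  Naturality of the unit shows that \<open>sus f\<close> and \<open>g\<close> have the same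
  desuspension, and desuspension is faithful.\<close>

lemma sus_full:
  assumes g: "g \<in> Hom T (Sus X) (Sus Y)" and X: "X \<in> Ob T" and Y: "Y \<in> Ob T"
  shows "\<exists>f \<in> Hom T X Y. sus f = g"
proof -
  obtain \<tau> where \<tau>: "natural_iso_on T (Ob T) id id (Des \<circ> Sus) (des_ar T \<circ> sus) \<tau>"
    using sus_des unfolding quasi_inverse_def by blast
  have X': "is_iso T X (Des (Sus X)) (\<tau> X)" and "is_iso T Y (Des (Sus Y)) (\<tau> Y)"
    using \<tau> X Y by (auto simp: natural_iso_on_def)
  then obtain t s where t: "\<tau> Y \<in> Hom T Y (Des (Sus Y))" "t \<in> Hom T (Des (Sus Y)) Y"
      "\<tau> Y \<cdot> t = ident T (Des (Sus Y))"
    and s: "\<tau> X \<in> Hom T X (Des (Sus X))" "s \<in> Hom T (Des (Sus X)) X"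
      "\<tau> X \<cdot> s = ident T (Des (Sus X))"
    by (metis is_isoE)
  have dg: "des_ar T g \<in> Hom T (Des (Sus X)) (Des (Sus Y))"
    using g by (rule endofunctor_hom[OF des_endo])
  define f where "f = t \<cdot> (des_ar T g \<cdot> \<tau> X)"
  have f: "f \<in> Hom T X Y"
    unfolding f_def using s t dg by (auto intro: cmp_hom)
  note h = HomD[OF f] HomD[OF s(1)] HomD[OF s(2)] HomD[OF t(1)] HomD[OF t(2)] HomD[OF dg]
  have df: "des_ar T (sus f) \<in> Hom T (Des (Sus X)) (Des (Sus Y))"
    using f by (intro endofunctor_hom[OF des_endo] sus_hom)
  have "des_ar T (sus f) \<cdot> \<tau> X = \<tau> Y \<cdot> f"
    using \<tau> X Y f by (auto simp: natural_iso_on_def)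
  also have "\<dots> = des_ar T g \<cdot> \<tau> X"
    unfolding f_def by (simp add: cat_simps h eq_assoc[OF t(3)])
  finally have "des_ar T (sus f) = des_ar T g"
    by (rule is_iso_cancel_right[OF X' df dg])
  then have "sus f = g"
    using des_faithful sus_hom[OF f] g by blast
  with f show ?thesis by blast
qed

lemma sus_reflects_iso:
  assumes "f \<in> Hom T X Y" "is_iso T (Sus X) (Sus Y) (sus f)"
  shows "is_iso T X Y f"
proof -
  obtain g where g: "g \<in> Hom T (Sus Y) (Sus X)" "g \<cdot> sus f = ident T (Sus X)"
      "sus f \<cdot> g = ident T (Sus Y)"
    using assms(2) by (auto elim: is_isoE)
  obtain k where k: "k \<in> Hom T Y X" "sus k = g"
    using sus_full[OF g(1)] HomD[OF assms(1)] by blast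
  note h = HomD[OF assms(1)] HomD[OF k(1)]
  show ?thesis
  proof (rule is_isoI[OF assms(1) k(1)])
    show "k \<cdot> f = ident T X"
      by (rule sus_faithful[of _ X X]) (use assms k g in \<open>auto simp: h cat_simps sus_simps intro: HomI\<close>)
    show "f \<cdot> k = ident T Y"
      by (rule sus_faithful[of _ Y Y]) (use assms k g in \<open>auto simp: h cat_simps sus_simps intro: HomI\<close>)
  qed
qed

lemma orth_Sus_iff:
  assumes "X \<in> Ob T" "Y \<in> Ob T"
  shows "orth (Sus X) (Sus Y) \<longleftrightarrow> orth X Y"
proof
  assume o: "orth (Sus X) (Sus Y)"
  show "orth X Y"
    unfolding orth_def
  proof safe
    fix f assume f: "f \<in> Hom T X Y"
    have "sus f = sus (hzero T X Y)"
      using orthD[OF o sus_hom[OF f]] sus_hzero[OF assms] by simp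
    then show "f = hzero T X Y"
      using sus_faithful f hzero_hom[OF assms] by blast
  qed
next
  assume o: "orth X Y"
  show "orth (Sus X) (Sus Y)"
    unfolding orth_def
  proof safe
    fix g assume "g \<in> Hom T (Sus X) (Sus Y)"
    then obtain f where "f \<in> Hom T X Y" "sus f = g"
      using sus_full assms by blast
    then show "g = hzero T (Sus X) (Sus Y)"
      using orthD[OF o] sus_hzero[OF assms] by metis
  qed
qed

lemma orth_Sus_left_iff:
  assumes "X \<in> Ob T" "Y \<in> Ob T"
  shows "orth (Sus X) Y \<longleftrightarrow> orth X (Des Y)"
proof -
  have "orth (Sus X) Y \<longleftrightarrow> orth (Sus X) (Sus (Des Y))"
    using orth_iso[OF isomorphic_refl isomorphic_sym[OF Sus_Des], of "Sus X" Y]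
      orth_iso[OF isomorphic_refl Sus_Des, of "Sus X" Y] assms sus_simps(1) by auto
  also have "\<dots> \<longleftrightarrow> orth X (Des Y)"
    using assms by (intro orth_Sus_iff) (auto simp: sus_simps)
  finally show ?thesis .
qed

text \<open>Every object is isomorphic to some \<open>Sus (Des V)\<close>, so vanishing has to be
  tested on suspensions only.\<close>

lemma zero_object_Sus:
  assumes "zero_object T Z"
  shows "zero_object T (Sus Z)"
proof -
  have Z: "Z \<in> Ob T"
    using assms by (simp add: zero_object_def)
  have "orth V (Sus Z) \<and> orth (Sus Z) V" if V: "V \<in> Ob T" for V
  proof -
    have "orth (Des V) Z" "orth Z (Des V)"
      using assms V sus_simps by (auto simp: zero_object_iff_orth)
    then have "orth (Sus (Des V)) (Sus Z)" "orth (Sus Z) (Sus (Des V))"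
      using V Z by (simp_all add: orth_Sus_iff sus_simps)
    then show ?thesis
      using orth_iso[OF Sus_Des[OF V] isomorphic_refl[OF sus_simps(1)[OF Z]]]
        orth_iso[OF isomorphic_refl[OF sus_simps(1)[OF Z]] Sus_Des[OF V]] by auto
  qed
  then show ?thesis
    using Z by (auto simp: zero_object_iff_orth sus_simps)
qed

section \<open>Exact triangles as sources of weak kernels and weak cokernels\<close>

lemma exact_hom:
  assumes "exact_triangle T X Y Z f g h"
  shows "f \<in> Hom T X Y" "g \<in> Hom T Y Z" "h \<in> Hom T Z (Sus X)"
  using assms by (auto simp: exact_triangle_def is_triangle_def)

lemma rotate: "exact_triangle T X Y Z f g h \<Longrightarrow> exact_triangle T Y Z (Sus X) g h (\<boxminus> (sus f))"
  using TR2[of X Y Z f g h] by (simp add: exact_triangle_def)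

text \<open>\<open>g\<close> is a weak cokernel of \<open>f\<close>: TR3 maps the given triangle to
  \<open>0 \<rightarrow> W \<rightarrow> W\<close>, and the third component is the
  extension.\<close>

lemma exact_extend:
  assumes t: "exact_triangle T X Y Z f g h" and u: "u \<in> Hom T Y W" "u \<cdot> f = hzero T X W"
  shows "\<exists>v \<in> Hom T Z W. v \<cdot> g = u"
proof -
  note h = exact_hom[OF t] HomD[OF u(1)]
  obtain O' where O: "zero_object T O'" using ex_zero_object by blast
  then have O': "O' \<in> Ob T" by (simp add: zero_object_def)
  \<comment> \<open>TR1 gives \<open>W \<rightarrow> W \<rightarrow> Sus O'\<close>, because
    \<open>Sus O'\<close> is again a zero object; TR2 read backwards turns this into the triangle
    with \<open>O'\<close> in front.\<close>
  have W: "exact_triangle T O' W W (hzero T O' W) (ident T W) (hzero T W (Sus O'))"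
  proof -
    have Z': "zero_object T (Sus O')"
      by (rule zero_object_Sus[OF O])
    have "exact_triangle T W W (Sus O') (ident T W) (hzero T W (Sus O')) (hzero T (Sus O') (Sus W))"
      using TR1_ident[OF h(8) Z'] .
    moreover have "\<boxminus> (sus (hzero T O' W)) = hzero T (Sus O') (Sus W)"
      using sus_hzero[OF O' h(8)] hneg_unique hzero_hom hzero_add O' h(8) sus_simps(1) by metis
    ultimately show ?thesis
      using TR2[of O' W W "hzero T O' W" "ident T W" "hzero T W (Sus O')"]
      using O' h(8) by (simp add: is_triangle_def hzero_hom ident_hom sus_simps)
  qed
  have "\<exists>a. a \<in> Hom T X O'"
    using O HomD[OF h(1)] by (meson hzero_hom O')
  then obtain a where a: "a \<in> Hom T X O'" ..
  have "u \<cdot> f = hzero T O' W \<cdot> a"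
    using u a hzero_cmp[OF a h(8)] by simp
  then obtain c where c: "c \<in> Hom T Z W" "c \<cdot> g = ident T W \<cdot> u"
    using TR3[OF t W a u(1)] by blast
  then show ?thesis
    using u(1) ident_cmp by metis
qed

text \<open>\<open>f\<close> is a weak kernel of \<open>g\<close>. TR3 fills only the third
  position, so the triangles are rotated; the fill-in is then a morphism between suspensions, which
  fullness desuspends once the signs are removed.\<close>

lemma exact_lift:
  assumes t: "exact_triangle T X Y Z f g h" and u: "u \<in> Hom T W Y" "g \<cdot> u = hzero T W Z"
  shows "\<exists>v \<in> Hom T W X. f \<cdot> v = u"
proof -
  note h = exact_hom[OF t] HomD[OF u(1)]
  note hs = HomD[OF h(1)] HomD[OF h(2)] HomD[OF h(3)]
  obtain O' where O: "zero_object T O'" using ex_zero_object by blast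
  then have O': "O' \<in> Ob T" by (simp add: zero_object_def)
  have W: "W \<in> Ob T" using h by simp
  have "exact_triangle T W O' (Sus W) (hzero T W O') (hzero T O' (Sus W)) (\<boxminus> (sus (ident T W)))"
    using rotate[OF TR1_ident[OF W O]] .
  moreover have "hzero T O' Z \<cdot> hzero T W O' = g \<cdot> u"
    using u hzero_cmp[OF hzero_hom[OF W O'] hs(10)] by simp
  ultimately obtain c where c: "c \<in> Hom T (Sus W) (Sus X)"
      "sus u \<cdot> \<boxminus> (sus (ident T W)) = \<boxminus> (sus f) \<cdot> c"
    using TR3[OF _ rotate[OF t] u(1) hzero_hom[OF O' hs(10)]] by blast
  obtain v where v: "v \<in> Hom T W X" "sus v = c"
    using sus_full[OF c(1) W hs(4)] by blast
  have "\<boxminus> (sus u) = \<boxminus> (sus f \<cdot> c)"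
    using c(2) cmp_hneg[OF sus_hom[OF ident_hom[OF W]] sus_hom[OF u(1)]]
      hneg_cmp[OF c(1) sus_hom[OF h(1)]] by (simp add: h sus_simps cat_simps)
  then have "sus u = sus f \<cdot> c"
    by (metis hneg_hneg sus_hom u(1) cmp_hom h(1) c(1))
  then have "sus u = sus (f \<cdot> v)"
    using v h(1) endofunctor_cmp[OF sus_endo] by metis
  then have "u = f \<cdot> v"
    using sus_faithful u(1) cmp_hom[OF v(1) h(1)] by blast
  with v show ?thesis by blast
qed

end

section \<open>Cancelling the morphisms of a triangle, and vanishing of Hom along triangles\<close>

context triangulated_category
begin

text \<open>The difference of \<open>a\<close> and \<open>b\<close> is killed by \<open>g\<close>,
  hence factors through \<open>X\<close>, where nothing nonzero arrives from
  \<open>W\<close>.\<close>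

lemma exact_cancel_left:
  assumes t: "exact_triangle T X Y Z f g h" and "orth W X"
    and ab: "a \<in> Hom T W Y" "b \<in> Hom T W Y" "g \<cdot> a = g \<cdot> b"
  shows "a = b"
proof -
  note h = exact_hom[OF t] HomD[OF ab(1)]
  have "g \<cdot> (a \<boxplus> \<boxminus> b) = g \<cdot> a \<boxplus> \<boxminus> (g \<cdot> b)"
    using cmp_add_right[OF ab(1) hneg_hom[OF ab(2)] h(2)] cmp_hneg[OF ab(2) h(2)] by simp
  also have "\<dots> = hzero T W Z"
    using ab(3) hadd_neg[OF cmp_hom[OF ab(2) h(2)]] by simp
  finally obtain v where v: "v \<in> Hom T W X" "f \<cdot> v = a \<boxplus> \<boxminus> b"
    using exact_lift[OF t hadd_hom[OF ab(1) hneg_hom[OF ab(2)]]] by blast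
  then have "a \<boxplus> \<boxminus> b = hzero T W Y"
    using orthD[OF assms(2) v(1)] cmp_hzero[OF h(1,7)] by simp
  then show ?thesis
    by (rule hdiff_eq_zero[OF ab(1,2)])
qed

lemma exact_cancel_right:
  assumes t: "exact_triangle T X Y Z f g h" and "orth Z W"
    and ab: "a \<in> Hom T Y W" "b \<in> Hom T Y W" "a \<cdot> f = b \<cdot> f"
  shows "a = b"
proof -
  note h = exact_hom[OF t] HomD[OF ab(1)]
  have "(a \<boxplus> \<boxminus> b) \<cdot> f = a \<cdot> f \<boxplus> \<boxminus> (b \<cdot> f)"
    using cmp_add_left[OF h(1) ab(1) hneg_hom[OF ab(2)]] hneg_cmp[OF h(1) ab(2)] by simp
  also have "\<dots> = hzero T X W"
    using ab(3) hadd_neg[OF cmp_hom[OF h(1) ab(2)]] by simp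
  finally obtain v where v: "v \<in> Hom T Z W" "v \<cdot> g = a \<boxplus> \<boxminus> b"
    using exact_extend[OF t hadd_hom[OF ab(1) hneg_hom[OF ab(2)]]] by blast
  then have "a \<boxplus> \<boxminus> b = hzero T Y W"
    using orthD[OF assms(2) v(1)] hzero_cmp[OF h(2,8)] by simp
  then show ?thesis
    by (rule hdiff_eq_zero[OF ab(1,2)])
qed

text \<open>Cancelling the first morphism is obstructed by Hom from \<open>W\<close> to the
  desuspension of \<open>Z\<close>, expressed here without desuspending as Hom from
  \<open>Sus W\<close> to \<open>Z\<close>. Two rotations bring the suspension of \<open>f\<close>
  into second position.\<close>

lemma exact_cancel_left_fiber:
  assumes t: "exact_triangle T X Y Z f g h" and "orth (Sus W) Z"
    and ab: "a \<in> Hom T W X" "b \<in> Hom T W X" "f \<cdot> a = f \<cdot> b"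
  shows "a = b"
proof -
  note h = exact_hom[OF t]
  have "sus f \<cdot> sus a = sus f \<cdot> sus b"
    using endofunctor_cmp[OF sus_endo ab(1) h(1)] endofunctor_cmp[OF sus_endo ab(2) h(1)] ab(3)
    by simp
  then have "\<boxminus> (sus f) \<cdot> sus a = \<boxminus> (sus f) \<cdot> sus b"
    using hneg_cmp_cancel[OF sus_hom[OF h(1)] sus_hom[OF ab(1)] sus_hom[OF ab(2)]] by simp
  then have "sus a = sus b"
    using exact_cancel_left[OF rotate[OF rotate[OF t]] assms(2) sus_hom[OF ab(1)] sus_hom[OF ab(2)]]
    by simp
  then show ?thesis
    using sus_faithful[OF ab(1,2)] by simp
qed

lemma orth_exact_left:
  assumes t: "exact_triangle T X Y Z f g h" and "orth X W" "orth Z W" "W \<in> Ob T"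
  shows "orth Y W"
  unfolding orth_def
proof safe
  fix a assume a: "a \<in> Hom T Y W"
  note h = exact_hom[OF t] HomD[OF a]
  have "a \<cdot> f = hzero T Y W \<cdot> f"
    using orthD[OF assms(2) cmp_hom[OF h(1) a]] hzero_cmp[OF h(1) assms(4)] by simp
  then show "a = hzero T Y W"
    by (rule exact_cancel_right[OF t assms(3) a hzero_hom[OF h(7,8)]])
qed

lemma orth_exact_fiber:
  assumes t: "exact_triangle T X Y Z f g h" and "orth W Y" "orth (Sus W) Z" "W \<in> Ob T"
  shows "orth W X"
  unfolding orth_def
proof safe
  fix a assume a: "a \<in> Hom T W X"
  note h = exact_hom[OF t] HomD[OF a]
  have "f \<cdot> a = f \<cdot> hzero T W X"
    using orthD[OF assms(2) cmp_hom[OF a h(1)]] cmp_hzero[OF h(1) assms(4)] by simp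
  then show "a = hzero T W X"
    by (rule exact_cancel_left_fiber[OF t assms(3) a hzero_hom[OF h(7,8)]])
qed

lemma orth_exact_right:
  assumes t: "exact_triangle T X Y Z f g h" and "orth W X" "orth W Z" "W \<in> Ob T"
  shows "orth W Y"
  unfolding orth_def
proof safe
  fix a assume a: "a \<in> Hom T W Y"
  note h = exact_hom[OF t] HomD[OF a]
  have "g \<cdot> a = g \<cdot> hzero T W Y"
    using orthD[OF assms(3) cmp_hom[OF a h(2)]] cmp_hzero[OF h(2) assms(4)] by simp
  then show "a = hzero T W Y"
    by (rule exact_cancel_left[OF t assms(2) a hzero_hom[OF h(7,8)]])
qed

text \<open>The difference \<open>k - 1\<close> factors through \<open>h\<close> and is killed by it, so it squares to zero.\<close>

lemma exact_endo_is_iso: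
  assumes t: "exact_triangle T X Y Z f g h"
    and k: "k \<in> Hom T Z Z" "k \<cdot> g = g" "h \<cdot> k = h"
  shows "is_iso T Z Z k"
proof -
  note h = exact_hom[OF t] HomD[OF k(1)]
  let ?i = "ident T Z"
  define n where "n = k \<boxplus> \<boxminus> ?i"
  have i: "?i \<in> Hom T Z Z" using ident_hom h by blast
  have n: "n \<in> Hom T Z Z"
    unfolding n_def by (intro hadd_hom k hneg_hom i)
  have k_eq: "k = n \<boxplus> ?i"
    unfolding n_def using k(1) i hneg_hom[OF i] by (simp add: hadd_assoc hneg_add hadd_zero)
  have "n \<cdot> g = g \<boxplus> \<boxminus> g"
    unfolding n_def using cmp_add_left[OF h(2) k(1) hneg_hom[OF i]] k(2) hneg_cmp[OF h(2) i]
      ident_cmp[OF h(2)] by simp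
  then have "n \<cdot> g = hzero T Y Z"
    using hadd_neg[OF h(2)] by simp
  then obtain v where v: "v \<in> Hom T (Sus X) Z" "v \<cdot> h = n"
    using exact_extend[OF rotate[OF t] n] by blast
  have "h \<cdot> n = h \<boxplus> \<boxminus> h"
    unfolding n_def using cmp_add_right[OF k(1) hneg_hom[OF i] h(3)] k(3) cmp_hneg[OF i h(3)]
      cmp_ident[OF h(3)] by simp
  then have hn: "h \<cdot> n = hzero T Z (Sus X)"
    using hadd_neg[OF h(3)] by simp
  have nn: "n \<cdot> n = hzero T Z Z"
    using cmp_assoc[OF n h(3) v(1)] v(2) hn cmp_hzero[OF v(1)] h by simp
  \<comment> \<open>Since \<open>n\<close> squares to zero, \<open>1 - n\<close> inverts
    \<open>1 + n = k\<close>.\<close>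
  define m where "m = \<boxminus> n \<boxplus> ?i"
  have m: "m \<in> Hom T Z Z"
    unfolding m_def by (intro hadd_hom hneg_hom n i)
  have nm: "n \<cdot> m = n" and mn: "m \<cdot> n = n"
    unfolding m_def using cmp_add_right[OF hneg_hom[OF n] i n] cmp_add_left[OF n hneg_hom[OF n] i]
      cmp_hneg[OF n n] hneg_cmp[OF n n] nn cmp_ident[OF n] ident_cmp[OF n] hzero_add[OF n]
      hneg_unique[OF hzero_hom hzero_hom hzero_add[OF hzero_hom], of Z Z] h by simp_all
  have nmi: "n \<boxplus> m = ?i"
    unfolding m_def using hadd_assoc[OF n hneg_hom[OF n] i] hadd_neg[OF n] hzero_add[OF i] by simp
  have "m \<cdot> k = ?i" "k \<cdot> m = ?i"
    unfolding k_eq using cmp_add_right[OF n i m] cmp_add_left[OF m n i] nm mn cmp_ident[OF m]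
      ident_cmp[OF m] nmi by simp_all
  then show ?thesis
    by (intro is_isoI[OF k(1) m])
qed

text \<open>A five lemma for triangles. The fill-ins \<open>c\<close> and \<open>c'\<close> need not
  be mutually inverse, but both composites fix the second and third morphisms of their triangle, so
  \<open>exact_endo_is_iso\<close> makes them invertible.\<close>

lemma TR3_iso:
  assumes t: "exact_triangle T X Y Z f g h" and t': "exact_triangle T X' Y' Z' f' g' h'"
    and a: "is_iso T X X' a" and b: "is_iso T Y Y' b" and sq: "b \<cdot> f = f' \<cdot> a"
  shows "\<exists>c. is_iso T Z Z' c \<and> c \<cdot> g = g' \<cdot> b \<and> sus a \<cdot> h = h' \<cdot> c"
proof -
  obtain a' where a': "a \<in> Hom T X X'" "a' \<in> Hom T X' X" "a' \<cdot> a = ident T X" "a \<cdot> a' = ident T X'"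
    using a by (rule is_isoE)
  obtain b' where b': "b \<in> Hom T Y Y'" "b' \<in> Hom T Y' Y" "b' \<cdot> b = ident T Y" "b \<cdot> b' = ident T Y'"
    using b by (rule is_isoE)
  note h = exact_hom[OF t] exact_hom[OF t']
  note H = HomD[OF h(1)] HomD[OF h(2)] HomD[OF h(3)] HomD[OF h(4)] HomD[OF h(5)] HomD[OF h(6)]
    HomD[OF a'(1)] HomD[OF a'(2)] HomD[OF b'(1)] HomD[OF b'(2)]
  obtain c where c: "c \<in> Hom T Z Z'" "c \<cdot> g = g' \<cdot> b" "sus a \<cdot> h = h' \<cdot> c"
    using TR3[OF t t' a'(1) b'(1) sq] by blast
  have "b' \<cdot> (b \<cdot> f) \<cdot> a' = b' \<cdot> (f' \<cdot> a) \<cdot> a'"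
    using sq by simp
  then have "b' \<cdot> f' = f \<cdot> a'"
    by (simp add: H cat_simps eq_assoc[OF b'(3)] a'(4))
  then obtain c' where c': "c' \<in> Hom T Z' Z" "c' \<cdot> g' = g \<cdot> b'" "sus a' \<cdot> h' = h \<cdot> c'"
    using TR3[OF t' t a'(2) b'(2)] by blast
  note H = H HomD[OF c(1)] HomD[OF c'(1)]
  have sa: "sus a' \<cdot> sus a = ident T (Sus X)" "sus a \<cdot> sus a' = ident T (Sus X')"
    using endofunctor_cmp[OF sus_endo a'(1,2)] endofunctor_cmp[OF sus_endo a'(2,1)] a'
    by (simp_all add: sus_simps H)
  have "is_iso T Z Z (c' \<cdot> c)"
  proof (rule exact_endo_is_iso[OF t])
    show "(c' \<cdot> c) \<cdot> g = g"
      by (simp add: H cat_simps c(2) eq_assoc[OF c'(2)] b'(3))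
    show "h \<cdot> (c' \<cdot> c) = h"
      by (simp add: H cat_simps sus_simps c(3)[symmetric] eq_assoc[OF c'(3)[symmetric]] eq_assoc[OF sa(1)])
  qed (use c c' cmp_hom in blast)
  moreover have "is_iso T Z' Z' (c \<cdot> c')"
  proof (rule exact_endo_is_iso[OF t'])
    show "(c \<cdot> c') \<cdot> g' = g'"
      by (simp add: H cat_simps c'(2) eq_assoc[OF c(2)] b'(4))
    show "h' \<cdot> (c \<cdot> c') = h'"
      by (simp add: H cat_simps sus_simps c'(3)[symmetric] eq_assoc[OF c(3)[symmetric]] eq_assoc[OF sa(2)])
  qed (use c c' cmp_hom in blast)
  ultimately have "is_iso T Z Z' c"
    by (rule is_iso_of_inverses[OF c(1) c'(1) _ c'(1)])
  with c show ?thesis by blast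
qed

text \<open>Rotation moves the unknown first component to third position. The resulting isomorphism
  between suspensions comes from a morphism by fullness, and the suspension reflects
  isomorphisms.\<close>

lemma TR3_iso_fiber:
  assumes t: "exact_triangle T X Y Z f g h" and t': "exact_triangle T X' Y' Z' f' g' h'"
    and b: "is_iso T Y Y' b" and c: "is_iso T Z Z' c" and sq: "c \<cdot> g = g' \<cdot> b"
  shows "\<exists>a. is_iso T X X' a \<and> b \<cdot> f = f' \<cdot> a \<and> sus a \<cdot> h = h' \<cdot> c"
proof -
  note h = exact_hom[OF t] exact_hom[OF t'] is_iso_hom[OF b] is_iso_hom[OF c]
  note H = HomD[OF h(1)] HomD[OF h(4)]
  obtain k where k: "is_iso T (Sus X) (Sus X') k" "k \<cdot> h = h' \<cdot> c"
      "sus b \<cdot> \<boxminus> (sus f) = \<boxminus> (sus f') \<cdot> k"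
    using TR3_iso[OF rotate[OF t] rotate[OF t'] b c sq] by blast
  obtain a where a: "a \<in> Hom T X X'" "sus a = k"
    using sus_full[OF is_iso_hom[OF k(1)]] H by blast
  have ai: "is_iso T X X' a"
    using sus_reflects_iso[OF a(1)] a(2) k(1) by simp
  have "\<boxminus> (sus b \<cdot> sus f) = \<boxminus> (sus f' \<cdot> sus a)"
    using k(3) cmp_hneg[OF sus_hom[OF h(1)] sus_hom[OF h(7)]]
      hneg_cmp[OF sus_hom[OF a(1)] sus_hom[OF h(4)]] a(2) by simp
  then have "sus b \<cdot> sus f = sus f' \<cdot> sus a"
    by (rule hneg_inject[OF cmp_hom[OF sus_hom[OF h(1)] sus_hom[OF h(7)]] cmp_hom[OF sus_hom[OF a(1)] sus_hom[OF h(4)]]])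
  then have "sus (b \<cdot> f) = sus (f' \<cdot> a)"
    using endofunctor_cmp[OF sus_endo h(1,7)] endofunctor_cmp[OF sus_endo a(1) h(4)] by simp
  then have "b \<cdot> f = f' \<cdot> a"
    by (rule sus_faithful[OF cmp_hom[OF h(1,7)] cmp_hom[OF a(1) h(4)]])
  with ai a k show ?thesis by blast
qed

text \<open>One more rotation reduces this to the unknown first component. It is the form needed to
  climb a left tower, where the isomorphisms on a stage and on the next cone are known.\<close>

lemma TR3_iso_mid:
  assumes t: "exact_triangle T X Y Z f g h" and t': "exact_triangle T X' Y' Z' f' g' h'"
    and a: "is_iso T X X' a" and c: "is_iso T Z Z' c" and sq: "sus a \<cdot> h = h' \<cdot> c"
  shows "\<exists>b. is_iso T Y Y' b \<and> b \<cdot> f = f' \<cdot> a \<and> c \<cdot> g = g' \<cdot> b"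
proof -
  note h = exact_hom[OF t] exact_hom[OF t'] is_iso_hom[OF a]
  obtain b where b: "is_iso T Y Y' b" "c \<cdot> g = g' \<cdot> b"
      "sus b \<cdot> \<boxminus> (sus f) = \<boxminus> (sus f') \<cdot> sus a"
    using TR3_iso_fiber[OF rotate[OF t] rotate[OF t'] c sus_is_iso[OF a] sq] by blast
  note bh = is_iso_hom[OF b(1)]
  have "\<boxminus> (sus b \<cdot> sus f) = \<boxminus> (sus f' \<cdot> sus a)"
    using b(3) cmp_hneg[OF sus_hom[OF h(1)] sus_hom[OF bh]]
      hneg_cmp[OF sus_hom[OF h(7)] sus_hom[OF h(4)]] by simp
  then have "sus b \<cdot> sus f = sus f' \<cdot> sus a"
    by (rule hneg_inject[OF cmp_hom[OF sus_hom[OF h(1)] sus_hom[OF bh]] cmp_hom[OF sus_hom[OF h(7)] sus_hom[OF h(4)]]])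
  then have "sus (b \<cdot> f) = sus (f' \<cdot> a)"
    using endofunctor_cmp[OF sus_endo h(1) bh] endofunctor_cmp[OF sus_endo h(7,4)] by simp
  then have "b \<cdot> f = f' \<cdot> a"
    by (rule sus_faithful[OF cmp_hom[OF h(1) bh] cmp_hom[OF h(7,4)]])
  with b show ?thesis by blast
qed

section \<open>Shifts of subcategories\<close>

lemma isomorphic_Sus_iff:
  assumes "X \<in> Ob T" "Y \<in> Ob T"
  shows "isomorphic T (Sus X) (Sus Y) \<longleftrightarrow> isomorphic T X Y"
proof
  assume "isomorphic T (Sus X) (Sus Y)"
  then obtain g where g: "is_iso T (Sus X) (Sus Y) g"
    by (auto simp: isomorphic_def)
  then obtain f where "f \<in> Hom T X Y" "sus f = g"
    using sus_full[OF is_iso_hom[OF g] assms] by blast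
  then show "isomorphic T X Y"
    using sus_reflects_iso g by (auto simp: isomorphic_def)
qed (rule endofunctor_isomorphic[OF sus_endo])

lemma shift_ob_Ob: "X \<in> Ob T \<Longrightarrow> shift_ob T n X \<in> Ob T"
proof -
  assume X: "X \<in> Ob T"
  have "(Sus ^^ k) X \<in> Ob T" "(Des ^^ k) X \<in> Ob T" for k
    by (induction k) (auto simp: X sus_simps)
  then show ?thesis by (simp add: shift_ob_def)
qed

text \<open>For negative \<open>n\<close> this is no equality: the suspension undoes the outermost
  desuspension only up to isomorphism.\<close>

lemma shift_ob_add1:
  assumes "X \<in> Ob T"
  shows "isomorphic T (shift_ob T (n + 1) X) (Sus (shift_ob T n X))"
proof (cases "0 \<le> n")
  case True
  then have "shift_ob T (n + 1) X = Sus (shift_ob T n X)"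
    by (simp add: shift_ob_def nat_add_distrib)
  then show ?thesis
    using assms by (simp add: isomorphic_refl shift_ob_Ob sus_simps)
next
  case False
  then have n: "nat (- n) = Suc (nat (- (n + 1)))"
    by simp
  have "shift_ob T n X = Des (shift_ob T (n + 1) X)"
    using False unfolding shift_ob_def n by simp
  then show ?thesis
    using Sus_Des[OF shift_ob_Ob[OF assms]] isomorphic_sym by metis
qed

lemma shift_subset: "shift T n \<X> \<subseteq> Ob T"
  by (auto simp: shift_def)

lemma shift_iso: "X \<in> shift T n \<X> \<Longrightarrow> isomorphic T Y X \<Longrightarrow> Y \<in> Ob T \<Longrightarrow> Y \<in> shift T n \<X>"
  unfolding shift_def using isomorphic_trans by blast

text \<open>Shifts are closed under isomorphism, which absorbs the failure of strictness in
  \<open>shift_ob_add1\<close>. The equivalence is what allows degrees to be moved both up and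
  down.\<close>

lemma Sus_shift_iff:
  assumes "\<X> \<subseteq> Ob T" "Z \<in> Ob T"
  shows "Sus Z \<in> shift T (n + 1) \<X> \<longleftrightarrow> Z \<in> shift T n \<X>"
proof -
  have "isomorphic T (Sus Z) (shift_ob T (n + 1) X) \<longleftrightarrow> isomorphic T Z (shift_ob T n X)"
    if "X \<in> \<X>" for X
  proof -
    have X: "X \<in> Ob T" using that assms by blast
    have "isomorphic T (Sus Z) (shift_ob T (n + 1) X) \<longleftrightarrow> isomorphic T (Sus Z) (Sus (shift_ob T n X))"
      using shift_ob_add1[OF X, of n] isomorphic_trans[of "Sus Z"] isomorphic_sym by blast
    then show ?thesis
      using isomorphic_Sus_iff[OF assms(2) shift_ob_Ob[OF X]] by simp
  qed
  then show ?thesis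
    using assms sus_simps by (auto simp: shift_def)
qed

lemma Des_shift:
  assumes "\<X> \<subseteq> Ob T" "Z \<in> shift T (n + 1) \<X>"
  shows "Des Z \<in> shift T n \<X>"
proof -
  have Z: "Z \<in> Ob T" using assms shift_subset by blast
  have "Sus (Des Z) \<in> shift T (n + 1) \<X>"
    using shift_iso[OF assms(2) Sus_Des[OF Z]] Z by (simp add: sus_simps)
  then show ?thesis
    using Sus_shift_iff[OF assms(1) sus_simps(7)[OF Z]] by simp
qed

lemma shift_0: "\<X> \<subseteq> Ob T \<Longrightarrow> \<X> \<subseteq> shift T 0 \<X>"
  by (fastforce simp: shift_def shift_ob_def intro: isomorphic_refl)

text \<open>The hypothesis is the case \<open>i = 0\<close>. Suspending or desuspending both objects
  together changes \<open>i\<close> while the gap \<open>n\<close> stays fixed, so integer induction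
  in both directions covers every degree.\<close>

lemma shift_hom_vanishes:
  assumes X: "\<X> \<subseteq> Ob T"
    and van: "\<And>n :: nat. n \<ge> 1 \<Longrightarrow> hom_vanishes T \<X> (shift T (- int n) \<X>)"
    and "j < i" "V \<in> shift T i \<X>" "W \<in> shift T j \<X>"
  shows "orth V W"
proof -
  define n where "n = nat (i - j)"
  have n: "n \<ge> 1" "j = i - int n" using assms(3) by (auto simp: n_def)
  have "\<forall>V \<in> shift T i \<X>. \<forall>W \<in> shift T (i - int n) \<X>. orth V W"
  proof (induction i rule: int_induct[of _ 0])
    case base
    show ?case
    proof (intro ballI)
      fix V W assume V: "V \<in> shift T 0 \<X>" and W: "W \<in> shift T (0 - int n) \<X>"
      obtain V' where V': "V' \<in> \<X>" "isomorphic T V V'"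
        using V by (auto simp: shift_def shift_ob_def)
      have "orth V' W"
        using van[OF n(1)] V' W by (auto simp: hom_vanishes_def orth_def)
      then show "orth V W"
        using orth_iso[OF isomorphic_sym[OF V'(2)] isomorphic_refl] W shift_subset by blast
    qed
  next
    case (step1 i)
    show ?case
    proof (intro ballI)
      fix V W assume VW: "V \<in> shift T (i + 1) \<X>" "W \<in> shift T (i + 1 - int n) \<X>"
      then have O: "V \<in> Ob T" "W \<in> Ob T" using shift_subset by blast+
      have "W \<in> shift T ((i - int n) + 1) \<X>"
        using VW(2) by (simp add: algebra_simps)
      then have "orth (Des V) (Des W)"
        using step1.IH Des_shift[OF X] VW(1) by blast
      then have "orth (Sus (Des V)) (Sus (Des W))"
        using O by (simp add: orth_Sus_iff sus_simps)
      then show "orth V W"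
        by (rule orth_iso[OF Sus_Des[OF O(1)] Sus_Des[OF O(2)]])
    qed
  next
    case (step2 i)
    show ?case
    proof (intro ballI)
      fix V W assume VW: "V \<in> shift T (i - 1) \<X>" "W \<in> shift T (i - 1 - int n) \<X>"
      then have O: "V \<in> Ob T" "W \<in> Ob T" using shift_subset by blast+
      have "Sus V \<in> shift T (i - 1 + 1) \<X>" "Sus W \<in> shift T (i - 1 - int n + 1) \<X>"
        unfolding Sus_shift_iff[OF X O(1)] Sus_shift_iff[OF X O(2)] by (fact VW)+
      then have "orth (Sus V) (Sus W)"
        using step2.IH by (simp add: algebra_simps)
      then show "orth V W"
        using O by (simp add: orth_Sus_iff)
    qed
  qed
  then show ?thesis
    using assms n by blast
qed

end

section \<open>Triangle endofunctors\<close>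

locale triangle_functor = triangulated_category T
  for T :: "('o, 'm, 'z) tricat_scheme" (structure) +
  fixes Fo :: "'o \<Rightarrow> 'o" and Fm :: "'m \<Rightarrow> 'm" and \<omega> :: "'o \<Rightarrow> 'm"
  assumes triangle_endo: "triangle_endofunctor T Fo Fm \<omega>"
begin

lemma F_additive: "additive_endofunctor T Fo Fm" and F_endo: "endofunctor T Fo Fm"
  using triangle_endo by (auto simp: triangle_endofunctor_def additive_endofunctor_def)

lemmas F_hom = endofunctor_hom[OF F_endo]
  and F_cmp = endofunctor_cmp[OF F_endo]
  and F_simps = endofunctor_simps[OF F_endo]
  and F_is_iso = endofunctor_is_iso[OF F_endo]

lemma F_exact:
  "exact_triangle T X Y Z f g h \<Longrightarrow> exact_triangle T (Fo X) (Fo Y) (Fo Z) (Fm f) (Fm g) (\<omega> X \<cdot> Fm h)"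
  using triangle_endo by (simp add: triangle_endofunctor_def)

lemma \<omega>_is_iso: "X \<in> Ob T \<Longrightarrow> is_iso T (Fo (Sus X)) (Sus (Fo X)) (\<omega> X)"
  using triangle_endo by (simp add: triangle_endofunctor_def natural_iso_on_def)

lemma \<omega>_natural: "f \<in> Hom T X Y \<Longrightarrow> \<omega> Y \<cdot> Fm (sus f) = sus (Fm f) \<cdot> \<omega> X"
  using triangle_endo HomD(4,5)[of f X Y] by (simp add: triangle_endofunctor_def natural_iso_on_def)

section \<open>Natural isomorphisms from the functor to the identity and their propagation to all
  degrees\<close>

abbreviation nat_iso :: "'o set \<Rightarrow> ('o \<Rightarrow> 'm) \<Rightarrow> bool" where
  "nat_iso \<X> \<tau> \<equiv> natural_iso_on T \<X> Fo Fm id id \<tau>"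

lemma nat_iso_iso: "nat_iso \<X> \<tau> \<Longrightarrow> X \<in> \<X> \<Longrightarrow> is_iso T (Fo X) X (\<tau> X)"
  and nat_iso_nat: "nat_iso \<X> \<tau> \<Longrightarrow> X \<in> \<X> \<Longrightarrow> Y \<in> \<X> \<Longrightarrow> f \<in> Hom T X Y \<Longrightarrow> \<tau> Y \<cdot> Fm f = f \<cdot> \<tau> X"
  by (simp_all add: natural_iso_on_def)

text \<open>The composite \<open>F(\<Sigma> X) \<rightarrow> \<Sigma>(F X) \<rightarrow> \<Sigma>
  Y\<close> of \<open>\<omega>\<close> with the suspension of
  \<open>a : F X \<rightarrow> Y\<close>.\<close>

definition susp :: "'o \<Rightarrow> 'm \<Rightarrow> 'm" where
  "susp X a = sus a \<cdot> \<omega> X"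

lemma susp_hom: "X \<in> Ob T \<Longrightarrow> a \<in> Hom T (Fo X) Y \<Longrightarrow> susp X a \<in> Hom T (Fo (Sus X)) (Sus Y)"
  unfolding susp_def using is_iso_hom[OF \<omega>_is_iso] sus_hom cmp_hom by blast

lemma susp_is_iso: "X \<in> Ob T \<Longrightarrow> is_iso T (Fo X) Y a \<Longrightarrow> is_iso T (Fo (Sus X)) (Sus Y) (susp X a)"
  unfolding susp_def by (rule is_iso_cmp[OF \<omega>_is_iso sus_is_iso])

text \<open>By naturality of \<open>\<omega>\<close> both sides of the suspended square are
  suspensions composed with \<open>\<omega> X\<close>. Cancelling \<open>\<omega> X\<close> and
  using faithfulness of the suspension makes this an equivalence, so naturality can be carried in
  either direction.\<close>

lemma susp_square_iff:
  assumes a: "a \<in> Hom T (Fo X) X" and b: "b \<in> Hom T (Fo Y) Y" and f: "f \<in> Hom T X Y"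
  shows "susp Y b \<cdot> Fm (sus f) = sus f \<cdot> susp X a \<longleftrightarrow> b \<cdot> Fm f = f \<cdot> a"
proof -
  note h = HomD[OF f] HomD[OF a] HomD[OF b]
  note \<omega>X = is_iso_hom[OF \<omega>_is_iso[OF h(4)]] and \<omega>Y = is_iso_hom[OF \<omega>_is_iso[OF h(5)]]
  note h = h HomD[OF \<omega>X] HomD[OF \<omega>Y]
  have 1: "susp Y b \<cdot> Fm (sus f) = sus (b \<cdot> Fm f) \<cdot> \<omega> X"
    unfolding susp_def by (simp add: h cat_simps sus_simps F_simps \<omega>_natural[OF f])
  have 2: "sus f \<cdot> susp X a = sus (f \<cdot> a) \<cdot> \<omega> X"
    unfolding susp_def by (simp add: h cat_simps sus_simps F_simps)
  have l: "b \<cdot> Fm f \<in> Hom T (Fo X) Y" and r: "f \<cdot> a \<in> Hom T (Fo X) Y"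
    using F_hom[OF f] a b f cmp_hom by blast+
  show ?thesis
    unfolding 1 2
    using is_iso_cancel_right[OF \<omega>_is_iso[OF h(4)] sus_hom[OF l] sus_hom[OF r]] sus_faithful[OF l r]
    by auto
qed

text \<open>An object \<open>Z\<close> of \<open>\<Y>\<close> is only isomorphic to a suspension, so
  \<open>s Z : Z \<rightarrow> Sus (q Z)\<close> is chosen and the suspended component is conjugated
  by it. Fullness of the suspension supplies naturality against all morphisms.\<close>

lemma nat_iso_suspend:
  assumes \<tau>: "nat_iso \<X> \<tau>" and X: "\<X> \<subseteq> Ob T" and Y: "\<Y> \<subseteq> Ob T"
    and ess: "\<And>Z. Z \<in> \<Y> \<Longrightarrow> \<exists>X \<in> \<X>. isomorphic T Z (Sus X)"
    and sub: "\<And>X. X \<in> \<X> \<Longrightarrow> Sus X \<in> \<Y>"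
  shows "\<exists>\<tau>'. nat_iso \<Y> \<tau>' \<and> (\<forall>X \<in> \<X>. \<tau>' (Sus X) = susp X (\<tau> X))"
proof -
  have "\<exists>X s t. X \<in> \<X> \<and> s \<in> Hom T Z (Sus X) \<and> t \<in> Hom T (Sus X) Z \<and>
      t \<cdot> s = ident T Z \<and> s \<cdot> t = ident T (Sus X)" if "Z \<in> \<Y>" for Z
    using ess[OF that] by (auto simp: isomorphic_def is_iso_def)
  then obtain q s t where q: "\<And>Z. Z \<in> \<Y> \<Longrightarrow> q Z \<in> \<X>"
    and s: "\<And>Z. Z \<in> \<Y> \<Longrightarrow> s Z \<in> Hom T Z (Sus (q Z))"
    and t: "\<And>Z. Z \<in> \<Y> \<Longrightarrow> t Z \<in> Hom T (Sus (q Z)) Z"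
    and ts: "\<And>Z. Z \<in> \<Y> \<Longrightarrow> t Z \<cdot> s Z = ident T Z"
    and st: "\<And>Z. Z \<in> \<Y> \<Longrightarrow> s Z \<cdot> t Z = ident T (Sus (q Z))"
    by metis
  define \<sigma> where "\<sigma> X = susp X (\<tau> X)" for X
  define \<tau>' where "\<tau>' Z = t Z \<cdot> (\<sigma> (q Z) \<cdot> Fm (s Z))" for Z
  have \<sigma>_iso: "is_iso T (Fo (Sus X)) (Sus X) (\<sigma> X)" if "X \<in> \<X>" for X
    unfolding \<sigma>_def using that X nat_iso_iso[OF \<tau>] by (intro susp_is_iso) auto
  have \<sigma>_nat: "\<sigma> X' \<cdot> Fm g = g \<cdot> \<sigma> X" if XX: "X \<in> \<X>" "X' \<in> \<X>" and g: "g \<in> Hom T (Sus X) (Sus X')" for X X' g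
  proof -
    obtain f where f: "f \<in> Hom T X X'" "sus f = g"
      using sus_full[OF g] XX X by blast
    have "\<tau> X' \<cdot> Fm f = f \<cdot> \<tau> X"
      by (rule nat_iso_nat[OF \<tau> XX f(1)])
    then show ?thesis
      using susp_square_iff[OF is_iso_hom[OF nat_iso_iso[OF \<tau> XX(1)]]
          is_iso_hom[OF nat_iso_iso[OF \<tau> XX(2)]] f(1)] f(2) by (simp add: \<sigma>_def)
  qed
  have "nat_iso \<Y> \<tau>'"
    unfolding natural_iso_on_def id_apply
  proof (intro conjI ballI)
    fix Z assume Z: "Z \<in> \<Y>"
    have "is_iso T Z (Sus (q Z)) (s Z)" "is_iso T (Sus (q Z)) Z (t Z)"
      using is_isoI[OF s t ts st] is_isoI[OF t s st ts] Z by auto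
    then show "is_iso T (Fo Z) Z (\<tau>' Z)"
      unfolding \<tau>'_def using \<sigma>_iso[OF q[OF Z]] by (blast intro: is_iso_cmp F_is_iso)
  next
    fix Z Z' f assume Z: "Z \<in> \<Y>" "Z' \<in> \<Y>" and f: "f \<in> Hom T Z Z'"
    note h = HomD[OF f] HomD[OF s[OF Z(1)]] HomD[OF s[OF Z(2)]] HomD[OF t[OF Z(1)]] HomD[OF t[OF Z(2)]]
      HomD[OF is_iso_hom[OF \<sigma>_iso[OF q[OF Z(1)]]]] HomD[OF is_iso_hom[OF \<sigma>_iso[OF q[OF Z(2)]]]]
    define g where "g = s Z' \<cdot> (f \<cdot> t Z)"
    have g: "g \<in> Hom T (Sus (q Z)) (Sus (q Z'))"
      unfolding g_def using s[OF Z(2)] t[OF Z(1)] f by (blast intro: cmp_hom)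
    note h = h HomD[OF g]
    have gs: "g \<cdot> s Z = s Z' \<cdot> f"
      unfolding g_def by (simp add: h cat_simps ts[OF Z(1)])
    have tg: "t Z' \<cdot> g = f \<cdot> t Z"
      unfolding g_def by (simp add: h cat_simps eq_assoc[OF ts[OF Z(2)]])
    have "\<tau>' Z' \<cdot> Fm f = t Z' \<cdot> (\<sigma> (q Z') \<cdot> Fm (s Z' \<cdot> f))"
      unfolding \<tau>'_def by (simp add: h cat_simps F_simps)
    also have "\<dots> = t Z' \<cdot> ((\<sigma> (q Z') \<cdot> Fm g) \<cdot> Fm (s Z))"
      unfolding gs[symmetric] by (simp add: h cat_simps F_simps)
    also have "\<dots> = (t Z' \<cdot> g) \<cdot> (\<sigma> (q Z) \<cdot> Fm (s Z))"
      unfolding \<sigma>_nat[OF q[OF Z(1)] q[OF Z(2)] g] by (simp add: h cat_simps F_simps)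
    also have "\<dots> = f \<cdot> \<tau>' Z"
      unfolding tg \<tau>'_def by (simp add: h cat_simps F_simps)
    finally show "\<tau>' Z' \<cdot> Fm f = f \<cdot> \<tau>' Z" .
  qed
  \<comment> \<open>The chosen \<open>q (Sus V)\<close> may differ from \<open>V\<close>; naturality
    applied to \<open>s (Sus V)\<close> removes the dependence on that choice.\<close>
  moreover have "\<tau>' (Sus V) = susp V (\<tau> V)" if V: "V \<in> \<X>" for V
  proof -
    note Z = sub[OF V]
    note h = HomD[OF s[OF Z]] HomD[OF t[OF Z]] HomD[OF is_iso_hom[OF \<sigma>_iso[OF V]]]
    have "\<tau>' (Sus V) = t (Sus V) \<cdot> (s (Sus V) \<cdot> \<sigma> V)"
      unfolding \<tau>'_def \<sigma>_nat[OF V q[OF Z] s[OF Z]] ..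
    also have "\<dots> = \<sigma> V"
      by (simp add: h cat_simps eq_assoc[OF ts[OF Z]])
    finally show ?thesis by (simp add: \<sigma>_def)
  qed
  ultimately show ?thesis by blast
qed

text \<open>The component at \<open>Z\<close> is the preimage under the suspension of
  \<open>\<tau> (Sus Z)\<close> composed with the inverse of \<open>\<omega> Z\<close>. Faithfulness
  makes naturality descend.\<close>

lemma nat_iso_desuspend:
  assumes \<tau>: "nat_iso \<Y> \<tau>" and X: "\<X> \<subseteq> Ob T" and sub: "\<And>X. X \<in> \<X> \<Longrightarrow> Sus X \<in> \<Y>"
  shows "\<exists>\<tau>'. nat_iso \<X> \<tau>' \<and> (\<forall>X \<in> \<X>. \<tau> (Sus X) = susp X (\<tau>' X))"
proof -
  have "\<exists>a. is_iso T (Fo Z) Z a \<and> \<tau> (Sus Z) = susp Z a" if "Z \<in> \<X>" for Z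
  proof -
    have Z: "Z \<in> Ob T" using that X by blast
    note h = F_simps(1)[OF Z] sus_simps(1)
    obtain w where w: "is_iso T (Sus (Fo Z)) (Fo (Sus Z)) w" "w \<cdot> \<omega> Z = ident T (Fo (Sus Z))"
      using is_iso_inverse[OF \<omega>_is_iso[OF Z]] by blast
    note \<tau>i = nat_iso_iso[OF \<tau> sub[OF that]]
    have g: "is_iso T (Sus (Fo Z)) (Sus Z) (\<tau> (Sus Z) \<cdot> w)"
      by (rule is_iso_cmp[OF w(1) \<tau>i])
    obtain a where a: "a \<in> Hom T (Fo Z) Z" "sus a = \<tau> (Sus Z) \<cdot> w"
      using sus_full[OF is_iso_hom[OF g]] h Z by blast
    have "is_iso T (Fo Z) Z a"
      by (rule sus_reflects_iso[OF a(1)]) (simp add: a(2) g)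
    moreover have "susp Z a = \<tau> (Sus Z)"
      unfolding susp_def a(2) using cmp_assoc[OF is_iso_hom[OF \<omega>_is_iso[OF Z]] is_iso_hom[OF w(1)] is_iso_hom[OF \<tau>i]]
        w(2) cmp_ident[OF is_iso_hom[OF \<tau>i]] by simp
    ultimately show ?thesis by metis
  qed
  then obtain \<tau>' where \<tau>': "\<And>Z. Z \<in> \<X> \<Longrightarrow> is_iso T (Fo Z) Z (\<tau>' Z)"
    "\<And>Z. Z \<in> \<X> \<Longrightarrow> \<tau> (Sus Z) = susp Z (\<tau>' Z)"
    by metis
  have "nat_iso \<X> \<tau>'"
    unfolding natural_iso_on_def id_apply
  proof (intro conjI ballI \<tau>'(1))
    fix V W f assume V: "V \<in> \<X>" and W: "W \<in> \<X>" and f: "f \<in> Hom T V W"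
    have "susp W (\<tau>' W) \<cdot> Fm (sus f) = sus f \<cdot> susp V (\<tau>' V)"
      using nat_iso_nat[OF \<tau> sub[OF V] sub[OF W] sus_hom[OF f]] \<tau>'(2)[OF V] \<tau>'(2)[OF W] by simp
    then show "\<tau>' W \<cdot> Fm f = f \<cdot> \<tau>' V"
      using susp_square_iff[OF is_iso_hom[OF \<tau>'(1)[OF V]] is_iso_hom[OF \<tau>'(1)[OF W]] f] by blast
  qed
  with \<tau>' show ?thesis by blast
qed

text \<open>Dependent choice builds one sequence upwards by suspending and one downwards by
  desuspending. Both start at \<open>\<eta>\<close>, so they can be glued in degree 0.\<close>

lemma shift_nat_iso:
  assumes \<X>: "\<X> \<subseteq> Ob T" and \<eta>: "nat_iso (shift T 0 \<X>) \<eta>"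
  obtains E :: "int \<Rightarrow> 'o \<Rightarrow> 'm" where "\<And>k. nat_iso (shift T k \<X>) (E k)" "E 0 = \<eta>"
    "\<And>k Z. Z \<in> shift T k \<X> \<Longrightarrow> E (k + 1) (Sus Z) = susp Z (E k Z)"
proof -
  let ?D = "\<lambda>k. shift T k \<X>"
  have D: "?D k \<subseteq> Ob T" for k by (rule shift_subset)
  have Sus_D: "Sus Z \<in> ?D (k + 1)" if "Z \<in> ?D k" for k Z
    using Sus_shift_iff[OF \<X>] that D by blast
  have ess: "\<exists>X \<in> ?D k. isomorphic T Z (Sus X)" if "Z \<in> ?D (k + 1)" for k Z
    using Des_shift[OF \<X> that] isomorphic_sym[OF Sus_Des] that D by blast
  have "\<exists>u. \<forall>n. (nat_iso (?D (int n)) (u n) \<and> (n = 0 \<longrightarrow> u n = \<eta>)) \<and>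
      (\<forall>Z \<in> ?D (int n). u (Suc n) (Sus Z) = susp Z (u n Z))"
  proof (rule dependent_nat_choice)
    show "\<exists>x. nat_iso (?D (int 0)) x \<and> (0 = 0 \<longrightarrow> x = \<eta>)"
      using \<eta> by simp
    fix x :: "'o \<Rightarrow> 'm" and n :: nat
    assume x: "nat_iso (?D (int n)) x \<and> (n = 0 \<longrightarrow> x = \<eta>)"
    have "\<exists>y. nat_iso (?D (int n + 1)) y \<and> (\<forall>Z \<in> ?D (int n). y (Sus Z) = susp Z (x Z))"
      by (rule nat_iso_suspend[OF conjunct1[OF x] D D ess Sus_D])
    then show "\<exists>y. (nat_iso (?D (int (Suc n))) y \<and> (Suc n = 0 \<longrightarrow> y = \<eta>)) \<and>
        (\<forall>Z \<in> ?D (int n). y (Sus Z) = susp Z (x Z))"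
      by (simp add: add.commute)
  qed
  then obtain u where u: "\<And>n. nat_iso (?D (int n)) (u n)" "u 0 = \<eta>"
    "\<And>n Z. Z \<in> ?D (int n) \<Longrightarrow> u (Suc n) (Sus Z) = susp Z (u n Z)"
    by blast
  have "\<exists>v. \<forall>n. (nat_iso (?D (- int n)) (v n) \<and> (n = 0 \<longrightarrow> v n = \<eta>)) \<and>
      (\<forall>Z \<in> ?D (- int (Suc n)). v n (Sus Z) = susp Z (v (Suc n) Z))"
  proof (rule dependent_nat_choice)
    show "\<exists>x. nat_iso (?D (- int 0)) x \<and> (0 = 0 \<longrightarrow> x = \<eta>)"
      using \<eta> by simp
    fix x :: "'o \<Rightarrow> 'm" and n :: nat
    assume x: "nat_iso (?D (- int n)) x \<and> (n = 0 \<longrightarrow> x = \<eta>)"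
    have "Sus Z \<in> ?D (- int n)" if "Z \<in> ?D (- int (Suc n))" for Z
      using Sus_D[OF that] by simp
    then have "\<exists>y. nat_iso (?D (- int (Suc n))) y \<and> (\<forall>Z \<in> ?D (- int (Suc n)). x (Sus Z) = susp Z (y Z))"
      by (rule nat_iso_desuspend[OF conjunct1[OF x] D])
    then show "\<exists>y. (nat_iso (?D (- int (Suc n))) y \<and> (Suc n = 0 \<longrightarrow> y = \<eta>)) \<and>
        (\<forall>Z \<in> ?D (- int (Suc n)). x (Sus Z) = susp Z (y Z))"
      by simp
  qed
  then obtain v where v: "\<And>n. nat_iso (?D (- int n)) (v n)" "v 0 = \<eta>"
    "\<And>n Z. Z \<in> ?D (- int (Suc n)) \<Longrightarrow> v n (Sus Z) = susp Z (v (Suc n) Z)"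
    by blast
  define E where "E k = (if 0 \<le> k then u (nat k) else v (nat (- k)))" for k
  show thesis
  proof (rule that)
    show "nat_iso (?D k) (E k)" for k
      using u(1)[of "nat k"] v(1)[of "nat (- k)"] by (auto simp: E_def)
    show "E 0 = \<eta>" by (simp add: E_def u)
    fix k Z assume Z: "Z \<in> ?D k"
    show "E (k + 1) (Sus Z) = susp Z (E k Z)"
    proof (cases "0 \<le> k")
      case True
      then show ?thesis
        using u(3)[of Z "nat k"] Z by (simp add: E_def nat_add_distrib)
    next
      case False
      define n where "n = nat (- k - 1)"
      have k: "k = - int (Suc n)" using False by (simp add: n_def)
      \<comment> \<open>For \<open>k = - 1\<close> the left side falls into the branch of
        \<open>u\<close>, and \<open>u 0\<close> and \<open>v 0\<close> are both
        \<open>\<eta>\<close>.\<close>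
      have "E (k + 1) = v n"
        by (cases n) (auto simp: E_def k u v nat_add_distrib)
      moreover have "E k = v (Suc n)"
        using False by (simp add: E_def n_def Suc_nat_eq_nat_zadd1)
      ultimately show ?thesis
        using v(3)[of Z n] Z k by simp
    qed
  qed
qed

end

section \<open>Towers\<close>

text \<open>Isolates what the induction along a tower uses: vanishing in negative degrees on a class
  \<open>\<C>\<close>, and isomorphisms on all its shifts that are compatible with the
  suspension.\<close>

locale shift_identity = triangle_functor T Fo Fm \<omega>
  for T :: "('o, 'm, 'z) tricat_scheme" (structure)
    and Fo :: "'o \<Rightarrow> 'o" and Fm :: "'m \<Rightarrow> 'm" and \<omega> :: "'o \<Rightarrow> 'm" +
  fixes \<C> :: "'o set" and E :: "int \<Rightarrow> 'o \<Rightarrow> 'm"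
  assumes C_Ob: "\<C> \<subseteq> Ob T"
    and vanish: "\<And>n :: nat. n \<ge> 1 \<Longrightarrow> hom_vanishes T \<C> (shift T (- int n) \<C>)"
    and E_nat_iso: "nat_iso (shift T k \<C>) (E k)"
    and E_Sus: "Z \<in> shift T k \<C> \<Longrightarrow> E (k + 1) (Sus Z) = susp Z (E k Z)"
begin

abbreviation D :: "int \<Rightarrow> 'o set" where "D k \<equiv> shift T k \<C>"

lemma D_Ob: "Z \<in> D k \<Longrightarrow> Z \<in> Ob T"
  using shift_subset by blast

lemma D_orth: "V \<in> D i \<Longrightarrow> W \<in> D j \<Longrightarrow> j < i \<Longrightarrow> orth V W"
  using shift_hom_vanishes[OF C_Ob vanish] by blast

lemma D_Sus: "Z \<in> D k \<Longrightarrow> Sus Z \<in> D (k + 1)"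
  using Sus_shift_iff[OF C_Ob D_Ob] by blast

lemmas E_iso = nat_iso_iso[OF E_nat_iso]
  and E_natural = nat_iso_nat[OF E_nat_iso]

text \<open>Up to the isomorphism \<open>Sus (Des Z) \<cong> Z\<close>, the morphism
  \<open>h\<close> is the suspension of a morphism from \<open>D k\<close> to \<open>X\<close>,
  where \<open>nat\<close> applies. With \<open>h\<close> an attaching morphism of a tower this is
  the connecting square of a morphism of triangles.\<close>

lemma susp_natural_from:
  assumes X: "X \<in> Ob T" and x: "x \<in> Hom T (Fo X) X"
    and nat: "\<And>V f. V \<in> D k \<Longrightarrow> f \<in> Hom T V X \<Longrightarrow> x \<cdot> Fm f = f \<cdot> E k V"
    and Z: "Z \<in> D (k + 1)" and h: "h \<in> Hom T Z (Sus X)"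
  shows "susp X x \<cdot> Fm h = h \<cdot> E (k + 1) Z"
proof -
  define V where "V = Des Z"
  have V: "V \<in> D k" "V \<in> Ob T" "Z \<in> Ob T"
    unfolding V_def using Des_shift[OF C_Ob Z] D_Ob Z by blast+
  obtain s where s: "is_iso T (Sus V) Z s"
    using Sus_Des[OF V(3)] by (auto simp: V_def isomorphic_def)
  note sh = is_iso_hom[OF s]
  obtain u where u: "u \<in> Hom T V X" "sus u = h \<cdot> s"
    using sus_full[OF cmp_hom[OF sh h] V(2) X] by blast
  note EV = is_iso_hom[OF E_iso[OF V(1)]] and EZ = is_iso_hom[OF E_iso[OF Z]]
    and sx = susp_hom[OF X x] and ES = is_iso_hom[OF E_iso[OF D_Sus[OF V(1)]]]
  note H = HomD[OF h] HomD[OF sh] HomD[OF u(1)] HomD[OF EZ] HomD[OF sx] HomD[OF ES]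
  have "susp X x \<cdot> Fm (sus u) = sus u \<cdot> susp V (E k V)"
    using susp_square_iff[OF EV x u(1)] nat[OF V(1) u(1)] by simp
  then have eq: "susp X x \<cdot> Fm (h \<cdot> s) = (h \<cdot> s) \<cdot> E (k + 1) (Sus V)"
    using u(2) E_Sus[OF V(1)] by simp
  have "(susp X x \<cdot> Fm h) \<cdot> Fm s = (h \<cdot> s) \<cdot> E (k + 1) (Sus V)"
    unfolding eq[symmetric] by (simp add: H cat_simps F_simps)
  also have "\<dots> = h \<cdot> (s \<cdot> E (k + 1) (Sus V))"
    by (simp add: H cat_simps)
  also have "\<dots> = (h \<cdot> E (k + 1) Z) \<cdot> Fm s"
    unfolding E_natural[OF D_Sus[OF V(1)] Z sh, symmetric] by (simp add: H cat_simps F_simps)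
  finally show ?thesis
    by (rule is_iso_cancel_right[OF F_is_iso[OF s] cmp_hom[OF F_hom[OF h] sx] cmp_hom[OF EZ h]])
qed

text \<open>The stage \<open>X n\<close> is an iterated extension of objects of \<open>D 0\<close>,
  ..., \<open>D n\<close>, and \<open>W\<close> lies in a degree above all of them.\<close>

lemma left_tower_orth_from:
  assumes X0: "X 0 \<in> D 0" and t: "\<And>n. exact_triangle T (X n) (X (Suc n)) (Z n) (\<phi> n) (p n) (h n)"
    and Z: "\<And>n. Z n \<in> D (int n + 1)" and "W \<in> D j" "j > int n"
  shows "orth W (X n)"
  using assms(5)
proof (induction n)
  case 0
  then show ?case using D_orth[OF assms(4) X0] by simp
next
  case (Suc n)
  show ?case
    using Suc by (intro orth_exact_right[OF t] D_orth[OF assms(4) Z] D_Ob[OF assms(4)]) auto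
qed

text \<open>The same filtration, used in the first argument. \<open>W\<close> is left general
  because it will be an object or a desuspension of an object outside the shifts of the
  core.\<close>

lemma left_tower_orth_to:
  assumes X0: "X 0 \<in> D 0" and t: "\<And>n. exact_triangle T (X n) (X (Suc n)) (Z n) (\<phi> n) (p n) (h n)"
    and Z: "\<And>n. Z n \<in> D (int n + 1)"
    and W: "W \<in> Ob T" "\<And>j V. 0 \<le> j \<Longrightarrow> V \<in> D j \<Longrightarrow> orth V W"
  shows "orth (X n) W"
proof (induction n)
  case 0
  then show ?case using W(2)[OF _ X0] by simp
next
  case (Suc n)
  then show ?case
    by (rule orth_exact_left[OF t _ W(2)[OF _ Z] W(1)]) simp
qed

text \<open>
  The isomorphism on \<open>X n\<close> is required to be compatible with all morphisms from \<open>\<Sigma>\<^sup>n(\<C>)\<close>,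
  which makes it compatible with the attaching morphism \<open>h n\<close>. The condition propagates because
  \<open>Hom(\<Sigma>\<^sup>n\<^sup>+\<^sup>1(\<C>), X n) = 0\<close>, so morphisms from \<open>\<Sigma>\<^sup>n\<^sup>+\<^sup>1(\<C>)\<close> to \<open>X (n + 1)\<close> are detected by \<open>p n\<close>.
\<close>

lemma left_tower_iso:
  assumes X0: "X 0 \<in> D 0" and t: "\<And>n. exact_triangle T (X n) (X (Suc n)) (Z n) (\<phi> n) (p n) (h n)"
    and Z: "\<And>n. Z n \<in> D (int n + 1)"
  obtains \<theta> where "\<theta> 0 = E 0 (X 0)" "\<And>n. is_iso T (Fo (X n)) (X n) (\<theta> n)"
    "\<And>n. \<theta> (Suc n) \<cdot> Fm (\<phi> n) = \<phi> n \<cdot> \<theta> n"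
proof -
  let ?P = "\<lambda>n x. is_iso T (Fo (X n)) (X n) x \<and> (n = 0 \<longrightarrow> x = E 0 (X 0)) \<and>
    (\<forall>W f. W \<in> D (int n) \<longrightarrow> f \<in> Hom T W (X n) \<longrightarrow> x \<cdot> Fm f = f \<cdot> E (int n) W)"
  have "\<exists>\<theta>. \<forall>n. ?P n (\<theta> n) \<and> \<theta> (Suc n) \<cdot> Fm (\<phi> n) = \<phi> n \<cdot> \<theta> n"
  proof (rule dependent_nat_choice)
    show "\<exists>x. ?P 0 x"
      using E_iso[OF X0] E_natural[OF _ X0] by auto
    fix x n
    assume P: "?P n x"
    then have x: "is_iso T (Fo (X n)) (X n) x"
      and nat: "\<And>W f. W \<in> D (int n) \<Longrightarrow> f \<in> Hom T W (X n) \<Longrightarrow> x \<cdot> Fm f = f \<cdot> E (int n) W"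
      by auto
    note hh = exact_hom[OF t[of n]]
    note H = HomD[OF hh(1)] HomD[OF hh(2)] HomD[OF hh(3)]
    note EZ = E_iso[OF Z[of n]] and \<omega>h = is_iso_hom[OF \<omega>_is_iso[OF H(4)]]
    have "susp (X n) x \<cdot> Fm (h n) = h n \<cdot> E (int n + 1) (Z n)"
      by (rule susp_natural_from[OF H(4) is_iso_hom[OF x] nat Z hh(3)])
    then have "sus x \<cdot> (\<omega> (X n) \<cdot> Fm (h n)) = h n \<cdot> E (int n + 1) (Z n)"
      unfolding susp_def using cmp_assoc[OF F_hom[OF hh(3)] \<omega>h sus_hom[OF is_iso_hom[OF x]]] by simp
    then obtain y where y: "is_iso T (Fo (X (Suc n))) (X (Suc n)) y"
        "y \<cdot> Fm (\<phi> n) = \<phi> n \<cdot> x" "E (int n + 1) (Z n) \<cdot> Fm (p n) = p n \<cdot> y"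
      using TR3_iso_mid[OF F_exact[OF t[of n]] t[of n] x EZ] by blast
    have "y \<cdot> Fm f = f \<cdot> E (int n + 1) W" if W: "W \<in> D (int n + 1)" and f: "f \<in> Hom T W (X (Suc n))" for W f
    proof (rule exact_cancel_left[OF t[of n]])
      note yh = is_iso_hom[OF y(1)] and EW = E_iso[OF W]
      note EWh = is_iso_hom[OF EW] and EZh = is_iso_hom[OF EZ]
      note H = H HomD[OF f] HomD[OF yh] HomD[OF EWh] HomD[OF EZh]
      have "orth W (X n)"
        by (rule left_tower_orth_from[OF X0 t Z W]) simp
      \<comment> \<open>The two morphisms being compared start at \<open>Fo W\<close>, so the
        vanishing is transported from \<open>W\<close> along \<open>E\<close>.\<close>
      moreover have "isomorphic T W (Fo W)"
        using EW isomorphic_sym by (auto simp: isomorphic_def)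
      ultimately show "orth (Fo W) (X n)"
        using orth_iso isomorphic_refl[OF H(4)] by blast
      show "y \<cdot> Fm f \<in> Hom T (Fo W) (X (Suc n))" "f \<cdot> E (int n + 1) W \<in> Hom T (Fo W) (X (Suc n))"
        by (rule cmp_hom[OF F_hom[OF f] yh], rule cmp_hom[OF EWh f])
      have "p n \<cdot> (y \<cdot> Fm f) = E (int n + 1) (Z n) \<cdot> Fm (p n \<cdot> f)"
        by (simp add: H cat_simps F_simps eq_assoc[OF y(3)[symmetric]])
      also have "\<dots> = (p n \<cdot> f) \<cdot> E (int n + 1) W"
        by (rule E_natural[OF W Z cmp_hom[OF f hh(2)]])
      also have "\<dots> = p n \<cdot> (f \<cdot> E (int n + 1) W)"
        by (simp add: H cat_simps)
      finally show "p n \<cdot> (y \<cdot> Fm f) = p n \<cdot> (f \<cdot> E (int n + 1) W)" .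
    qed
    then have "?P (Suc n) y"
      using y(1) by (simp add: add.commute)
    with y(2) show "\<exists>y. ?P (Suc n) y \<and> y \<cdot> Fm (\<phi> n) = \<phi> n \<cdot> x"
      by blast
  qed
  then obtain \<theta> where "\<And>n. ?P n (\<theta> n)" "\<And>n. \<theta> (Suc n) \<cdot> Fm (\<phi> n) = \<phi> n \<cdot> \<theta> n"
    by blast
  then show thesis
    by (intro that[of \<theta>]) auto
qed

text \<open>\<open>Z n\<close> enters \<open>Y (Suc n)\<close> desuspended, hence in degree
  \<open>- n - 1\<close>; thus \<open>Y n\<close> is built from \<open>D 0\<close>, ...,
  \<open>D (- n)\<close>. The induction step is carried out after one suspension, where
  \<open>Sus (Y (Suc n))\<close> sits between \<open>Z n\<close> and
  \<open>Sus (Y n)\<close>.\<close>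

lemma right_tower_orth_to:
  assumes Y0: "Y 0 \<in> D 0" and t: "\<And>n. exact_triangle T (Y (Suc n)) (Y n) (Z n) (\<psi> n) (q n) (h n)"
    and Z: "\<And>n. Z n \<in> D (- int n)" and W: "W \<in> D j" and "j < - int n"
  shows "orth (Y n) W"
  using assms(5)
proof (induction n)
  case 0
  then show ?case using D_orth[OF Y0 W] by simp
next
  case (Suc n)
  note hh = exact_hom[OF t[of n]]
  note H = HomD[OF hh(1)] D_Ob[OF W]
  have "orth (Sus (Y (Suc n))) (Sus W)"
  proof (rule orth_exact_left[OF rotate[OF rotate[OF t[of n]]]])
    show "orth (Z n) (Sus W)"
      using Suc.prems by (intro D_orth[OF Z D_Sus[OF W]]) simp
    show "orth (Sus (Y n)) (Sus W)"
      using Suc H by (simp add: orth_Sus_iff)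
  qed (simp add: H sus_simps)
  then show ?case
    using H by (simp add: orth_Sus_iff)
qed

text \<open>All pieces of all stages lie in degrees at most 0. The bound on \<open>j\<close> is thus
  uniform in \<open>n\<close>, as the passage to the homotopy limit requires.\<close>

lemma right_tower_orth_from:
  assumes Y0: "Y 0 \<in> D 0" and t: "\<And>n. exact_triangle T (Y (Suc n)) (Y n) (Z n) (\<psi> n) (q n) (h n)"
    and Z: "\<And>n. Z n \<in> D (- int n)" and W: "W \<in> D j" and "j > 0"
  shows "orth W (Y n)"
proof (induction n)
  case 0
  then show ?case using D_orth[OF W Y0] assms(5) by simp
next
  case (Suc n)
  then show ?case
    using assms(5) by (intro orth_exact_fiber[OF t] D_orth[OF D_Sus[OF W] Z] D_Ob[OF W]) auto
qed

text \<open>Here the isomorphism on \<open>Y n\<close> is compatible with all morphisms to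
  \<open>D (- n)\<close>, in particular with \<open>q n\<close>, so it extends to the fiber
  \<open>Y (Suc n)\<close>. The condition propagates because no nonzero morphism goes from
  \<open>Y n\<close> to \<open>D (- n - 1)\<close>.\<close>

lemma right_tower_iso:
  assumes Y0: "Y 0 \<in> D 0" and t: "\<And>n. exact_triangle T (Y (Suc n)) (Y n) (Z n) (\<psi> n) (q n) (h n)"
    and Z: "\<And>n. Z n \<in> D (- int n)"
  obtains \<theta> where "\<theta> 0 = E 0 (Y 0)" "\<And>n. is_iso T (Fo (Y n)) (Y n) (\<theta> n)"
    "\<And>n. \<theta> n \<cdot> Fm (\<psi> n) = \<psi> n \<cdot> \<theta> (Suc n)"
proof -
  let ?P = "\<lambda>n x. is_iso T (Fo (Y n)) (Y n) x \<and> (n = 0 \<longrightarrow> x = E 0 (Y 0)) \<and>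
    (\<forall>W f. W \<in> D (- int n) \<longrightarrow> f \<in> Hom T (Y n) W \<longrightarrow> E (- int n) W \<cdot> Fm f = f \<cdot> x)"
  have "\<exists>\<theta>. \<forall>n. ?P n (\<theta> n) \<and> \<theta> n \<cdot> Fm (\<psi> n) = \<psi> n \<cdot> \<theta> (Suc n)"
  proof (rule dependent_nat_choice)
    show "\<exists>x. ?P 0 x"
      using E_iso[OF Y0] E_natural[OF Y0] by auto
    fix x n
    assume P: "?P n x"
    then have x: "is_iso T (Fo (Y n)) (Y n) x"
      and nat: "\<And>W f. W \<in> D (- int n) \<Longrightarrow> f \<in> Hom T (Y n) W \<Longrightarrow> E (- int n) W \<cdot> Fm f = f \<cdot> x"
      by auto
    note hh = exact_hom[OF t[of n]]
    note H = HomD[OF hh(1)] HomD[OF hh(2)] HomD[OF hh(3)]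
    note EZ = E_iso[OF Z[of n]] and \<omega>h = is_iso_hom[OF \<omega>_is_iso[OF H(4)]]
    obtain y where y: "is_iso T (Fo (Y (Suc n))) (Y (Suc n)) y" "x \<cdot> Fm (\<psi> n) = \<psi> n \<cdot> y"
        "sus y \<cdot> (\<omega> (Y (Suc n)) \<cdot> Fm (h n)) = h n \<cdot> E (- int n) (Z n)"
      using TR3_iso_fiber[OF F_exact[OF t[of n]] t[of n] x EZ nat[OF Z hh(2)]] by blast
    note yh = is_iso_hom[OF y(1)]
    have sq: "susp (Y (Suc n)) y \<cdot> Fm (h n) = h n \<cdot> E (- int n) (Z n)"
      unfolding susp_def using y(3) cmp_assoc[OF F_hom[OF hh(3)] \<omega>h sus_hom[OF yh]] by simp
    have "E (- int (Suc n)) W \<cdot> Fm f = f \<cdot> y"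
      if W: "W \<in> D (- int (Suc n))" and f: "f \<in> Hom T (Y (Suc n)) W" for W f
    proof -
      have W': "Sus W \<in> D (- int n)" "E (- int n) (Sus W) = susp W (E (- int (Suc n)) W)"
        using D_Sus[OF W] E_Sus[OF W] by auto
      note EW = is_iso_hom[OF E_iso[OF W]] and ES = is_iso_hom[OF E_iso[OF W'(1)]]
        and sy = susp_hom[OF H(4) yh] and sf = sus_hom[OF f] and EZh = is_iso_hom[OF EZ]
      note H = H HomD[OF sf] HomD[OF ES] HomD[OF sy] HomD[OF EZh]
      \<comment> \<open>Checked after suspending, where
        \<open>h n : Z n \<rightarrow> Sus (Y (Suc n))\<close> is available and has cone
        \<open>Sus (Y n)\<close>. After composition with \<open>h n\<close>, only naturality in
        degree \<open>- n\<close> is left.\<close>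
      have "E (- int n) (Sus W) \<cdot> Fm (sus f) = sus f \<cdot> susp (Y (Suc n)) y"
      proof (rule exact_cancel_right[OF F_exact[OF rotate[OF rotate[OF t[of n]]]]])
        have "orth (Y n) W"
          by (rule right_tower_orth_to[OF Y0 t Z W]) simp
        then have "orth (Sus (Y n)) (Sus W)"
          using H(5) D_Ob[OF W] by (simp add: orth_Sus_iff)
        moreover have "isomorphic T (Sus (Y n)) (Fo (Sus (Y n)))"
          using susp_is_iso[OF H(5) x] isomorphic_sym by (auto simp: isomorphic_def)
        ultimately show "orth (Fo (Sus (Y n))) (Sus W)"
          using orth_iso isomorphic_refl[OF D_Ob[OF W'(1)]] by blast
        show "E (- int n) (Sus W) \<cdot> Fm (sus f) \<in> Hom T (Fo (Sus (Y (Suc n)))) (Sus W)"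
          "sus f \<cdot> susp (Y (Suc n)) y \<in> Hom T (Fo (Sus (Y (Suc n)))) (Sus W)"
          by (rule cmp_hom[OF F_hom[OF sf] ES], rule cmp_hom[OF sy sf])
        have "(E (- int n) (Sus W) \<cdot> Fm (sus f)) \<cdot> Fm (h n) = E (- int n) (Sus W) \<cdot> Fm (sus f \<cdot> h n)"
          by (simp add: H cat_simps F_simps)
        also have "\<dots> = (sus f \<cdot> h n) \<cdot> E (- int n) (Z n)"
          by (rule E_natural[OF Z W'(1) cmp_hom[OF hh(3) sf]])
        also have "\<dots> = (sus f \<cdot> susp (Y (Suc n)) y) \<cdot> Fm (h n)"
          by (simp add: H cat_simps F_simps sq)
        finally show "(E (- int n) (Sus W) \<cdot> Fm (sus f)) \<cdot> Fm (h n) = (sus f \<cdot> susp (Y (Suc n)) y) \<cdot> Fm (h n)" .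
      qed
      then show ?thesis
        unfolding W'(2) using susp_square_iff[OF yh EW f] by simp
    qed
    then have "?P (Suc n) y"
      using y(1) by simp
    with y(2) show "\<exists>y. ?P (Suc n) y \<and> x \<cdot> Fm (\<psi> n) = \<psi> n \<cdot> y"
      by blast
  qed
  then obtain \<theta> where "\<And>n. ?P n (\<theta> n)" "\<And>n. \<theta> n \<cdot> Fm (\<psi> n) = \<psi> n \<cdot> \<theta> (Suc n)"
    by blast
  then show thesis
    by (intro that[of \<theta>]) auto
qed

end

section \<open>Homotopy colimits and limits\<close>

context category
begin

lemma coproduct_ex:
  assumes "is_coproduct T I X P inn" "Q \<in> Ob T" "\<And>i. i \<in> I \<Longrightarrow> q i \<in> Hom T (X i) Q"
  obtains u where "u \<in> Hom T P Q" "\<And>i. i \<in> I \<Longrightarrow> u \<cdot> inn i = q i"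
proof -
  have "(\<forall>i\<in>I. q i \<in> Hom T (X i) Q) \<longrightarrow> (\<exists>!u. u \<in> Hom T P Q \<and> (\<forall>i\<in>I. u \<cdot> inn i = q i))"
    using assms(1,2) unfolding is_coproduct_def by blast
  then have "\<exists>!u. u \<in> Hom T P Q \<and> (\<forall>i\<in>I. u \<cdot> inn i = q i)"
    using assms(3) by blast
  then obtain u where "u \<in> Hom T P Q \<and> (\<forall>i\<in>I. u \<cdot> inn i = q i)"
    by (rule ex1E)
  then show thesis
    by (intro that[of u]) blast+
qed

lemma product_ex:
  assumes "is_product T I X P pr" "Q \<in> Ob T" "\<And>i. i \<in> I \<Longrightarrow> q i \<in> Hom T Q (X i)"
  obtains u where "u \<in> Hom T Q P" "\<And>i. i \<in> I \<Longrightarrow> pr i \<cdot> u = q i"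
proof -
  have "(\<forall>i\<in>I. q i \<in> Hom T Q (X i)) \<longrightarrow> (\<exists>!u. u \<in> Hom T Q P \<and> (\<forall>i\<in>I. pr i \<cdot> u = q i))"
    using assms(1,2) unfolding is_product_def by blast
  then have "\<exists>!u. u \<in> Hom T Q P \<and> (\<forall>i\<in>I. pr i \<cdot> u = q i)"
    using assms(3) by blast
  then obtain u where "u \<in> Hom T Q P \<and> (\<forall>i\<in>I. pr i \<cdot> u = q i)"
    by (rule ex1E)
  then show thesis
    by (intro that[of u]) blast+
qed

lemma coproduct_hom: "is_coproduct T I X P inn \<Longrightarrow> i \<in> I \<Longrightarrow> inn i \<in> Hom T (X i) P"
  and coproduct_Ob: "is_coproduct T I X P inn \<Longrightarrow> P \<in> Ob T"
  by (simp_all add: is_coproduct_def)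

lemma product_hom: "is_product T I X P pr \<Longrightarrow> i \<in> I \<Longrightarrow> pr i \<in> Hom T P (X i)"
  and product_Ob: "is_product T I X P pr \<Longrightarrow> P \<in> Ob T"
  by (simp_all add: is_product_def)

lemma coproduct_reindex_iff:
  assumes e: "inj_on e I"
  shows "is_coproduct T (e ` I) X P inn \<longleftrightarrow> is_coproduct T I (X \<circ> e) P (inn \<circ> e)"
proof -
  have "(\<forall>q. (\<forall>i\<in>e ` I. q i \<in> Hom T (X i) Q) \<longrightarrow> (\<exists>!u. u \<in> Hom T P Q \<and> (\<forall>i\<in>e ` I. u \<cdot> inn i = q i))) \<longleftrightarrow>
      (\<forall>q. (\<forall>i\<in>I. q i \<in> Hom T (X (e i)) Q) \<longrightarrow> (\<exists>!u. u \<in> Hom T P Q \<and> (\<forall>i\<in>I. u \<cdot> inn (e i) = q i)))"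
    (is "?L \<longleftrightarrow> ?R") for Q
  proof
    assume L: ?L
    show ?R
    proof (intro allI impI)
      fix q assume "\<forall>i\<in>I. q i \<in> Hom T (X (e i)) Q"
      then show "\<exists>!u. u \<in> Hom T P Q \<and> (\<forall>i\<in>I. u \<cdot> inn (e i) = q i)"
        using spec[OF L, of "\<lambda>j. q (inv_into I e j)"] by (simp add: inv_into_f_f[OF e])
    qed
  next
    assume R: ?R
    show ?L
    proof (intro allI impI)
      fix q assume "\<forall>i\<in>e ` I. q i \<in> Hom T (X i) Q"
      then show "\<exists>!u. u \<in> Hom T P Q \<and> (\<forall>i\<in>e ` I. u \<cdot> inn i = q i)"
        using spec[OF R, of "\<lambda>i. q (e i)"] by simp
    qed
  qed
  then show ?thesis by (simp add: is_coproduct_def)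
qed

lemma product_reindex_iff:
  assumes e: "inj_on e I"
  shows "is_product T (e ` I) X P pr \<longleftrightarrow> is_product T I (X \<circ> e) P (pr \<circ> e)"
proof -
  have "(\<forall>q. (\<forall>i\<in>e ` I. q i \<in> Hom T Q (X i)) \<longrightarrow> (\<exists>!u. u \<in> Hom T Q P \<and> (\<forall>i\<in>e ` I. pr i \<cdot> u = q i))) \<longleftrightarrow>
      (\<forall>q. (\<forall>i\<in>I. q i \<in> Hom T Q (X (e i))) \<longrightarrow> (\<exists>!u. u \<in> Hom T Q P \<and> (\<forall>i\<in>I. pr (e i) \<cdot> u = q i)))"
    (is "?L \<longleftrightarrow> ?R") for Q
  proof
    assume L: ?L
    show ?R
    proof (intro allI impI)
      fix q assume "\<forall>i\<in>I. q i \<in> Hom T Q (X (e i))"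
      then show "\<exists>!u. u \<in> Hom T Q P \<and> (\<forall>i\<in>I. pr (e i) \<cdot> u = q i)"
        using spec[OF L, of "\<lambda>j. q (inv_into I e j)"] by (simp add: inv_into_f_f[OF e])
    qed
  next
    assume R: ?R
    show ?L
    proof (intro allI impI)
      fix q assume "\<forall>i\<in>e ` I. q i \<in> Hom T Q (X i)"
      then show "\<exists>!u. u \<in> Hom T Q P \<and> (\<forall>i\<in>e ` I. pr i \<cdot> u = q i)"
        using spec[OF R, of "\<lambda>i. q (e i)"] by simp
    qed
  qed
  then show ?thesis by (simp add: is_product_def)
qed

text \<open>An infinite index type contains a copy of the natural numbers. A sequence becomes a
  family on \<open>range e\<close>, to which preservation applies, and is then read back along
  \<open>e\<close>.\<close>

lemma bi_continuous_sequences: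
  assumes "infinite (UNIV :: 'i set)" and cont: "bi_continuous TYPE('i) T Fo Fm"
  shows "is_coproduct T (UNIV :: nat set) X P inn \<Longrightarrow> is_coproduct T UNIV (Fo \<circ> X) (Fo P) (Fm \<circ> inn)"
    and "is_product T (UNIV :: nat set) X P pr \<Longrightarrow> is_product T UNIV (Fo \<circ> X) (Fo P) (Fm \<circ> pr)"
proof -
  obtain e :: "nat \<Rightarrow> 'i" where e: "inj e"
    using assms(1) infinite_countable_subset by blast
  let ?d = "the_inv e"
  have d: "?d \<circ> e = id"
    by (simp add: fun_eq_iff the_inv_f_f[OF e])
  show "is_coproduct T (UNIV :: nat set) X P inn \<Longrightarrow> is_coproduct T UNIV (Fo \<circ> X) (Fo P) (Fm \<circ> inn)"
  proof -
    assume "is_coproduct T (UNIV :: nat set) X P inn"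
    then have "is_coproduct T (range e) (X \<circ> ?d) P (inn \<circ> ?d)"
      unfolding coproduct_reindex_iff[OF e] comp_assoc d comp_id .
    then have "is_coproduct T (range e) (Fo \<circ> X \<circ> ?d) (Fo P) (Fm \<circ> inn \<circ> ?d)"
      using cont unfolding bi_continuous_def o_assoc[symmetric] by blast
    then show ?thesis
      unfolding coproduct_reindex_iff[OF e] comp_assoc d comp_id .
  qed
  show "is_product T (UNIV :: nat set) X P pr \<Longrightarrow> is_product T UNIV (Fo \<circ> X) (Fo P) (Fm \<circ> pr)"
  proof -
    assume "is_product T (UNIV :: nat set) X P pr"
    then have "is_product T (range e) (X \<circ> ?d) P (pr \<circ> ?d)"
      unfolding product_reindex_iff[OF e] comp_assoc d comp_id .
    then have "is_product T (range e) (Fo \<circ> X \<circ> ?d) (Fo P) (Fm \<circ> pr \<circ> ?d)"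
      using cont unfolding bi_continuous_def o_assoc[symmetric] by blast
    then show ?thesis
      unfolding product_reindex_iff[OF e] comp_assoc d comp_id .
  qed
qed

end

context additive_category
begin

lemma orth_product:
  assumes P: "is_product T I X P pr" and "\<And>i. i \<in> I \<Longrightarrow> orth Q (X i)" "Q \<in> Ob T"
  shows "orth Q P"
  unfolding orth_def
proof safe
  fix f assume f: "f \<in> Hom T Q P"
  show "f = hzero T Q P"
  proof (rule hom_product_eqI[OF P f hzero_hom])
    show "pr i \<cdot> f = pr i \<cdot> hzero T Q P" if "i \<in> I" for i
      using orthD[OF assms(2)[OF that] cmp_hom[OF f product_hom[OF P that]]]
        cmp_hzero[OF product_hom[OF P that] assms(3)] by simp
  qed (use HomD[OF f] in auto)
qed

lemma coproduct_iso:
  assumes P: "is_coproduct T I X P inn" and Q: "is_coproduct T I Y Q jnn"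
    and \<theta>: "\<And>i. i \<in> I \<Longrightarrow> is_iso T (X i) (Y i) (\<theta> i)"
  obtains u where "is_iso T P Q u" "\<And>i. i \<in> I \<Longrightarrow> u \<cdot> inn i = jnn i \<cdot> \<theta> i"
proof -
  have "\<exists>r. is_iso T (Y i) (X i) r \<and> r \<cdot> \<theta> i = ident T (X i) \<and> \<theta> i \<cdot> r = ident T (Y i)" if "i \<in> I" for i
    using is_iso_inverse[OF \<theta>[OF that]] .
  then obtain r where r: "\<And>i. i \<in> I \<Longrightarrow> is_iso T (Y i) (X i) (r i)"
    "\<And>i. i \<in> I \<Longrightarrow> r i \<cdot> \<theta> i = ident T (X i)" "\<And>i. i \<in> I \<Longrightarrow> \<theta> i \<cdot> r i = ident T (Y i)"
    by metis
  note ih = coproduct_hom[OF P] and jh = coproduct_hom[OF Q]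
    and \<theta>h = is_iso_hom[OF \<theta>] and rh = is_iso_hom[OF r(1)]
  obtain u where u: "u \<in> Hom T P Q" "\<And>i. i \<in> I \<Longrightarrow> u \<cdot> inn i = jnn i \<cdot> \<theta> i"
    using coproduct_ex[OF P coproduct_Ob[OF Q], of "\<lambda>i. jnn i \<cdot> \<theta> i"] cmp_hom[OF \<theta>h jh] by blast
  obtain v where v: "v \<in> Hom T Q P" "\<And>i. i \<in> I \<Longrightarrow> v \<cdot> jnn i = inn i \<cdot> r i"
    using coproduct_ex[OF Q coproduct_Ob[OF P], of "\<lambda>i. inn i \<cdot> r i"] cmp_hom[OF rh ih] by blast
  note H = HomD[OF u(1)] HomD[OF v(1)]
  have "v \<cdot> u = ident T P"
  proof (rule hom_coproduct_eqI[OF P cmp_hom[OF u(1) v(1)] ident_hom[OF H(4)]])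
    fix i assume i: "i \<in> I"
    note Hi = H HomD[OF ih[OF i]] HomD[OF jh[OF i]] HomD[OF \<theta>h[OF i]] HomD[OF rh[OF i]]
    show "(v \<cdot> u) \<cdot> inn i = ident T P \<cdot> inn i"
      by (simp add: Hi cat_simps u(2)[OF i] eq_assoc[OF v(2)[OF i]] r(2)[OF i])
  qed
  moreover have "u \<cdot> v = ident T Q"
  proof (rule hom_coproduct_eqI[OF Q cmp_hom[OF v(1) u(1)] ident_hom[OF H(5)]])
    fix i assume i: "i \<in> I"
    note Hi = H HomD[OF ih[OF i]] HomD[OF jh[OF i]] HomD[OF \<theta>h[OF i]] HomD[OF rh[OF i]]
    show "(u \<cdot> v) \<cdot> jnn i = ident T Q \<cdot> jnn i"
      by (simp add: Hi cat_simps v(2)[OF i] eq_assoc[OF u(2)[OF i]] r(3)[OF i])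
  qed
  ultimately show thesis
    using that[OF is_isoI[OF u(1) v(1)]] u(2) by blast
qed

lemma product_iso:
  assumes P: "is_product T I X P pr" and Q: "is_product T I Y Q qr"
    and \<theta>: "\<And>i. i \<in> I \<Longrightarrow> is_iso T (X i) (Y i) (\<theta> i)"
  obtains u where "is_iso T P Q u" "\<And>i. i \<in> I \<Longrightarrow> qr i \<cdot> u = \<theta> i \<cdot> pr i"
proof -
  have "\<exists>r. is_iso T (Y i) (X i) r \<and> r \<cdot> \<theta> i = ident T (X i) \<and> \<theta> i \<cdot> r = ident T (Y i)" if "i \<in> I" for i
    using is_iso_inverse[OF \<theta>[OF that]] .
  then obtain r where r: "\<And>i. i \<in> I \<Longrightarrow> is_iso T (Y i) (X i) (r i)"
    "\<And>i. i \<in> I \<Longrightarrow> r i \<cdot> \<theta> i = ident T (X i)" "\<And>i. i \<in> I \<Longrightarrow> \<theta> i \<cdot> r i = ident T (Y i)"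
    by metis
  note ih = product_hom[OF P] and jh = product_hom[OF Q]
    and \<theta>h = is_iso_hom[OF \<theta>] and rh = is_iso_hom[OF r(1)]
  obtain u where u: "u \<in> Hom T P Q" "\<And>i. i \<in> I \<Longrightarrow> qr i \<cdot> u = \<theta> i \<cdot> pr i"
    using product_ex[OF Q product_Ob[OF P], of "\<lambda>i. \<theta> i \<cdot> pr i"] cmp_hom[OF ih \<theta>h] by blast
  obtain v where v: "v \<in> Hom T Q P" "\<And>i. i \<in> I \<Longrightarrow> pr i \<cdot> v = r i \<cdot> qr i"
    using product_ex[OF P product_Ob[OF Q], of "\<lambda>i. r i \<cdot> qr i"] cmp_hom[OF jh rh] by blast
  note H = HomD[OF u(1)] HomD[OF v(1)]
  have "v \<cdot> u = ident T P"
  proof (rule hom_product_eqI[OF P cmp_hom[OF u(1) v(1)] ident_hom[OF H(4)]])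
    fix i assume i: "i \<in> I"
    note Hi = H HomD[OF ih[OF i]] HomD[OF jh[OF i]] HomD[OF \<theta>h[OF i]] HomD[OF rh[OF i]]
    show "pr i \<cdot> (v \<cdot> u) = pr i \<cdot> ident T P"
      by (simp add: Hi cat_simps u(2)[OF i] eq_assoc[OF v(2)[OF i]] eq_assoc[OF r(2)[OF i]])
  qed
  moreover have "u \<cdot> v = ident T Q"
  proof (rule hom_product_eqI[OF Q cmp_hom[OF v(1) u(1)] ident_hom[OF H(5)]])
    fix i assume i: "i \<in> I"
    note Hi = H HomD[OF ih[OF i]] HomD[OF jh[OF i]] HomD[OF \<theta>h[OF i]] HomD[OF rh[OF i]]
    show "qr i \<cdot> (u \<cdot> v) = qr i \<cdot> ident T Q"
      by (simp add: Hi cat_simps v(2)[OF i] eq_assoc[OF u(2)[OF i]] eq_assoc[OF r(3)[OF i]])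
  qed
  ultimately show thesis
    using that[OF is_isoI[OF u(1) v(1)]] u(2) by blast
qed

end

section \<open>Structure morphisms of homotopy colimits and limits, and vanishing of Hom on
  them\<close>

context triangulated_category
begin

lemma hocolim_hom:
  assumes "is_hocolim T X \<phi> H \<gamma>"
  shows "\<gamma> n \<in> Hom T (X n) H"
proof -
  obtain P inn d c h where P: "is_coproduct T UNIV X P inn" and t: "exact_triangle T P P H d c h"
    and \<gamma>: "\<gamma> n = c \<cdot> inn n"
    using assms unfolding is_hocolim_def by blast
  show ?thesis
    unfolding \<gamma> by (rule cmp_hom[OF coproduct_hom[OF P UNIV_I] exact_hom(2)[OF t]])
qed

lemma holim_hom:
  assumes "is_holim T Y \<psi> H \<sigma>"
  shows "\<sigma> n \<in> Hom T H (Y n)"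
proof -
  obtain P pr s d h where P: "is_product T UNIV Y P pr" and t: "exact_triangle T H P P s d h"
    and \<sigma>: "\<sigma> n = pr n \<cdot> s"
    using assms unfolding is_holim_def by blast
  show ?thesis
    unfolding \<sigma> by (rule cmp_hom[OF exact_hom(1)[OF t] product_hom[OF P UNIV_I]])
qed

text \<open>\<open>H\<close> is an extension of \<open>Sus P\<close> by the coproduct
  \<open>P\<close>. The part coming from \<open>Sus P\<close> is why vanishing against
  \<open>Des W\<close> is asked as well.\<close>

lemma orth_hocolim:
  assumes "is_hocolim T X \<phi> H \<gamma>" and X: "\<And>n. orth (X n) W" "\<And>n. orth (X n) (Des W)" and W: "W \<in> Ob T"
  shows "orth H W"
proof -
  obtain P inn d c h where P: "is_coproduct T UNIV X P inn" and t: "exact_triangle T P P H d c h"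
    using assms(1) unfolding is_hocolim_def by blast
  show ?thesis
  proof (rule orth_exact_left[OF rotate[OF t]])
    show "orth P W"
      by (rule orth_coproduct[OF P X(1) W])
    have "orth P (Des W)"
      by (rule orth_coproduct[OF P X(2)]) (simp add: W sus_simps)
    then show "orth (Sus P) W"
      by (simp add: orth_Sus_left_iff coproduct_Ob[OF P] W)
  qed (rule W)
qed

text \<open>\<open>H\<close> is the fiber of an endomorphism of the product, so morphisms from
  \<open>Sus W\<close> to the stages enter too.\<close>

lemma orth_holim:
  assumes "is_holim T Y \<psi> H \<sigma>" and Y: "\<And>n. orth W (Y n)" "\<And>n. orth (Sus W) (Y n)" and W: "W \<in> Ob T"
  shows "orth W H"
proof -
  obtain P pr s d h where P: "is_product T UNIV Y P pr" and t: "exact_triangle T H P P s d h"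
    using assms(1) unfolding is_holim_def by blast
  show ?thesis
    using W by (intro orth_exact_fiber[OF t] orth_product[OF P] Y) (auto simp: sus_simps)
qed

end

section \<open>Extending stagewise isomorphisms to homotopy colimits and limits\<close>

context triangle_functor
begin

lemma hocolim_iso:
  assumes "is_hocolim T X \<phi> H \<gamma>"
    and pres: "\<And>P inn. is_coproduct T UNIV X P inn \<Longrightarrow> is_coproduct T UNIV (Fo \<circ> X) (Fo P) (Fm \<circ> inn)"
    and \<phi>: "\<And>n. \<phi> n \<in> Hom T (X n) (X (Suc n))"
    and \<theta>: "\<And>n. is_iso T (Fo (X n)) (X n) (\<theta> n)" "\<And>n. \<theta> (Suc n) \<cdot> Fm (\<phi> n) = \<phi> n \<cdot> \<theta> n"
  shows "\<exists>x. is_iso T (Fo H) H x \<and> (\<forall>n. x \<cdot> Fm (\<gamma> n) = \<gamma> n \<cdot> \<theta> n)"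
proof -
  obtain P inn d c h where P: "is_coproduct T UNIV X P inn"
    and d: "\<And>n. d \<cdot> inn n = inn n \<boxplus> \<boxminus> (inn (Suc n) \<cdot> \<phi> n)"
    and t: "exact_triangle T P P H d c h" and \<gamma>: "\<And>n. \<gamma> n = c \<cdot> inn n"
    using assms(1) unfolding is_hocolim_def by blast
  note FP = pres[OF P] and th = exact_hom[OF t]
  have i: "inn n \<in> Hom T (X n) P" for n
    using coproduct_hom[OF P] by blast
  note \<theta>h = is_iso_hom[OF \<theta>(1)]
  obtain u where u: "is_iso T (Fo P) P u" "\<And>n. u \<cdot> Fm (inn n) = inn n \<cdot> \<theta> n"
    using coproduct_iso[OF FP P, of \<theta>] \<theta>(1) by auto
  note uh = is_iso_hom[OF u(1)]
  \<comment> \<open>Tested on each summand: the identity part of \<open>1 - \<phi>\<close> is the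
    defining equation of \<open>u\<close>, and the shifted part is the compatibility of
    \<open>\<theta>\<close> with \<open>\<phi>\<close>.\<close>
  have "u \<cdot> Fm d = d \<cdot> u"
  proof (rule hom_coproduct_eqI[OF FP cmp_hom[OF F_hom[OF th(1)] uh] cmp_hom[OF uh th(1)]])
    fix n
    note H = HomD[OF th(1)] HomD[OF uh] HomD[OF i[of n]] HomD[OF i[of "Suc n"]] HomD[OF \<phi>[of n]]
      HomD[OF \<theta>h[of n]] HomD[OF \<theta>h[of "Suc n"]]
    have ip: "inn (Suc n) \<cdot> \<phi> n \<in> Hom T (X n) P"
      by (rule cmp_hom[OF \<phi> i])
    have eq: "u \<cdot> Fm (inn (Suc n) \<cdot> \<phi> n) = (inn (Suc n) \<cdot> \<phi> n) \<cdot> \<theta> n"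
      by (simp add: H cat_simps F_simps eq_assoc[OF u(2)] \<theta>(2))
    have Fadd: "Fm (inn n \<boxplus> \<boxminus> (inn (Suc n) \<cdot> \<phi> n)) = Fm (inn n) \<boxplus> \<boxminus> (Fm (inn (Suc n) \<cdot> \<phi> n))"
      using F_additive i[of n] hneg_hom[OF ip] additive_endofunctor_hneg[OF F_additive ip]
      unfolding additive_endofunctor_def by metis
    have "(u \<cdot> Fm d) \<cdot> (Fm \<circ> inn) n = u \<cdot> Fm (d \<cdot> inn n)"
      by (simp add: H cat_simps F_simps)
    also have "\<dots> = u \<cdot> Fm (inn n) \<boxplus> \<boxminus> (u \<cdot> Fm (inn (Suc n) \<cdot> \<phi> n))"
      unfolding d Fadd cmp_add_right[OF F_hom[OF i] hneg_hom[OF F_hom[OF ip]] uh]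
      by (simp only: cmp_hneg[OF F_hom[OF ip] uh])
    also have "\<dots> = (d \<cdot> inn n) \<cdot> \<theta> n"
      unfolding d u(2) eq cmp_add_left[OF \<theta>h i hneg_hom[OF ip]]
      by (simp only: hneg_cmp[OF \<theta>h ip])
    also have "\<dots> = (d \<cdot> u) \<cdot> (Fm \<circ> inn) n"
      by (simp add: H cat_simps F_simps u(2))
    finally show "(u \<cdot> Fm d) \<cdot> (Fm \<circ> inn) n = (d \<cdot> u) \<cdot> (Fm \<circ> inn) n" .
  qed
  then obtain x where x: "is_iso T (Fo H) H x" "x \<cdot> Fm c = c \<cdot> u"
    using TR3_iso[OF F_exact[OF t] t u(1) u(1)] by blast
  have "x \<cdot> Fm (\<gamma> n) = \<gamma> n \<cdot> \<theta> n" for n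
  proof -
    note H = HomD[OF th(2)] HomD[OF uh] HomD[OF i[of n]] HomD[OF \<theta>h[of n]] HomD[OF is_iso_hom[OF x(1)]]
    show ?thesis
      unfolding \<gamma> by (simp add: H cat_simps F_simps eq_assoc[OF x(2)] u(2))
  qed
  with x(1) show ?thesis by blast
qed

text \<open>The homotopy limit is the first vertex of its defining triangle, so the isomorphism
  comes from the fiber form of TR3. It is not canonical; compatibility with every
  \<open>\<sigma> n\<close> is what is retained.\<close>

lemma holim_iso:
  assumes "is_holim T Y \<psi> H \<sigma>"
    and pres: "\<And>P pr. is_product T UNIV Y P pr \<Longrightarrow> is_product T UNIV (Fo \<circ> Y) (Fo P) (Fm \<circ> pr)"
    and \<psi>: "\<And>n. \<psi> n \<in> Hom T (Y (Suc n)) (Y n)"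
    and \<theta>: "\<And>n. is_iso T (Fo (Y n)) (Y n) (\<theta> n)" "\<And>n. \<theta> n \<cdot> Fm (\<psi> n) = \<psi> n \<cdot> \<theta> (Suc n)"
  shows "\<exists>y. is_iso T (Fo H) H y \<and> (\<forall>n. \<theta> n \<cdot> Fm (\<sigma> n) = \<sigma> n \<cdot> y)"
proof -
  obtain P pr s d h where P: "is_product T UNIV Y P pr"
    and d: "\<And>n. pr n \<cdot> d = pr n \<boxplus> \<boxminus> (\<psi> n \<cdot> pr (Suc n))"
    and t: "exact_triangle T H P P s d h" and \<sigma>: "\<And>n. \<sigma> n = pr n \<cdot> s"
    using assms(1) unfolding is_holim_def by blast
  note FP = pres[OF P] and th = exact_hom[OF t]
  have i: "pr n \<in> Hom T P (Y n)" for n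
    using product_hom[OF P] by blast
  note \<theta>h = is_iso_hom[OF \<theta>(1)]
  obtain u where u: "is_iso T (Fo P) P u" "\<And>n. pr n \<cdot> u = \<theta> n \<cdot> Fm (pr n)"
    using product_iso[OF FP P, of \<theta>] \<theta>(1) by auto
  note uh = is_iso_hom[OF u(1)]
  have "u \<cdot> Fm d = d \<cdot> u"
  proof (rule hom_product_eqI[OF P cmp_hom[OF F_hom[OF th(2)] uh] cmp_hom[OF uh th(2)]])
    fix n
    note H = HomD[OF th(2)] HomD[OF uh] HomD[OF i[of n]] HomD[OF i[of "Suc n"]] HomD[OF \<psi>[of n]]
      HomD[OF \<theta>h[of n]] HomD[OF \<theta>h[of "Suc n"]]
    have ip: "\<psi> n \<cdot> pr (Suc n) \<in> Hom T P (Y n)"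
      by (rule cmp_hom[OF i \<psi>])
    have eq: "\<theta> n \<cdot> Fm (\<psi> n \<cdot> pr (Suc n)) = (\<psi> n \<cdot> pr (Suc n)) \<cdot> u"
      by (simp add: H cat_simps F_simps eq_assoc[OF \<theta>(2)] u(2))
    have Fadd: "Fm (pr n \<boxplus> \<boxminus> (\<psi> n \<cdot> pr (Suc n))) = Fm (pr n) \<boxplus> \<boxminus> (Fm (\<psi> n \<cdot> pr (Suc n)))"
      using F_additive i[of n] hneg_hom[OF ip] additive_endofunctor_hneg[OF F_additive ip]
      unfolding additive_endofunctor_def by metis
    have "pr n \<cdot> (u \<cdot> Fm d) = \<theta> n \<cdot> Fm (pr n \<cdot> d)"
      by (simp add: H cat_simps F_simps eq_assoc[OF u(2)])
    also have "\<dots> = \<theta> n \<cdot> Fm (pr n) \<boxplus> \<boxminus> (\<theta> n \<cdot> Fm (\<psi> n \<cdot> pr (Suc n)))"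
      unfolding d Fadd cmp_add_right[OF F_hom[OF i] hneg_hom[OF F_hom[OF ip]] \<theta>h]
      by (simp only: cmp_hneg[OF F_hom[OF ip] \<theta>h])
    also have "\<dots> = (pr n \<cdot> d) \<cdot> u"
      unfolding d u(2)[symmetric] eq cmp_add_left[OF uh i hneg_hom[OF ip]]
      by (simp only: hneg_cmp[OF uh ip])
    also have "\<dots> = pr n \<cdot> (d \<cdot> u)"
      by (simp add: H cat_simps)
    finally show "pr n \<cdot> (u \<cdot> Fm d) = pr n \<cdot> (d \<cdot> u)" .
  qed
  then obtain y where y: "is_iso T (Fo H) H y" "u \<cdot> Fm s = s \<cdot> y"
    using TR3_iso_fiber[OF F_exact[OF t] t u(1) u(1)] by blast
  have "\<theta> n \<cdot> Fm (\<sigma> n) = \<sigma> n \<cdot> y" for n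
  proof -
    note H = HomD[OF th(1)] HomD[OF uh] HomD[OF i[of n]] HomD[OF \<theta>h[of n]] HomD[OF is_iso_hom[OF y(1)]]
    show ?thesis
      unfolding \<sigma> by (simp add: H cat_simps F_simps y(2)[symmetric] eq_assoc[OF u(2)])
  qed
  with y(1) show ?thesis by blast
qed

end

section \<open>Pre-weight structures\<close>

context triangulated_category
begin

text \<open>An isomorphism \<open>Z \<rightarrow> Z'\<close> has zero cone, which exhibits
  \<open>Z'\<close> as an extension of a zero object by \<open>Z\<close>.\<close>

lemma ext_closed_iso:
  assumes X: "additive_subcategory T \<X>" "ext_product T \<X> \<X> \<subseteq> \<X>"
    and Z: "Z \<in> \<X>" and "isomorphic T Z Z'"
  shows "Z' \<in> \<X>"
proof -
  obtain a where a: "is_iso T Z Z' a"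
    using assms(4) by (auto simp: isomorphic_def)
  note ah = is_iso_hom[OF a]
  obtain O' where O: "O' \<in> \<X>" "zero_object T O'"
    using X(1) by (auto simp: additive_subcategory_def)
  have O': "O' \<in> Ob T"
    using O by (simp add: zero_object_def)
  note H = HomD[OF ah] O' sus_simps(1)[OF HomD(4)[OF ah]]
  have "exact_triangle T Z Z' O' a (hzero T Z' O') (hzero T O' (Sus Z))"
  proof (rule TR1_iso[OF TR1_ident[OF H(4) O(2)] _ ident_is_iso[OF H(4)] a ident_is_iso[OF O']])
    show "is_triangle T Z Z' O' a (hzero T Z' O') (hzero T O' (Sus Z))"
      unfolding is_triangle_def using ah hzero_hom H by auto
    show "ident T O' \<cdot> hzero T Z O' = hzero T Z' O' \<cdot> a"
      using ident_cmp[OF hzero_hom[OF H(4) O']] hzero_cmp[OF ah O'] by simp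
    show "sus (ident T Z) \<cdot> hzero T O' (Sus Z) = hzero T O' (Sus Z) \<cdot> ident T O'"
      using ident_cmp[OF hzero_hom[OF O' H(7)]] cmp_ident[OF hzero_hom[OF O' H(7)]] sus_simps(2)[OF H(4)]
      by simp
  qed simp
  then show ?thesis
    using X(2) Z O(1) unfolding ext_product_def by blast
qed

lemma shift_0_ext_closed:
  assumes "additive_subcategory T \<X>" "ext_product T \<X> \<X> \<subseteq> \<X>"
  shows "shift T 0 \<X> = \<X>"
proof
  show "shift T 0 \<X> \<subseteq> \<X>"
    using ext_closed_iso[OF assms] isomorphic_sym by (auto simp: shift_def shift_ob_def)
  show "\<X> \<subseteq> shift T 0 \<X>"
    using assms(1) by (intro shift_0) (simp add: additive_subcategory_def)
qed

text \<open>Both classes are closed under isomorphism, hence so is the core. A natural isomorphism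
  given on the core is therefore one on the essential image in degree 0, where the family
  \<open>E\<close> starts.\<close>

lemma shift_0_core:
  assumes "pre_weight_structure T Uge Ule"
  shows "shift T 0 (core Uge Ule) = core Uge Ule"
proof
  have U: "shift T 0 Uge = Uge" "shift T 0 Ule = Ule"
    using assms shift_0_ext_closed unfolding pre_weight_structure_def by blast+
  have "shift T 0 (core Uge Ule) \<subseteq> shift T 0 Uge" "shift T 0 (core Uge Ule) \<subseteq> shift T 0 Ule"
    by (auto simp: shift_def core_def)
  then show "shift T 0 (core Uge Ule) \<subseteq> core Uge Ule"
    unfolding U by (simp add: core_def)
  show "core Uge Ule \<subseteq> shift T 0 (core Uge Ule)"
    using assms by (intro shift_0) (auto simp: pre_weight_structure_def additive_subcategory_def core_def)
qed

lemma shift_1E: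
  assumes "Z \<in> shift T 1 \<X>"
  obtains X where "X \<in> \<X>" "isomorphic T Z (Sus X)"
  using assms by (auto simp: shift_def shift_ob_def)

end

text \<open>Preservation is recorded for sequences, the shape of the (co)products that define
  homotopy (co)limits; the index type no longer appears.\<close>

locale weight_identity = shift_identity T Fo Fm \<omega> "core Uge Ule" E
  for T :: "('o, 'm, 'z) tricat_scheme" (structure)
    and Fo :: "'o \<Rightarrow> 'o" and Fm :: "'m \<Rightarrow> 'm" and \<omega> :: "'o \<Rightarrow> 'm"
    and Uge Ule :: "'o set" and E :: "int \<Rightarrow> 'o \<Rightarrow> 'm" +
  assumes weight: "pre_weight_structure T Uge Ule"
    and convergent: "two_sided_convergent T Uge Ule"
    and F_coproduct: "\<And>(X :: nat \<Rightarrow> 'o) P inn. is_coproduct T UNIV X P inn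
      \<Longrightarrow> is_coproduct T UNIV (Fo \<circ> X) (Fo P) (Fm \<circ> inn)"
    and F_product: "\<And>(X :: nat \<Rightarrow> 'o) P pr. is_product T UNIV X P pr
      \<Longrightarrow> is_product T UNIV (Fo \<circ> X) (Fo P) (Fm \<circ> pr)"
begin

lemma Uge_Ob: "Uge \<subseteq> Ob T" and Ule_Ob: "Ule \<subseteq> Ob T"
  and shift_0_Uge: "shift T 0 Uge = Uge" and shift_0_Ule: "shift T 0 Ule = Ule"
  using weight shift_0_ext_closed unfolding pre_weight_structure_def additive_subcategory_def by auto

text \<open>Fixes cones of all \<open>\<phi> n\<close>. Of the morphisms to \<open>X\<close> only
  the one from stage 0 is kept, as the comparison with the core takes place there; its cone lies in
  \<open>U_le T Ule (- 1)\<close>, which is \<open>shift T 1 Ule\<close>.\<close>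

lemma left_tower_data:
  assumes "X \<in> Ule"
  obtains Xs \<iota> \<phi> Z p h H \<gamma> \<kappa> L l k
  where "Xs 0 \<in> D 0" "\<And>n. exact_triangle T (Xs n) (Xs (Suc n)) (Z n) (\<phi> n) (p n) (h n)"
    "\<And>n. Z n \<in> D (int n + 1)" "is_hocolim T Xs \<phi> H \<gamma>" "is_iso T H X \<kappa>" "\<kappa> \<cdot> \<gamma> 0 = \<iota>"
    "L \<in> shift T 1 Ule" "exact_triangle T (Xs 0) X L \<iota> l k"
proof -
  obtain Xs \<iota> \<phi> where t: "left_tower T Uge Ule X Xs \<iota> \<phi>" and c: "left_tower_convergent T X Xs \<iota> \<phi>"
    using convergent assms unfolding two_sided_convergent_def left_convergent_def by blast
  note t = t[unfolded left_tower_def, THEN conjunct2, rule_format]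
  have X0: "Xs 0 \<in> D 0"
    unfolding shift_0_core[OF weight] using t[of 0]
    by (simp add: U_between_def U_ge_def U_le_def shift_0_Uge shift_0_Ule core_def)
  have "\<exists>Z p h. Z \<in> D (int n + 1) \<and> exact_triangle T (Xs n) (Xs (Suc n)) Z (\<phi> n) p h" for n
    using t[of n] HomD[of "\<phi> n" "Xs n" "Xs (Suc n)"] by (auto simp: cone_in_def)
  then obtain Z p h where Z: "\<And>n. Z n \<in> D (int n + 1)"
    "\<And>n. exact_triangle T (Xs n) (Xs (Suc n)) (Z n) (\<phi> n) (p n) (h n)"
    by metis
  obtain L l k where L: "L \<in> shift T 1 Ule" "exact_triangle T (Xs 0) X L (\<iota> 0) l k"
    using t[of 0] HomD[of "\<iota> 0" "Xs 0" X] by (auto simp: cone_in_def U_le_def)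
  obtain H \<gamma> \<kappa> where "is_hocolim T Xs \<phi> H \<gamma>" "is_iso T H X \<kappa>" "\<kappa> \<cdot> \<gamma> 0 = \<iota> 0"
    using c unfolding left_tower_convergent_def by blast
  then show thesis
    using that[OF X0 Z(2,1) _ _ _ L] by blast
qed

lemma right_tower_data:
  assumes "Y \<in> Uge"
  obtains Ys \<pi> \<psi> Z q h H \<sigma> \<rho> K l k
  where "Ys 0 \<in> D 0" "\<And>n. exact_triangle T (Ys (Suc n)) (Ys n) (Z n) (\<psi> n) (q n) (h n)"
    "\<And>n. Z n \<in> D (- int n)" "is_holim T Ys \<psi> H \<sigma>" "is_iso T Y H \<rho>" "\<sigma> 0 \<cdot> \<rho> = \<pi>"
    "K \<in> Uge" "exact_triangle T Y (Ys 0) K \<pi> l k"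
proof -
  obtain Ys \<pi> \<psi> where t: "right_tower T Uge Ule Y Ys \<pi> \<psi>" and c: "right_tower_convergent T Y Ys \<pi> \<psi>"
    using convergent assms unfolding two_sided_convergent_def right_convergent_def by blast
  note t = t[unfolded right_tower_def, THEN conjunct2, rule_format]
  have Y0: "Ys 0 \<in> D 0"
    unfolding shift_0_core[OF weight] using t[of 0]
    by (simp add: U_between_def U_ge_def U_le_def shift_0_Uge shift_0_Ule core_def)
  have "\<exists>Z p h. Z \<in> D (- int n) \<and> exact_triangle T (Ys (Suc n)) (Ys n) Z (\<psi> n) p h" for n
    using t[of n] HomD[of "\<psi> n" "Ys (Suc n)" "Ys n"] by (auto simp: cone_in_def)
  then obtain Z q h where Z: "\<And>n. Z n \<in> D (- int n)"
    "\<And>n. exact_triangle T (Ys (Suc n)) (Ys n) (Z n) (\<psi> n) (q n) (h n)"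
    by metis
  obtain K l k where K: "K \<in> Uge" "exact_triangle T Y (Ys 0) K (\<pi> 0) l k"
    using t[of 0] HomD[of "\<pi> 0" Y "Ys 0"] by (auto simp: cone_in_def U_ge_def shift_0_Uge)
  obtain H \<sigma> l where "is_holim T Ys \<psi> H \<sigma>" "is_iso T Y H l" "\<sigma> 0 \<cdot> l = \<pi> 0"
    using c unfolding right_tower_convergent_def by blast
  then show thesis
    using that[OF Y0 Z(2,1) _ _ _ K] by blast
qed

text \<open>\<open>Y\<close> is a homotopy limit of stages with pieces in degrees at most 0, while
  \<open>W\<close> and \<open>Sus W\<close> both have positive degree.\<close>

lemma Uge_orth:
  assumes "Y \<in> Uge" and W: "W \<in> D j" "j > 0"
  shows "orth W Y"
proof -
  obtain Ys \<pi> \<psi> Z q h H \<sigma> l where Y0: "Ys 0 \<in> D 0"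
    and t: "\<And>n. exact_triangle T (Ys (Suc n)) (Ys n) (Z n) (\<psi> n) (q n) (h n)"
    and Z: "\<And>n. Z n \<in> D (- int n)" and H: "is_holim T Ys \<psi> H \<sigma>" and l: "is_iso T Y H l"
    using right_tower_data[OF assms(1)] by metis
  have "orth W H"
    using W(2) by (intro orth_holim[OF H right_tower_orth_from[OF Y0 t Z W]
          right_tower_orth_from[OF Y0 t Z D_Sus[OF W(1)]] D_Ob[OF W(1)]]) simp
  then show ?thesis
    using orth_iso[OF isomorphic_refl[OF D_Ob[OF W(1)]] isomorphic_sym] l unfolding isomorphic_def
    by blast
qed

text \<open>\<open>X\<close> is a homotopy colimit of stages with pieces in degrees at least 0. The
  condition on \<open>W\<close> passes to \<open>Des W\<close>, since morphisms from
  \<open>V\<close> to \<open>Des W\<close> correspond to morphisms from \<open>Sus V\<close> to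
  \<open>W\<close>.\<close>

lemma Ule_orth:
  assumes "X \<in> Ule" and W: "W \<in> Ob T" "\<And>j V. 0 \<le> j \<Longrightarrow> V \<in> D j \<Longrightarrow> orth V W"
  shows "orth X W"
proof -
  obtain Xs \<iota> \<phi> Z p h H \<gamma> \<kappa> where X0: "Xs 0 \<in> D 0"
    and t: "\<And>n. exact_triangle T (Xs n) (Xs (Suc n)) (Z n) (\<phi> n) (p n) (h n)"
    and Z: "\<And>n. Z n \<in> D (int n + 1)" and H: "is_hocolim T Xs \<phi> H \<gamma>" and \<kappa>: "is_iso T H X \<kappa>"
    using left_tower_data[OF assms(1)] by metis
  have W': "orth V (Des W)" if "0 \<le> j" "V \<in> D j" for j V
    using W(2)[OF _ D_Sus[OF that(2)]] that(1) orth_Sus_left_iff[OF D_Ob[OF that(2)] W(1)] by simp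
  have "orth H W"
    by (rule orth_hocolim[OF H left_tower_orth_to[OF X0 t Z W] left_tower_orth_to[OF X0 t Z sus_simps(7)[OF W(1)] W'] W(1)])
  then show ?thesis
    using orth_iso[OF _ isomorphic_refl[OF W(1)]] \<kappa> unfolding isomorphic_def by blast
qed

text \<open>Desuspending moves the question to morphisms from \<open>X\<close> to
  \<open>Des Y\<close>. For \<open>V\<close> of degree at least 0 its suspension has positive
  degree, where \<open>Uge_orth\<close> applies.\<close>

lemma Sus_Ule_orth_Uge:
  assumes "L \<in> shift T 1 Ule" "Y \<in> Uge"
  shows "orth L Y"
proof -
  obtain X where X: "X \<in> Ule" "isomorphic T L (Sus X)"
    using assms(1) by (rule shift_1E)
  have O: "X \<in> Ob T" "Y \<in> Ob T"
    using X(1) assms(2) Uge_Ob Ule_Ob by auto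
  have "orth X (Des Y)"
  proof (rule Ule_orth[OF X(1) sus_simps(7)[OF O(2)]])
    show "orth V (Des Y)" if "0 \<le> j" "V \<in> D j" for j V
      using Uge_orth[OF assms(2) D_Sus[OF that(2)]] that(1) orth_Sus_left_iff[OF D_Ob[OF that(2)] O(2)]
      by simp
  qed
  then have "orth (Sus X) Y"
    using O by (simp add: orth_Sus_left_iff)
  then show ?thesis
    using orth_iso[OF isomorphic_sym[OF X(2)] isomorphic_refl[OF O(2)]] by blast
qed

text \<open>The isomorphism on the homotopy colimit is conjugated by \<open>\<kappa>\<close>.
  Because \<open>\<kappa> \<cdot> \<gamma> 0\<close> is \<open>\<iota>\<close>, it still restricts
  to \<open>E 0\<close> on the stage in the core.\<close>

lemma Ule_iso:
  assumes "X \<in> Ule"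
  obtains X0 \<iota> L l k \<theta> where "X0 \<in> D 0" "L \<in> shift T 1 Ule" "exact_triangle T X0 X L \<iota> l k"
    "is_iso T (Fo X) X \<theta>" "\<theta> \<cdot> Fm \<iota> = \<iota> \<cdot> E 0 X0"
proof -
  obtain Xs \<iota> \<phi> Z p h H \<gamma> \<kappa> L l k where X0: "Xs 0 \<in> D 0"
    and t: "\<And>n. exact_triangle T (Xs n) (Xs (Suc n)) (Z n) (\<phi> n) (p n) (h n)"
    and Z: "\<And>n. Z n \<in> D (int n + 1)" and H: "is_hocolim T Xs \<phi> H \<gamma>" and \<kappa>: "is_iso T H X \<kappa>"
    and \<iota>: "\<kappa> \<cdot> \<gamma> 0 = \<iota>" and L: "L \<in> shift T 1 Ule" "exact_triangle T (Xs 0) X L \<iota> l k"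
    using left_tower_data[OF assms] by metis
  obtain \<theta> where \<theta>: "\<theta> 0 = E 0 (Xs 0)" "\<And>n. is_iso T (Fo (Xs n)) (Xs n) (\<theta> n)"
    "\<And>n. \<theta> (Suc n) \<cdot> Fm (\<phi> n) = \<phi> n \<cdot> \<theta> n"
    using left_tower_iso[OF X0 t Z] by metis
  obtain x where x: "is_iso T (Fo H) H x" "x \<cdot> Fm (\<gamma> 0) = \<gamma> 0 \<cdot> \<theta> 0"
    using hocolim_iso[OF H F_coproduct exact_hom(1)[OF t] \<theta>(2,3)] by blast
  obtain \<kappa>' where \<kappa>': "is_iso T X H \<kappa>'" "\<kappa>' \<cdot> \<kappa> = ident T H"
    using is_iso_inverse[OF \<kappa>] by blast
  note \<gamma>0 = hocolim_hom[OF H, of 0]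
  note H' = HomD[OF is_iso_hom[OF x(1)]] HomD[OF is_iso_hom[OF \<kappa>]] HomD[OF is_iso_hom[OF \<kappa>'(1)]]
    HomD[OF \<gamma>0] HomD[OF is_iso_hom[OF \<theta>(2)[of 0]]]
  have F\<kappa>: "Fm \<kappa>' \<cdot> Fm \<kappa> = ident T (Fo H)"
    using F_cmp[OF is_iso_hom[OF \<kappa>] is_iso_hom[OF \<kappa>'(1)]] \<kappa>'(2) H' by (simp add: F_simps)
  show thesis
  proof (rule that[OF X0 L])
    show "is_iso T (Fo X) X (\<kappa> \<cdot> (x \<cdot> Fm \<kappa>'))"
      by (rule is_iso_cmp[OF is_iso_cmp[OF F_is_iso[OF \<kappa>'(1)] x(1)] \<kappa>])
    show "(\<kappa> \<cdot> (x \<cdot> Fm \<kappa>')) \<cdot> Fm \<iota> = \<iota> \<cdot> E 0 (Xs 0)"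
      unfolding \<iota>[symmetric] \<theta>(1)[symmetric]
      by (simp add: H' cat_simps F_simps eq_assoc[OF F\<kappa>] x(2))
  qed
qed

lemma Uge_iso:
  assumes "Y \<in> Uge"
  obtains Y0 \<pi> K l k \<theta> where "Y0 \<in> D 0" "K \<in> Uge" "exact_triangle T Y Y0 K \<pi> l k"
    "is_iso T (Fo Y) Y \<theta>" "E 0 Y0 \<cdot> Fm \<pi> = \<pi> \<cdot> \<theta>"
proof -
  obtain Ys \<pi> \<psi> Z q h H \<sigma> \<rho> K l k where Y0: "Ys 0 \<in> D 0"
    and t: "\<And>n. exact_triangle T (Ys (Suc n)) (Ys n) (Z n) (\<psi> n) (q n) (h n)"
    and Z: "\<And>n. Z n \<in> D (- int n)" and H: "is_holim T Ys \<psi> H \<sigma>" and \<kappa>: "is_iso T Y H \<rho>"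
    and \<pi>: "\<sigma> 0 \<cdot> \<rho> = \<pi>" and K: "K \<in> Uge" "exact_triangle T Y (Ys 0) K \<pi> l k"
    using right_tower_data[OF assms] by metis
  obtain \<theta> where \<theta>: "\<theta> 0 = E 0 (Ys 0)" "\<And>n. is_iso T (Fo (Ys n)) (Ys n) (\<theta> n)"
    "\<And>n. \<theta> n \<cdot> Fm (\<psi> n) = \<psi> n \<cdot> \<theta> (Suc n)"
    using right_tower_iso[OF Y0 t Z] by metis
  obtain x where x: "is_iso T (Fo H) H x" "\<theta> 0 \<cdot> Fm (\<sigma> 0) = \<sigma> 0 \<cdot> x"
    using holim_iso[OF H F_product exact_hom(1)[OF t] \<theta>(2,3)] by blast
  obtain \<kappa>' where \<kappa>': "is_iso T H Y \<kappa>'" "\<rho> \<cdot> \<kappa>' = ident T H"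
    using is_iso_inverse[OF \<kappa>] by blast
  note \<sigma>0 = holim_hom[OF H, of 0]
  note H' = HomD[OF is_iso_hom[OF x(1)]] HomD[OF is_iso_hom[OF \<kappa>]] HomD[OF is_iso_hom[OF \<kappa>'(1)]]
    HomD[OF \<sigma>0] HomD[OF is_iso_hom[OF \<theta>(2)[of 0]]]
  show thesis
  proof (rule that[OF Y0 K])
    show "is_iso T (Fo Y) Y (\<kappa>' \<cdot> (x \<cdot> Fm \<rho>))"
      by (rule is_iso_cmp[OF is_iso_cmp[OF F_is_iso[OF \<kappa>] x(1)] \<kappa>'(1)])
    show "E 0 (Ys 0) \<cdot> Fm \<pi> = \<pi> \<cdot> (\<kappa>' \<cdot> (x \<cdot> Fm \<rho>))"
      unfolding \<pi>[symmetric] \<theta>(1)[symmetric]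
      by (simp add: H' cat_simps F_simps eq_assoc[OF \<kappa>'(2)] eq_assoc[OF x(2)])
  qed
qed

text \<open>\<open>\<pi>\<close> cancels because \<open>Sus X0\<close> has degree 1 and the cone
  \<open>K\<close> lies in \<open>Uge\<close>; then \<open>\<iota>\<close> cancels because its cone
  \<open>L\<close> is orthogonal to \<open>Y\<close>.\<close>

lemma Ule_Uge_hom_eqI:
  assumes Y: "Y \<in> Uge"
    and \<iota>: "X0 \<in> D 0" "L \<in> shift T 1 Ule" "exact_triangle T X0 X L \<iota> l k"
    and \<pi>: "K \<in> Uge" "exact_triangle T Y Y0 K \<pi> m n"
    and ab: "a \<in> Hom T X Y" "b \<in> Hom T X Y" "\<pi> \<cdot> (a \<cdot> \<iota>) = \<pi> \<cdot> (b \<cdot> \<iota>)"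
  shows "a = b"
proof (rule exact_cancel_right[OF \<iota>(3) Sus_Ule_orth_Uge[OF \<iota>(2) Y] ab(1,2)])
  note ih = exact_hom(1)[OF \<iota>(3)]
  have "orth (Sus X0) K"
    using Uge_orth[OF \<pi>(1) D_Sus[OF \<iota>(1)]] by simp
  then show "a \<cdot> \<iota> = b \<cdot> \<iota>"
    by (rule exact_cancel_left_fiber[OF \<pi>(2) _ cmp_hom[OF ih ab(1)] cmp_hom[OF ih ab(2)] ab(3)])
qed

text \<open>The weight decomposition \<open>Y \<rightarrow> A \<rightarrow> Z\<close> has
  \<open>Z\<close> isomorphic to some \<open>Sus X\<close>; rotating it backwards presents
  \<open>A\<close> as the cone of a morphism \<open>X \<rightarrow> Y\<close>.\<close>

lemma weight_triangle:
  assumes "A \<in> Ob T"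
  obtains X Y w f g where "X \<in> Ule" "Y \<in> Uge" "exact_triangle T X Y A w f g"
proof -
  have "A \<in> ext_product T Uge (shift T 1 Ule)"
    using weight assms by (simp add: pre_weight_structure_def)
  then obtain Y Z f g h where Y: "Y \<in> Uge" and Z: "Z \<in> shift T 1 Ule" and t: "exact_triangle T Y A Z f g h"
    unfolding ext_product_def by blast
  obtain X where X: "X \<in> Ule" "isomorphic T Z (Sus X)"
    using Z by (rule shift_1E)
  have O: "X \<in> Ob T" "Y \<in> Ob T"
    using X(1) Y Uge_Ob Ule_Ob by auto
  note th = exact_hom[OF t]
  obtain s where s: "is_iso T Z (Sus X) s"
    using X(2) by (auto simp: isomorphic_def)
  then obtain r where r: "r \<in> Hom T (Sus X) Z" "r \<cdot> s = ident T Z"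
    by (auto elim: is_isoE)
  note sh = is_iso_hom[OF s]
  note H = HomD[OF th(1)] HomD[OF th(2)] HomD[OF th(3)] HomD[OF sh] HomD[OF r(1)]
  obtain v where v: "v \<in> Hom T X Y" "sus v = h \<cdot> r"
    using sus_full[OF cmp_hom[OF r(1) th(3)] O] by blast
  \<comment> \<open>Rotating back requires the third morphism to be the negative of a suspension,
    hence the sign on \<open>v\<close>.\<close>
  have w: "\<boxminus> v \<in> Hom T X Y" "\<boxminus> (sus (\<boxminus> v)) = h \<cdot> r"
    using hneg_hom[OF v(1)] sus_hneg[OF v(1)] hneg_hneg[OF sus_hom[OF v(1)]] v(2) by simp_all
  have "exact_triangle T Y A (Sus X) f (s \<cdot> g) (\<boxminus> (sus (\<boxminus> v)))"
    unfolding w(2)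
  proof (rule TR1_iso[OF t _ ident_is_iso[OF O(2)] ident_is_iso[OF assms] s])
    show "is_triangle T Y A (Sus X) f (s \<cdot> g) (h \<cdot> r)"
      unfolding is_triangle_def using th sh r(1) cmp_hom by blast
  qed (simp_all add: H cat_simps sus_simps r(2))
  then have "exact_triangle T X Y A (\<boxminus> v) f (s \<cdot> g)"
    using TR2[of X Y A "\<boxminus> v" f "s \<cdot> g"] w(1) th(1) cmp_hom[OF th(2) sh]
    by (simp add: is_triangle_def)
  then show thesis
    using that X(1) Y by blast
qed

lemma F_isomorphic:
  assumes "A \<in> Ob T"
  shows "isomorphic T (Fo A) A"
proof -
  obtain X Y w f g where X: "X \<in> Ule" and Y: "Y \<in> Uge" and t: "exact_triangle T X Y A w f g"
    using weight_triangle[OF assms] by metis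
  obtain X0 \<iota> L l k x where \<iota>: "X0 \<in> D 0" "L \<in> shift T 1 Ule" "exact_triangle T X0 X L \<iota> l k"
    and x: "is_iso T (Fo X) X x" "x \<cdot> Fm \<iota> = \<iota> \<cdot> E 0 X0"
    using Ule_iso[OF X] by metis
  obtain Y0 \<pi> K m n y where \<pi>: "Y0 \<in> D 0" "K \<in> Uge" "exact_triangle T Y Y0 K \<pi> m n"
    and y: "is_iso T (Fo Y) Y y" "E 0 Y0 \<cdot> Fm \<pi> = \<pi> \<cdot> y"
    using Uge_iso[OF Y] by metis
  obtain r where r: "r \<in> Hom T X (Fo X)" "r \<cdot> x = ident T (Fo X)"
    using x(1) by (auto elim: is_isoE)
  note wh = exact_hom(1)[OF t] and ih = exact_hom(1)[OF \<iota>(3)] and ph = exact_hom(1)[OF \<pi>(3)]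
    and xh = is_iso_hom[OF x(1)] and yh = is_iso_hom[OF y(1)]
    and EX = is_iso_hom[OF E_iso[OF \<iota>(1)]] and EY = is_iso_hom[OF E_iso[OF \<pi>(1)]]
  note H = HomD[OF wh] HomD[OF ih] HomD[OF ph] HomD[OF xh] HomD[OF yh] HomD[OF EX] HomD[OF EY] HomD[OF r(1)]
  have a: "y \<cdot> (Fm w \<cdot> r) \<in> Hom T X Y"
    using r(1) F_hom[OF wh] yh cmp_hom by blast
  \<comment> \<open>The square is rewritten with the inverse \<open>r\<close> of \<open>x\<close>,
    so that both sides lie in \<open>Hom T X Y\<close>, where \<open>Ule_Uge_hom_eqI\<close> decides
    equality.\<close>
  have eq: "y \<cdot> (Fm w \<cdot> r) = w"
  proof (rule Ule_Uge_hom_eqI[OF Y \<iota> \<pi>(2,3) a wh])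
    have wi: "\<pi> \<cdot> (w \<cdot> \<iota>) \<in> Hom T X0 Y0"
      using ih wh ph cmp_hom by blast
    \<comment> \<open>Composing with \<open>E 0 X0\<close> brings in the compatibility of
      \<open>x\<close> with \<open>\<iota>\<close>, which cancels \<open>r\<close>; that of
      \<open>y\<close> with \<open>\<pi>\<close> then leaves the naturality square of
      \<open>\<pi> \<cdot> (w \<cdot> \<iota>)\<close>.\<close>
    have "(\<pi> \<cdot> (y \<cdot> (Fm w \<cdot> r) \<cdot> \<iota>)) \<cdot> E 0 X0 = E 0 Y0 \<cdot> Fm (\<pi> \<cdot> (w \<cdot> \<iota>))"
      by (simp add: H cat_simps F_simps x(2)[symmetric] eq_assoc[OF y(2)] eq_assoc[OF r(2)])
    also have "\<dots> = (\<pi> \<cdot> (w \<cdot> \<iota>)) \<cdot> E 0 X0"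
      by (rule E_natural[OF \<iota>(1) \<pi>(1) wi])
    finally show "\<pi> \<cdot> (y \<cdot> (Fm w \<cdot> r) \<cdot> \<iota>) = \<pi> \<cdot> (w \<cdot> \<iota>)"
      by (rule is_iso_cancel_right[OF E_iso[OF \<iota>(1)] cmp_hom[OF cmp_hom[OF ih a] ph] wi])
  qed
  have "y \<cdot> Fm w = (y \<cdot> (Fm w \<cdot> r)) \<cdot> x"
    by (simp add: H cat_simps F_simps r(2))
  then have "y \<cdot> Fm w = w \<cdot> x"
    unfolding eq .
  then show ?thesis
    using TR3_iso[OF F_exact[OF t] t x(1) y(1)] by (auto simp: isomorphic_def)
qed

end

theorem theorem5p6:
  fixes T :: "('o, 'm) tricat"
    and Uge Ule :: "'o set"
    and Fo :: "'o \<Rightarrow> 'o" and Fm :: "'m \<Rightarrow> 'm" and \<omega> \<eta> :: "'o \<Rightarrow> 'm"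
  assumes "triangulated_category T"
    and "pre_weight_structure T Uge Ule"
    and "triangle_endofunctor T Fo Fm \<omega>"
    and "natural_iso_on T (core Uge Ule) Fo Fm id id \<eta>"
    and "infinite (UNIV :: 'i set)"
    and "bi_complete TYPE('i) T"
    and "bi_continuous TYPE('i) T Fo Fm"
    and "two_sided_convergent T Uge Ule"
    and "\<And>n :: nat. n \<ge> 1 \<Longrightarrow>
           hom_vanishes T (core Uge Ule) (shift T (- int n) (core Uge Ule))"
  shows "\<forall>A \<in> Ob T. isomorphic T (Fo A) A"
proof -
  interpret triangle_functor T Fo Fm \<omega>
    using assms(1,3) by (simp add: triangle_functor_def triangle_functor_axioms_def)
  have C: "core Uge Ule \<subseteq> Ob T"
    using assms(2) by (auto simp: pre_weight_structure_def additive_subcategory_def core_def)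
  obtain E where E: "\<And>k. nat_iso (shift T k (core Uge Ule)) (E k)"
    "\<And>k Z. Z \<in> shift T k (core Uge Ule) \<Longrightarrow> E (k + 1) (Sus Z) = susp Z (E k Z)"
    using shift_nat_iso[OF C, of \<eta>] assms(4) unfolding shift_0_core[OF assms(2)] by metis
  \<comment> \<open>Infinity of the index type enters here, turning bi-continuity into preservation
    of sequential coproducts and products.\<close>
  interpret weight_identity T Fo Fm \<omega> Uge Ule E
    by unfold_locales (fact C assms E bi_continuous_sequences[OF assms(5,7)])+
  show ?thesis
    using F_isomorphic by blast
qed

end
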